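(* Let $\mathbf{T}=\{(z,w)\in\mathbf{C}^2 : |z|<|w|<1\}$ be the Hartogs triangle with boundary $b\mathbf{T}$. There exists a bounded linear operator $\tau:W^1(\mathbf{T})\to L^2(b\mathbf{T})$ with the property that $\tau f=f|_{b\mathbf{T}}$ for every continuous function $f$ on $\overline{\mathbf{T}}$ that belongs to $W^1(\mathbf{T})$.
   Context: $W^1(\mathbf{T})$ is the Sobolev space of $L^2$ functions on $\mathbf{T}$ with weak first-order derivatives in $L^2$. $L^2(b\mathbf{T})$ is taken with respect to the three-dimensional Hausdorff (surface) measure on $b\mathbf{T}$. *)

theory Defs
  imports "HOL-Analysis.Analysis"
begin

section \<open>Hausdorff measure\<close>

text \<open>
  The size of a covering set \<open>C\<close> is \<open>\<omega>\<^sub>n (diam C / 2)\<^sup>n\<close>, where \<open>\<omega>\<^sub>n\<close> is the volume of the unit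
  ball of \<open>\<real>\<^sup>n\<close>; with this normalisation the measure is the usual surface measure on
  \<open>n\<close>-dimensional submanifolds. The empty set is singled out because \<open>0 ^ 0 = 1\<close>.
\<close>

definition hausdorff_size :: "nat \<Rightarrow> 'a::metric_space set \<Rightarrow> ennreal" where
  "hausdorff_size n C =
     (if C = {} then 0 else ennreal (unit_ball_vol (real n) * (diameter C / 2) ^ n))"

definition hausdorff_content :: "nat \<Rightarrow> real \<Rightarrow> 'a::metric_space set \<Rightarrow> ennreal" where
  "hausdorff_content n \<delta> A =
     (INF C \<in> {C :: nat \<Rightarrow> 'a set. A \<subseteq> (\<Union>i. C i) \<and> (\<forall>i. bounded (C i) \<and> diameter (C i) \<le> \<delta>)}.
        \<Sum>i. hausdorff_size n (C i))"

definition hausdorff_outer :: "nat \<Rightarrow> 'a::metric_space set \<Rightarrow> ennreal" where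
  "hausdorff_outer n A = (SUP \<delta>\<in>{0<..}. hausdorff_content n \<delta> A)"

definition hausdorff_measure :: "nat \<Rightarrow> 'a::metric_space measure" where
  "hausdorff_measure n = measure_of UNIV (sets borel) (hausdorff_outer n)"

text \<open>
  \<^const>\<open>measure_of\<close> yields the zero measure unless it is given a measure; the following facts
  show that this does not happen here (see \<open>emeasure_hausdorff_measure\<close>).
\<close>

lemma hausdorff_size_empty [simp]: "hausdorff_size n {} = 0"
  by (simp add: hausdorff_size_def)

lemma hausdorff_content_le:
  assumes "A \<subseteq> (\<Union>i. C i)" "\<And>i. bounded (C i)" "\<And>i. diameter (C i) \<le> \<delta>"
  shows "hausdorff_content n \<delta> A \<le> (\<Sum>i. hausdorff_size n (C i))"
  unfolding hausdorff_content_def by (rule INF_lower) (use assms in auto)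

lemma hausdorff_content_empty: "0 < \<delta> \<Longrightarrow> hausdorff_content n \<delta> {} = 0"
  using hausdorff_content_le[of "{}" "\<lambda>_. {}" \<delta> n] by simp

lemma hausdorff_content_mono:
  "A \<subseteq> B \<Longrightarrow> hausdorff_content n \<delta> A \<le> hausdorff_content n \<delta> B"
  unfolding hausdorff_content_def by (rule INF_superset_mono) auto

lemma hausdorff_content_antimono:
  "\<delta> \<le> \<epsilon> \<Longrightarrow> hausdorff_content n \<epsilon> A \<le> hausdorff_content n \<delta> A"
  unfolding hausdorff_content_def by (rule INF_superset_mono) (auto intro: order_trans)

lemma hausdorff_content_subadditive:
  fixes A :: "nat \<Rightarrow> 'a::metric_space set"
  shows "hausdorff_content n \<delta> (\<Union>i. A i) \<le> (\<Sum>i. hausdorff_content n \<delta> (A i))"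
proof (rule ennreal_le_epsilon)
  fix e :: real
  assume fin: "(\<Sum>i. hausdorff_content n \<delta> (A i)) < top" and e: "0 < e"
  have "\<exists>C. A i \<subseteq> (\<Union>j. C j) \<and> (\<forall>j. bounded (C j) \<and> diameter (C j) \<le> \<delta>)
      \<and> (\<Sum>j. hausdorff_size n (C j)) < hausdorff_content n \<delta> (A i) + ennreal (e * (1/2) ^ Suc i)" for i
  proof -
    have "hausdorff_content n \<delta> (A i) < hausdorff_content n \<delta> (A i) + ennreal (e * (1/2) ^ Suc i)"
      using e fin by (auto simp: less_top dest!: ennreal_suminf_lessD)
    then show ?thesis
      unfolding hausdorff_content_def[of n \<delta> "A i"] INF_less_iff by blast
  qed
  then have "\<forall>i. \<exists>C. A i \<subseteq> (\<Union>j. C j) \<and> (\<forall>j. bounded (C j) \<and> diameter (C j) \<le> \<delta>)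
      \<and> (\<Sum>j. hausdorff_size n (C j)) < hausdorff_content n \<delta> (A i) + ennreal (e * (1/2) ^ Suc i)"
    by (rule allI)
  from choice[OF this] obtain C where C: "\<And>i. A i \<subseteq> (\<Union>j. C i j)" "\<And>i j. bounded (C i j)"
      "\<And>i j. diameter (C i j) \<le> \<delta>"
      "\<And>i. (\<Sum>j. hausdorff_size n (C i j)) < hausdorff_content n \<delta> (A i) + ennreal (e * (1/2) ^ Suc i)"
    by blast
  define B where "B k = C (fst (prod_decode k)) (snd (prod_decode k))" for k
  have "(\<Union>i. A i) \<subseteq> (\<Union>k. B k)"
  proof
    fix x assume "x \<in> (\<Union>i. A i)"
    then obtain i j where "x \<in> C i j" using C(1) by blast
    then have "x \<in> B (prod_encode (i, j))" by (simp add: B_def)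
    then show "x \<in> (\<Union>k. B k)" by blast
  qed
  then have "hausdorff_content n \<delta> (\<Union>i. A i) \<le> (\<Sum>k. hausdorff_size n (B k))"
    by (rule hausdorff_content_le) (simp_all only: B_def C(2,3))
  also have "\<dots> = (\<Sum>i. \<Sum>j. hausdorff_size n (C i j))"
    unfolding B_def
    using suminf_ennreal_2dimen[of "\<lambda>i. \<Sum>j. hausdorff_size n (C i j)" "\<lambda>p. hausdorff_size n (C (fst p) (snd p))"]
    by simp
  also have "\<dots> \<le> (\<Sum>i. hausdorff_content n \<delta> (A i) + ennreal (e * (1/2) ^ Suc i))"
    by (intro suminf_le summableI less_imp_le C(4))
  also have "\<dots> = (\<Sum>i. hausdorff_content n \<delta> (A i)) + (\<Sum>i. ennreal (e * (1/2) ^ Suc i))"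
    by (rule suminf_add[symmetric]) (rule summableI)+
  also have "(\<Sum>i. ennreal (e * (1/2) ^ Suc i)) = ennreal e"
  proof -
    have "(\<lambda>i. e * (1/2) ^ Suc i) sums e"
      using sums_mult[OF power_half_series, of e] by (simp only: mult_1_right)
    then show ?thesis
      by (rule suminf_ennreal_eq[rotated]) (use e in simp)
  qed
  finally show "hausdorff_content n \<delta> (\<Union>i. A i) \<le> (\<Sum>i. hausdorff_content n \<delta> (A i)) + ennreal e" .
qed

lemma hausdorff_content_le_outer: "0 < \<delta> \<Longrightarrow> hausdorff_content n \<delta> A \<le> hausdorff_outer n A"
  unfolding hausdorff_outer_def by (rule SUP_upper) auto

lemma hausdorff_outer_mono: "A \<subseteq> B \<Longrightarrow> hausdorff_outer n A \<le> hausdorff_outer n B"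
  unfolding hausdorff_outer_def by (rule SUP_mono') (rule hausdorff_content_mono)

lemma hausdorff_outer_empty [simp]: "hausdorff_outer n {} = 0"
  by (auto simp: hausdorff_outer_def hausdorff_content_empty)

lemma hausdorff_outer_subadditive:
  "hausdorff_outer n (\<Union>i. A i) \<le> (\<Sum>i. hausdorff_outer n (A i))"
  unfolding hausdorff_outer_def[of n "\<Union>i. A i"]
proof (rule SUP_least)
  fix \<delta> :: real assume "\<delta> \<in> {0<..}"
  then have "(\<Sum>i. hausdorff_content n \<delta> (A i)) \<le> (\<Sum>i. hausdorff_outer n (A i))"
    by (intro suminf_le summableI hausdorff_content_le_outer) auto
  with hausdorff_content_subadditive
  show "hausdorff_content n \<delta> (\<Union>i. A i) \<le> (\<Sum>i. hausdorff_outer n (A i))"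
    by (rule order_trans)
qed

lemma hausdorff_outer_measure_space: "outer_measure_space (Pow UNIV) (hausdorff_outer n)"
  by (auto simp: outer_measure_space_def positive_def increasing_def countably_subadditive_def
      hausdorff_outer_mono hausdorff_outer_subadditive)

lemma hausdorff_outer_Un: "hausdorff_outer n (A \<union> B) \<le> hausdorff_outer n A + hausdorff_outer n B"
proof -
  have "hausdorff_outer n (\<Union>i. binaryset A B i) \<le> (\<Sum>i. hausdorff_outer n (binaryset A B i))"
    by (rule hausdorff_outer_subadditive)
  then show ?thesis
    by (simp add: UN_binaryset_eq suminf_binaryset_eq)
qed

lemma hausdorff_content_separated:
  fixes A B :: "'a::metric_space set"
  assumes "\<delta> < d" and sep: "\<And>x y. x \<in> A \<Longrightarrow> y \<in> B \<Longrightarrow> d \<le> dist x y"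
  shows "hausdorff_content n \<delta> A + hausdorff_content n \<delta> B \<le> hausdorff_content n \<delta> (A \<union> B)"
  unfolding hausdorff_content_def[of n \<delta> "A \<union> B"]
proof (rule INF_greatest)
  fix C :: "nat \<Rightarrow> 'a set"
  assume "C \<in> {C. A \<union> B \<subseteq> (\<Union>i. C i) \<and> (\<forall>i. bounded (C i) \<and> diameter (C i) \<le> \<delta>)}"
  then have C: "A \<union> B \<subseteq> (\<Union>i. C i)" "\<And>i. bounded (C i)" "\<And>i. diameter (C i) \<le> \<delta>" by auto
  have C0: "\<delta> \<ge> 0" using C(3)[of 0] diameter_ge_0[OF C(2)[of 0]] by linarith
  define C1 where "C1 i = (if C i \<inter> A = {} then {} else C i)" for i
  define C2 where "C2 i = (if C i \<inter> B = {} then {} else C i)" for i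
  have "hausdorff_content n \<delta> A \<le> (\<Sum>i. hausdorff_size n (C1 i))"
  proof (rule hausdorff_content_le)
    show "A \<subseteq> (\<Union>i. C1 i)" using C(1) unfolding C1_def by fastforce
  qed (auto simp: C1_def C C0)
  moreover have "hausdorff_content n \<delta> B \<le> (\<Sum>i. hausdorff_size n (C2 i))"
  proof (rule hausdorff_content_le)
    show "B \<subseteq> (\<Union>i. C2 i)" using C(1) unfolding C2_def by fastforce
  qed (auto simp: C2_def C C0)
  ultimately have "hausdorff_content n \<delta> A + hausdorff_content n \<delta> B
      \<le> (\<Sum>i. hausdorff_size n (C1 i)) + (\<Sum>i. hausdorff_size n (C2 i))"
    by (rule add_mono)
  also have "\<dots> = (\<Sum>i. hausdorff_size n (C1 i) + hausdorff_size n (C2 i))"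
    by (rule suminf_add) (rule summableI)+
  also have "\<dots> \<le> (\<Sum>i. hausdorff_size n (C i))"
  proof (intro suminf_le summableI)
    fix i
    have False if "x \<in> C i" "x \<in> A" "y \<in> C i" "y \<in> B" for x y
      using diameter_bounded_bound[OF C(2) that(1,3)] C(3)[of i] sep[OF that(2,4)] assms(1) by linarith
    then have "C1 i = {} \<or> C2 i = {}" unfolding C1_def C2_def by auto
    moreover have "C1 i = {} \<or> C1 i = C i" "C2 i = {} \<or> C2 i = C i"
      unfolding C1_def C2_def by auto
    ultimately show "hausdorff_size n (C1 i) + hausdorff_size n (C2 i) \<le> hausdorff_size n (C i)"
      by auto
  qed
  finally show "hausdorff_content n \<delta> A + hausdorff_content n \<delta> B \<le> (\<Sum>i. hausdorff_size n (C i))" .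
qed

lemma hausdorff_outer_separated:
  fixes A B :: "'a::metric_space set"
  assumes "0 < d" and sep: "\<And>x y. x \<in> A \<Longrightarrow> y \<in> B \<Longrightarrow> d \<le> dist x y"
  shows "hausdorff_outer n A + hausdorff_outer n B \<le> hausdorff_outer n (A \<union> B)"
proof -
  have le: "hausdorff_content n \<delta> A + hausdorff_content n \<epsilon> B \<le> hausdorff_outer n (A \<union> B)"
    if "0 < \<delta>" "0 < \<epsilon>" for \<delta> \<epsilon>
  proof -
    define r where "r = min (min \<delta> \<epsilon>) (d / 2)"
    have r: "0 < r" "r < d" "r \<le> \<delta>" "r \<le> \<epsilon>" using that assms(1) unfolding r_def by auto
    have "hausdorff_content n \<delta> A + hausdorff_content n \<epsilon> B
        \<le> hausdorff_content n r A + hausdorff_content n r B"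
      by (intro add_mono hausdorff_content_antimono r)
    also have "\<dots> \<le> hausdorff_content n r (A \<union> B)"
      by (rule hausdorff_content_separated[OF r(2) sep])
    also have "\<dots> \<le> hausdorff_outer n (A \<union> B)"
      by (rule hausdorff_content_le_outer[OF r(1)])
    finally show ?thesis .
  qed
  have "hausdorff_outer n A + hausdorff_outer n B
      = (SUP \<delta>\<in>{0<..}. hausdorff_content n \<delta> A + hausdorff_outer n B)"
    unfolding hausdorff_outer_def[of n A] by (rule ennreal_SUP_add_left[symmetric]) auto
  also have "\<dots> \<le> hausdorff_outer n (A \<union> B)"
  proof (rule SUP_least)
    fix \<delta> :: real assume d: "\<delta> \<in> {0<..}"
    have "hausdorff_content n \<delta> A + hausdorff_outer n B
        = (SUP \<epsilon>\<in>{0<..}. hausdorff_content n \<delta> A + hausdorff_content n \<epsilon> B)"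
      unfolding hausdorff_outer_def by (rule ennreal_SUP_add_right) auto
    also have "\<dots> \<le> hausdorff_outer n (A \<union> B)"
      using d by (intro SUP_least le) auto
    finally show "hausdorff_content n \<delta> A + hausdorff_outer n B \<le> hausdorff_outer n (A \<union> B)" .
  qed
  finally show ?thesis .
qed

lemma hausdorff_outer_sum_separated:
  fixes D :: "nat \<Rightarrow> 'a::metric_space set"
  assumes sep: "\<And>i j. i < j \<Longrightarrow> \<exists>d>0. \<forall>k\<ge>j. \<forall>x\<in>D i. \<forall>y\<in>D k. d \<le> dist x y"
  shows "(\<Sum>i<m. hausdorff_outer n (D (i + l))) \<le> hausdorff_outer n (\<Union>i<m. D (i + l))"
proof (induction m arbitrary: l)
  case (Suc m)
  obtain d where d: "d > 0" "\<And>k x y. k \<ge> Suc l \<Longrightarrow> x \<in> D l \<Longrightarrow> y \<in> D k \<Longrightarrow> d \<le> dist x y"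
    using sep[of l "Suc l"] by auto
  have "(\<Sum>i<Suc m. hausdorff_outer n (D (i + l)))
      = hausdorff_outer n (D l) + (\<Sum>i<m. hausdorff_outer n (D (i + Suc l)))"
    by (simp only: sum.lessThan_Suc_shift) simp
  also have "\<dots> \<le> hausdorff_outer n (D l) + hausdorff_outer n (\<Union>i<m. D (i + Suc l))"
    by (intro add_left_mono Suc.IH)
  also have "\<dots> \<le> hausdorff_outer n (D l \<union> (\<Union>i<m. D (i + Suc l)))"
  proof (rule hausdorff_outer_separated[OF d(1)])
    fix x y assume "x \<in> D l" "y \<in> (\<Union>i<m. D (i + Suc l))"
    then obtain i where "y \<in> D (i + Suc l)" by blast
    with \<open>x \<in> D l\<close> show "d \<le> dist x y" by (intro d(2)[of "i + Suc l"]) auto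
  qed
  also have "D l \<union> (\<Union>i<m. D (i + Suc l)) = (\<Union>i<Suc m. D (i + l))"
    by (simp only: lessThan_Suc_eq_insert_0) auto
  finally show ?case .
qed simp

lemma closed_in_lambda_system_hausdorff:
  fixes F :: "'a::metric_space set"
  assumes "closed F"
  shows "F \<in> lambda_system UNIV (Pow UNIV) (hausdorff_outer n)"
proof -
  have "hausdorff_outer n (F \<inter> X) + hausdorff_outer n (X - F) \<le> hausdorff_outer n X" for X
  proof (cases "F = {} \<or> hausdorff_outer n X = top")
    case True
    then show ?thesis by auto
  next
    case False
    then have ne: "F \<noteq> {}" and fin: "hausdorff_outer n X \<noteq> top" by auto
    define E where "E k = {x \<in> X. 1 / real (Suc k) \<le> infdist x F}" for k
    define D where "D k = {x \<in> X. 1 / real (Suc (Suc k)) \<le> infdist x F \<and> infdist x F < 1 / real (Suc k)}" for k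
    have dist_ge: "1 / real (Suc i) - 1 / real (Suc j) \<le> dist x y"
      if "1 / real (Suc i) \<le> infdist x F" "infdist y F < 1 / real (Suc j)" for i j x y
      using infdist_triangle[of x F y] that by linarith
    have sep: "\<exists>d>0. \<forall>k\<ge>j. \<forall>x\<in>D (2 * i + r). \<forall>y\<in>D (2 * k + r). d \<le> dist x y"
      if "i < j" for i j r
    proof (intro exI conjI allI impI ballI)
      let ?d = "1 / real (Suc (Suc (2 * i + r))) - 1 / real (Suc (2 * j + r))"
      have "1 / real (Suc (2 * j + r)) < 1 / real (Suc (Suc (2 * i + r)))"
        using that by (intro divide_strict_left_mono) auto
      then show "0 < ?d" by simp
      fix k x y assume k: "j \<le> k" and x: "x \<in> D (2 * i + r)" and y: "y \<in> D (2 * k + r)"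
      have "1 / real (Suc (2 * k + r)) \<le> 1 / real (Suc (2 * j + r))"
        using k by (intro divide_left_mono) auto
      then show "?d \<le> dist x y"
        using dist_ge[of "Suc (2 * i + r)" x y "2 * k + r"] x y unfolding D_def by auto
    qed
    have half: "(\<Sum>k. hausdorff_outer n (D (2 * k + r))) \<le> hausdorff_outer n X" for r
    proof (rule suminf_le_const[OF summableI])
      fix m
      have "(\<Sum>k<m. hausdorff_outer n (D (2 * k + r))) \<le> hausdorff_outer n (\<Union>k<m. D (2 * k + r))"
        using hausdorff_outer_sum_separated[where D = "\<lambda>k. D (2 * k + r)" and l = 0 and m = m and n = n, OF sep]
        by simp
      also have "\<dots> \<le> hausdorff_outer n X"
        by (rule hausdorff_outer_mono) (auto simp: D_def)
      finally show "(\<Sum>k<m. hausdorff_outer n (D (2 * k + r))) \<le> hausdorff_outer n X" .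
    qed
    have sumD: "(\<Sum>k. hausdorff_outer n (D k)) < top"
    proof -
      have "(\<Sum>k. hausdorff_outer n (D k)) \<le> hausdorff_outer n X + hausdorff_outer n X"
      proof (rule suminf_le_const[OF summableI])
        fix m
        have "(\<Sum>k<m. hausdorff_outer n (D k)) \<le> (\<Sum>k<2 * m. hausdorff_outer n (D k))"
          by (rule sum_mono2) auto
        also have "\<dots> = (\<Sum>k<m. hausdorff_outer n (D (2 * k + 0)))
            + (\<Sum>k<m. hausdorff_outer n (D (2 * k + 1)))"
          by (induction m) (auto simp: ac_simps)
        also have "\<dots> \<le> (\<Sum>k. hausdorff_outer n (D (2 * k + 0)))
            + (\<Sum>k. hausdorff_outer n (D (2 * k + 1)))"
          by (intro add_mono sum_le_suminf summableI) auto
        also have "\<dots> \<le> hausdorff_outer n X + hausdorff_outer n X"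
          by (intro add_mono half)
        finally show "(\<Sum>k<m. hausdorff_outer n (D k)) \<le> hausdorff_outer n X + hausdorff_outer n X" .
      qed
      also have "\<dots> < top" using fin by (simp add: less_top)
      finally show ?thesis .
    qed
    have cover: "X - F \<subseteq> E m \<union> (\<Union>k. D (k + m))" for m
    proof
      fix x assume x: "x \<in> X - F"
      then have pos: "0 < infdist x F"
        using in_closed_iff_infdist_zero[OF assms ne, of x] infdist_nonneg[of x F] by auto
      define P where "P k \<longleftrightarrow> 1 / real (Suc k) \<le> infdist x F" for k
      have "\<exists>k. P k"
        using reals_Archimedean[OF pos] unfolding P_def by (auto simp: inverse_eq_divide intro: less_imp_le)
      then have L: "P (LEAST k. P k)" and nL: "\<And>k. k < (LEAST k. P k) \<Longrightarrow> \<not> P k"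
        by (auto intro: LeastI_ex dest: not_less_Least)
      define l where "l = (LEAST k. P k)"
      show "x \<in> E m \<union> (\<Union>k. D (k + m))"
      proof (cases "l \<le> m")
        case True
        then have "1 / real (Suc m) \<le> 1 / real (Suc l)" by (intro divide_left_mono) auto
        with L x show ?thesis unfolding E_def P_def l_def by auto
      next
        case False
        then obtain k where k: "l = Suc (k + m)"
          by (metis add.commute less_imp_Suc_add not_le)
        then have "x \<in> D (k + m)"
          using L nL[of "k + m"] x unfolding l_def[symmetric] unfolding D_def P_def k by auto
        then show ?thesis by blast
      qed
    qed
    have EF: "hausdorff_outer n (F \<inter> X) + hausdorff_outer n (E m) \<le> hausdorff_outer n X" for m
    proof -
      have "hausdorff_outer n (F \<inter> X) + hausdorff_outer n (E m) \<le> hausdorff_outer n (F \<inter> X \<union> E m)"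
      proof (rule hausdorff_outer_separated)
        show "0 < 1 / real (Suc m)" by simp
        fix x y assume "x \<in> F \<inter> X" "y \<in> E m"
        then show "1 / real (Suc m) \<le> dist x y"
          using infdist_le[of x F y] unfolding E_def by (auto simp: dist_commute)
      qed
      also have "\<dots> \<le> hausdorff_outer n X" by (rule hausdorff_outer_mono) (auto simp: E_def)
      finally show ?thesis .
    qed
    have bound: "hausdorff_outer n (F \<inter> X) + hausdorff_outer n (X - F)
        \<le> hausdorff_outer n X + (\<Sum>k. hausdorff_outer n (D (k + m)))" for m
    proof -
      have "hausdorff_outer n (X - F) \<le> hausdorff_outer n (E m \<union> (\<Union>k. D (k + m)))"
        by (rule hausdorff_outer_mono[OF cover])
      also have "\<dots> \<le> hausdorff_outer n (E m) + hausdorff_outer n (\<Union>k. D (k + m))"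
        by (rule hausdorff_outer_Un)
      also have "\<dots> \<le> hausdorff_outer n (E m) + (\<Sum>k. hausdorff_outer n (D (k + m)))"
        by (intro add_left_mono hausdorff_outer_subadditive)
      finally have "hausdorff_outer n (F \<inter> X) + hausdorff_outer n (X - F)
          \<le> (hausdorff_outer n (F \<inter> X) + hausdorff_outer n (E m)) + (\<Sum>k. hausdorff_outer n (D (k + m)))"
        by (simp add: add.assoc add_left_mono)
      also have "\<dots> \<le> hausdorff_outer n X + (\<Sum>k. hausdorff_outer n (D (k + m)))"
        by (intro add_right_mono EF)
      finally show ?thesis .
    qed
    have tail: "(\<lambda>m. \<Sum>k. hausdorff_outer n (D (k + m))) \<longlonglongrightarrow> 0"
    proof -
      define a where "a k = enn2real (hausdorff_outer n (D k))" for k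
      have ea: "hausdorff_outer n (D k) = ennreal (a k)" for k
        unfolding a_def using ennreal_suminf_lessD[OF sumD, of k] by simp
      have a0: "0 \<le> a k" for k unfolding a_def by simp
      have sa: "summable a"
        by (rule summable_suminf_not_top[OF a0]) (use sumD in \<open>auto simp: ea\<close>)
      have "(\<lambda>m. ennreal (\<Sum>k. a (k + m))) \<longlonglongrightarrow> ennreal 0"
        by (rule tendsto_ennrealI[OF suminf_exist_split2[OF sa]])
      moreover have "(\<Sum>k. hausdorff_outer n (D (k + m))) = ennreal (\<Sum>k. a (k + m))" for m
        unfolding ea using a0 summable_ignore_initial_segment[OF sa]
        by (intro suminf_ennreal2) auto
      ultimately show ?thesis by simp
    qed
    have "(\<lambda>m. hausdorff_outer n X + (\<Sum>k. hausdorff_outer n (D (k + m))))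
        \<longlonglongrightarrow> hausdorff_outer n X + 0"
      by (intro tendsto_add tendsto_const tail)
    from LIMSEQ_le_const[OF this] show ?thesis using bound by auto
  qed
  moreover have "hausdorff_outer n X \<le> hausdorff_outer n (F \<inter> X) + hausdorff_outer n (X - F)" for X
  proof -
    have "F \<inter> X \<union> (X - F) = X" by auto
    then show ?thesis using hausdorff_outer_Un[of n "F \<inter> X" "X - F"] by simp
  qed
  ultimately have "hausdorff_outer n (F \<inter> X) + hausdorff_outer n (X - F) = hausdorff_outer n X" for X
    by (rule antisym)
  moreover have "(UNIV - F) \<inter> X = X - F" for X by auto
  ultimately show ?thesis
    by (simp add: lambda_system_def)
qed

lemma measure_space_hausdorff: "measure_space UNIV (sets borel) (hausdorff_outer n)"
proof -
  let ?L = "lambda_system UNIV (Pow UNIV) (hausdorff_outer n)"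
  have ms: "measure_space UNIV ?L (hausdorff_outer n)"
    using sigma_algebra.caratheodory_lemma[OF sigma_algebra_Pow hausdorff_outer_measure_space] .
  then interpret L: sigma_algebra UNIV ?L unfolding measure_space_def by (rule conjunct1)
  have "sets borel \<subseteq> ?L"
    unfolding borel_eq_closed
    using L.sigma_sets_subset[of "Collect closed"] closed_in_lambda_system_hausdorff[of _ n]
    by (auto simp: sets_measure_of_conv)
  then show ?thesis
    using ms sets.sigma_algebra_axioms[of borel]
    by (auto simp: measure_space_def positive_def countably_additive_def)
qed

lemma space_hausdorff_measure [simp]: "space (hausdorff_measure n) = UNIV"
  by (simp add: hausdorff_measure_def space_measure_of_conv)

lemma sets_hausdorff_measure [simp, measurable_cong]: "sets (hausdorff_measure n) = sets borel"
  unfolding hausdorff_measure_def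
  using sets.sigma_sets_eq[of borel] by (simp add: sets_measure_of_conv)

lemma emeasure_hausdorff_measure:
  "A \<in> sets borel \<Longrightarrow> emeasure (hausdorff_measure n) A = hausdorff_outer n A"
  unfolding hausdorff_measure_def
  using measure_space_hausdorff[of n]
  by (intro emeasure_measure_of_sigma) (auto simp: measure_space_def)


section \<open>Square-integrable functions and the Sobolev space \<open>W\<^sup>1\<close>\<close>

text \<open>
  Elements of \<open>L\<^sup>2\<close> and \<open>W\<^sup>1\<close> are represented by functions, so that equality in these spaces is
  equality almost everywhere.
\<close>

definition L2_space :: "'a measure \<Rightarrow> ('a \<Rightarrow> complex) set" where
  "L2_space M = {f \<in> borel_measurable M. integrable M (\<lambda>x. (cmod (f x))\<^sup>2)}"

definition L2_norm :: "'a measure \<Rightarrow> ('a \<Rightarrow> complex) \<Rightarrow> real" where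
  "L2_norm M f = sqrt (LINT x|M. (cmod (f x))\<^sup>2)"

definition partial_deriv :: "'a::euclidean_space \<Rightarrow> ('a \<Rightarrow> complex) \<Rightarrow> 'a \<Rightarrow> complex" where
  "partial_deriv b f x = frechet_derivative f (at x) b"

text \<open>
  Differentiability of all iterated partial derivatives makes each of them continuous, so this is
  smoothness in the usual sense.
\<close>

definition smooth :: "('a::euclidean_space \<Rightarrow> complex) \<Rightarrow> bool" where
  "smooth f \<longleftrightarrow> (\<forall>bs. set bs \<subseteq> Basis \<longrightarrow> fold partial_deriv bs f differentiable_on UNIV)"

definition test_functions :: "'a::euclidean_space set \<Rightarrow> ('a \<Rightarrow> complex) set" where
  "test_functions \<Omega> =
     {\<phi>. smooth \<phi> \<and> compact (closure {x. \<phi> x \<noteq> 0}) \<and> closure {x. \<phi> x \<noteq> 0} \<subseteq> \<Omega>}"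

text \<open>
  For \<open>f\<close> and \<open>g\<close> in \<open>L\<^sup>2(\<Omega>)\<close>, the only case used below, both integrands are integrable.
\<close>

definition is_weak_deriv ::
    "'a::euclidean_space set \<Rightarrow> 'a \<Rightarrow> ('a \<Rightarrow> complex) \<Rightarrow> ('a \<Rightarrow> complex) \<Rightarrow> bool" where
  "is_weak_deriv \<Omega> b f g \<longleftrightarrow>
     (\<forall>\<phi>\<in>test_functions \<Omega>.
        (LINT x|lebesgue_on \<Omega>. f x * partial_deriv b \<phi> x) = - (LINT x|lebesgue_on \<Omega>. g x * \<phi> x))"

definition W1_space :: "'a::euclidean_space set \<Rightarrow> ('a \<Rightarrow> complex) set" where
  "W1_space \<Omega> =
     {f \<in> L2_space (lebesgue_on \<Omega>).
        \<forall>b\<in>Basis. \<exists>g\<in>L2_space (lebesgue_on \<Omega>). is_weak_deriv \<Omega> b f g}"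

text \<open>Weak derivatives are unique up to null sets, so the choice of \<open>g\<close> is immaterial for the norm.\<close>

definition weak_deriv ::
    "'a::euclidean_space set \<Rightarrow> 'a \<Rightarrow> ('a \<Rightarrow> complex) \<Rightarrow> 'a \<Rightarrow> complex" where
  "weak_deriv \<Omega> b f = (SOME g. g \<in> L2_space (lebesgue_on \<Omega>) \<and> is_weak_deriv \<Omega> b f g)"

definition W1_norm :: "'a::euclidean_space set \<Rightarrow> ('a \<Rightarrow> complex) \<Rightarrow> real" where
  "W1_norm \<Omega> f =
     sqrt ((L2_norm (lebesgue_on \<Omega>) f)\<^sup>2
           + (\<Sum>b\<in>Basis. (L2_norm (lebesgue_on \<Omega>) (weak_deriv \<Omega> b f))\<^sup>2))"


section \<open>The Hartogs triangle\<close>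

definition hartogs_triangle :: "(complex \<times> complex) set" where
  "hartogs_triangle = {(z, w). cmod z < cmod w \<and> cmod w < 1}"

definition hartogs_surface_measure :: "(complex \<times> complex) measure" where
  "hartogs_surface_measure = restrict_space (hausdorff_measure 3) (frontier hartogs_triangle)"

text \<open>
  A map on representatives that descends to a bounded complex-linear operator
  \<open>W\<^sup>1(\<Omega>) \<rightarrow> L\<^sup>2(M)\<close> between the spaces of almost-everywhere classes.
\<close>

definition bounded_operator_W1_L2 ::
    "'a::euclidean_space set \<Rightarrow> 'b measure \<Rightarrow> (('a \<Rightarrow> complex) \<Rightarrow> 'b \<Rightarrow> complex) \<Rightarrow> bool" where
  "bounded_operator_W1_L2 \<Omega> M \<tau> \<longleftrightarrow>
     (\<forall>f\<in>W1_space \<Omega>. \<tau> f \<in> L2_space M) \<and>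
     (\<forall>f\<in>W1_space \<Omega>. \<forall>g\<in>W1_space \<Omega>.
        (AE x in lebesgue_on \<Omega>. f x = g x) \<longrightarrow> (AE y in M. \<tau> f y = \<tau> g y)) \<and>
     (\<forall>f\<in>W1_space \<Omega>. \<forall>g\<in>W1_space \<Omega>. AE y in M. \<tau> (\<lambda>x. f x + g x) y = \<tau> f y + \<tau> g y) \<and>
     (\<forall>c. \<forall>f\<in>W1_space \<Omega>. AE y in M. \<tau> (\<lambda>x. c * f x) y = c * \<tau> f y) \<and>
     (\<exists>C. \<forall>f\<in>W1_space \<Omega>. L2_norm M (\<tau> f) \<le> C * W1_norm \<Omega> f)"

end

theory Submission
  imports Defs
begin

text \<open>
  The trace of \<open>f\<close> at a boundary point \<open>y\<close> is taken along a straight segment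
  \<open>y + t e(y)\<close>, \<open>0 < t < 1/20\<close>, that enters the domain: it is the limit of the averages of \<open>f\<close> over
  shorter and shorter initial parts of the segment. For continuous \<open>f\<close> this limit is \<open>f y\<close> at
  every boundary point, so everything rests on one estimate for \<open>f \<in> W\<^sup>1\<close>: the limit exists
  for almost every \<open>y\<close>, and its \<open>L\<^sup>2\<close> norm is bounded by the Sobolev norm of \<open>f\<close>.

  On a single segment the estimate is the fundamental theorem of calculus. If \<open>F\<close> and \<open>G\<close> are
  square integrable on \<open>[0, \<delta>]\<close> and \<open>F(s + r) - F(s)\<close> is the integral of \<open>G\<close> over \<open>[s, s + r]\<close> for
  almost all \<open>s\<close> and \<open>r\<close>, then \<open>F\<close> agrees almost everywhere with \<open>c\<close> plus a primitive of \<open>G\<close> that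
  vanishes at \<open>0\<close>; the averages tend to \<open>c\<close>, and \<open>|c|\<^sup>2\<close> is controlled by the integrals of
  \<open>|F|\<^sup>2\<close> and \<open>|G|\<^sup>2\<close> (\<open>line_trace\<close>). That the restrictions of \<open>f\<close> and of its weak derivative to almost every
  segment have this property follows by testing the weak derivative with the integrals of a bump
  function along the segments (\<open>weak_derivative_increment\<close>).

  To integrate the estimate over a set \<open>S\<close> of boundary points with the same direction \<open>e\<close>, one
  needs \<open>\<integral>\<^sub>S \<integral> h(y + t e) dt dH(y) \<le> C \<integral> h(x) dx\<close>, where \<open>H\<close> is Hausdorff measure of codimension one.
  This holds as soon as \<open>S\<close> is a Lipschitz graph over the hyperplanes transversal to \<open>e\<close>. No
  parametrization and no change of variables is involved: it suffices to test the inequality on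
  cubes, and a cube of side \<open>s\<close> meets only those lines whose base points form a part of \<open>S\<close> of
  measure \<open>O(s\<^sup>n\<^sup>-\<^sup>1)\<close>, each in a segment of length \<open>O(s)\<close> (\<open>transversal_line_integral_bound\<close>).

  The Hartogs triangle is not a Lipschitz domain at the origin, but this does no harm. The
  boundary is cut into pieces according to the coordinate half-axes nearest to \<open>z\<close> and to
  \<open>w\<close>, the face \<open>|w| = 1\<close> or \<open>|z| = |w|\<close>, and the size of \<open>z\<close>. Near the origin the
  boundary is the cone \<open>|z| = |w|\<close>, and moving \<open>w\<close> along its half-axis keeps \<open>z\<close> fixed and increases \<open>|w|\<close>, with constants that do not depend on the distance to the origin.
  Away from the origin a fixed direction that enters the domain is easily found
  (\<open>direction_enters\<close>, \<open>piece_transversal\<close>).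
\<close>

section \<open>Bump functions supported in boxes\<close>

text \<open>
  The flat function \<open>exp (-1/s)\<close>, extended by zero, divided by powers of \<open>s\<close>. The powers are there
  because differentiation produces them; the derivatives then stay in the family.
\<close>

definition flat :: "nat \<Rightarrow> real \<Rightarrow> real" where
  "flat m s = (if s \<le> 0 then 0 else exp (- (1 / s)) / s ^ m)"

lemma flat_bound:
  assumes "0 < s"
  shows "flat m s \<le> fact (m + 2) * s\<^sup>2"
proof -
  let ?k = "m + 2"
  have "(\<Sum>i\<in>{?k}. inverse (fact i) * (1 / s) ^ i) \<le> exp (1 / s)"
    unfolding exp_def real_scaleR_def[symmetric]
    by (rule sum_le_suminf) (use assms summable_exp_generic[of "1 / s"] in auto)
  then have "(1 / s) ^ ?k / fact ?k \<le> exp (1 / s)"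
    by (simp add: field_simps)
  then have "inverse (exp (1 / s)) \<le> inverse ((1 / s) ^ ?k / fact ?k)"
    by (rule le_imp_inverse_le) (use assms in simp)
  then have "exp (- (1 / s)) \<le> fact ?k * s ^ ?k"
    by (simp add: exp_minus power_one_over inverse_eq_divide mult_ac)
  then have "exp (- (1 / s)) / s ^ m \<le> fact ?k * s ^ ?k / s ^ m"
    by (rule divide_right_mono) (use assms in simp)
  also have "\<dots> = fact ?k * s\<^sup>2"
    using assms by (simp add: power_add power2_eq_square)
  finally show ?thesis using assms by (simp add: flat_def)
qed

text \<open>
  One formula covers both half-lines and the point \<open>0\<close>, where the difference quotient tends to \<open>0\<close>
  because of the quadratic bound above.
\<close>

lemma flat_has_derivative:
  "(flat m has_real_derivative (flat (m + 2) s - real m * flat (m + 1) s)) (at s)"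
proof -
  consider "s < 0" | "s = 0" | "0 < s" by linarith
  then show ?thesis
  proof cases
    case 1
    have "((\<lambda>_. 0) has_real_derivative 0) (at s)" by simp
    then have "(flat m has_real_derivative 0) (at s)"
      by (rule has_field_derivative_transform_within_open[of _ _ _ "{..<0}"])
        (use 1 in \<open>auto simp: flat_def\<close>)
    then show ?thesis using 1 by (simp add: flat_def)
  next
    case 2
    have "((\<lambda>h. flat m h / h) \<longlongrightarrow> 0) (at 0)"
    proof (rule Lim_null_comparison)
      show "\<forall>\<^sub>F h in at 0. norm (flat m h / h) \<le> fact (m + 2) * \<bar>h\<bar>"
      proof (rule eventuallyI)
        fix h :: real
        show "norm (flat m h / h) \<le> fact (m + 2) * \<bar>h\<bar>"
        proof (cases "0 < h")
          case True
          then have "flat m h / h \<le> fact (m + 2) * h"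
            using flat_bound[OF True, of m] by (simp add: field_simps power2_eq_square)
          then show ?thesis using True by (simp add: flat_def)
        next
          case False
          have "0 \<le> fact (m + 2) * \<bar>h\<bar>" by (rule mult_nonneg_nonneg) auto
          with False show ?thesis by (simp only: flat_def not_less if_True div_0 norm_zero)
        qed
      qed
      show "((\<lambda>h::real. fact (m + 2) * \<bar>h\<bar>) \<longlongrightarrow> 0) (at 0)"
        by (auto intro!: tendsto_eq_intros)
    qed
    then have "(flat m has_real_derivative 0) (at 0)"
      unfolding DERIV_def by (simp add: flat_def[of m 0])
    then show ?thesis using 2 by (simp add: flat_def[of _ 0])
  next
    case 3
    have i: "((\<lambda>s. - (1 / s)) has_real_derivative 1 / s\<^sup>2) (at s)"
      using 3 by (auto intro!: derivative_eq_intros simp: power2_eq_square)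
    have "((\<lambda>s. exp (- (1 / s)) / s ^ m) has_real_derivative
       ((exp (- (1 / s)) * (1 / s\<^sup>2)) * s ^ m - exp (- (1 / s)) * (real m * s ^ (m - 1))) / (s ^ m * s ^ m)) (at s)"
      by (rule DERIV_divide[OF DERIV_chain2[OF DERIV_exp i]])
        (use 3 in \<open>auto intro!: derivative_eq_intros\<close>)
    moreover have "((exp (- (1 / s)) * (1 / s\<^sup>2)) * s ^ m - exp (- (1 / s)) * (real m * s ^ (m - 1))) / (s ^ m * s ^ m)
        = exp (- (1 / s)) / s ^ (m + 2) - real m * (exp (- (1 / s)) / s ^ (m + 1))"
      using 3 by (cases m) (simp_all add: field_simps power2_eq_square)
    ultimately have "((\<lambda>s. exp (- (1 / s)) / s ^ m) has_real_derivative
       (exp (- (1 / s)) / s ^ (m + 2) - real m * (exp (- (1 / s)) / s ^ (m + 1)))) (at s)"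
      by simp
    then have "(flat m has_real_derivative
       (exp (- (1 / s)) / s ^ (m + 2) - real m * (exp (- (1 / s)) / s ^ (m + 1)))) (at s)"
      by (rule has_field_derivative_transform_within_open[of _ _ _ "{0<..}"])
        (use 3 in \<open>auto simp: flat_def\<close>)
    then show ?thesis using 3 by (simp add: flat_def)
  qed
qed

text \<open>
  This algebra contains the bump functions below, and partial differentiation maps it to itself.
  Smoothness of its members is then an induction on the number of derivatives, with no explicit
  formula for the higher derivatives.
\<close>

inductive flat_algebra :: "('a::euclidean_space \<Rightarrow> complex) \<Rightarrow> bool" where
  const: "flat_algebra (\<lambda>x. c)"
| flat: "flat_algebra (\<lambda>x. complex_of_real (flat m (c + x \<bullet> v)))"
| add: "flat_algebra f \<Longrightarrow> flat_algebra g \<Longrightarrow> flat_algebra (\<lambda>x. f x + g x)"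
| mult: "flat_algebra f \<Longrightarrow> flat_algebra g \<Longrightarrow> flat_algebra (\<lambda>x. f x * g x)"

lemma partial_deriv_eqI: "(f has_derivative D) (at x) \<Longrightarrow> partial_deriv b f x = D b"
  unfolding partial_deriv_def by (metis frechet_derivative_at)

lemma flat_algebra_step:
  assumes "flat_algebra f"
  shows "f differentiable_on UNIV \<and> (\<forall>b. flat_algebra (partial_deriv b f))"
  using assms
proof (induction rule: flat_algebra.induct)
  case (const c)
  have "partial_deriv b (\<lambda>x::'a. c) = (\<lambda>x. 0)" for b
    by (rule ext, subst partial_deriv_eqI[where D = "\<lambda>_. 0"]) auto
  then show ?case by (auto intro: flat_algebra.const)
next
  case (flat m c v)
  have D: "((\<lambda>x. complex_of_real (flat m (c + x \<bullet> v))) has_derivative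
      (\<lambda>h. complex_of_real ((flat (m + 2) (c + x \<bullet> v) - real m * flat (m + 1) (c + x \<bullet> v)) * (h \<bullet> v)))) (at x)" for x
  proof -
    have "((\<lambda>x. flat m (c + x \<bullet> v)) has_derivative
      (\<lambda>h. (flat (m + 2) (c + x \<bullet> v) - real m * flat (m + 1) (c + x \<bullet> v)) * (h \<bullet> v))) (at x)"
      by (rule has_derivative_compose[of "\<lambda>x. c + x \<bullet> v" "\<lambda>h. h \<bullet> v", OF _ flat_has_derivative[unfolded has_field_derivative_def]])
        (auto intro!: derivative_eq_intros)
    from bounded_linear.has_derivative[OF bounded_linear_of_real this] show ?thesis by simp
  qed
  have "flat_algebra (partial_deriv b (\<lambda>x. complex_of_real (flat m (c + x \<bullet> v))))" for b
  proof -
    have "partial_deriv b (\<lambda>x. complex_of_real (flat m (c + x \<bullet> v))) =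
      (\<lambda>x. complex_of_real (b \<bullet> v) * complex_of_real (flat (m + 2) (c + x \<bullet> v))
        + complex_of_real (- real m * (b \<bullet> v)) * complex_of_real (flat (m + 1) (c + x \<bullet> v)))"
      by (rule ext, subst partial_deriv_eqI[OF D]) (simp add: algebra_simps)
    then show ?thesis by (simp only:) (intro flat_algebra.intros)
  qed
  then show ?case using D by (auto simp: differentiable_on_def differentiable_def)
next
  case (add f g)
  then have d: "(f has_derivative frechet_derivative f (at x)) (at x)" "(g has_derivative frechet_derivative g (at x)) (at x)" for x
    by (auto simp: frechet_derivative_works[symmetric] differentiable_on_def)
  have "partial_deriv b (\<lambda>x. f x + g x) = (\<lambda>x. partial_deriv b f x + partial_deriv b g x)" for b
    by (rule ext, subst partial_deriv_eqI[OF has_derivative_add[OF d]]) (simp add: partial_deriv_def)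
  then show ?case using add by (auto intro: flat_algebra.add)
next
  case (mult f g)
  then have d: "(f has_derivative frechet_derivative f (at x)) (at x)" "(g has_derivative frechet_derivative g (at x)) (at x)" for x
    by (auto simp: frechet_derivative_works[symmetric] differentiable_on_def)
  have "partial_deriv b (\<lambda>x. f x * g x) = (\<lambda>x. f x * partial_deriv b g x + partial_deriv b f x * g x)" for b
    by (rule ext, subst partial_deriv_eqI[OF has_derivative_mult[OF d]]) (simp add: partial_deriv_def)
  then show ?case using mult by (auto intro!: flat_algebra.add flat_algebra.mult differentiable_on_mult)
qed

lemma flat_algebra_smooth:
  assumes "flat_algebra f"
  shows "smooth f"
proof -
  have "flat_algebra (fold partial_deriv bs f)" for bs
    using assms by (induction bs arbitrary: f) (auto simp: flat_algebra_step)
  then show ?thesis by (auto simp: smooth_def flat_algebra_step)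
qed

lemma flat_algebra_prod:
  "finite A \<Longrightarrow> (\<And>i. i \<in> A \<Longrightarrow> flat_algebra (f i)) \<Longrightarrow> flat_algebra (\<lambda>x. \<Prod>i\<in>A. f i x)"
  by (induction A rule: finite_induct) (auto intro: flat_algebra.const flat_algebra.mult)

text \<open>
  As \<open>n\<close> grows the factors tend to \<open>1\<close> inside the box, so these functions approximate the indicator
  of the box boundedly and pointwise. That is all that dominated convergence asks for.
\<close>

definition box_bump :: "nat \<Rightarrow> 'a::euclidean_space \<Rightarrow> 'a \<Rightarrow> 'a \<Rightarrow> real" where
  "box_bump n l u x = (\<Prod>b\<in>Basis. flat 0 (real (Suc n) * (x \<bullet> b - l \<bullet> b)) * flat 0 (real (Suc n) * (u \<bullet> b - x \<bullet> b)))"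

lemma box_bump_smooth: "smooth (\<lambda>x. complex_of_real (box_bump n l u x))"
proof (rule flat_algebra_smooth)
  have "(\<lambda>x. complex_of_real (box_bump n l u x)) =
    (\<lambda>x. \<Prod>b\<in>Basis. complex_of_real (flat 0 (- real (Suc n) * (l \<bullet> b) + x \<bullet> (real (Suc n) *\<^sub>R b)))
       * complex_of_real (flat 0 (real (Suc n) * (u \<bullet> b) + x \<bullet> (- real (Suc n) *\<^sub>R b))))"
    unfolding box_bump_def by (simp add: algebra_simps)
  then show "flat_algebra (\<lambda>x. complex_of_real (box_bump n l u x))"
    by (simp only:) (intro flat_algebra_prod flat_algebra.intros finite_Basis)
qed

lemma flat_0_bounds: "0 \<le> flat 0 s" "flat 0 s \<le> 1" "flat 0 s > 0 \<longleftrightarrow> s > 0"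
  by (auto simp: flat_def)

lemma box_bump_bounds: "0 \<le> box_bump n l u x" "box_bump n l u x \<le> 1"
  unfolding box_bump_def
  by (auto intro!: prod_nonneg prod_le_1 mult_le_one mult_nonneg_nonneg flat_0_bounds)

lemma box_bump_nonzero: "box_bump n l u x \<noteq> 0 \<longleftrightarrow> x \<in> box l u"
proof -
  have "flat 0 s \<noteq> 0 \<longleftrightarrow> 0 < s" for s using flat_0_bounds[of s] by auto
  then show ?thesis
    unfolding box_bump_def mem_box by (auto simp: zero_less_mult_iff)
qed

lemma box_bump_tendsto: "(\<lambda>n. box_bump n l u x) \<longlonglongrightarrow> indicat_real (box l u) x"
proof (cases "x \<in> box l u")
  case False
  then have "box_bump n l u x = 0" for n using box_bump_nonzero by blast
  with False show ?thesis by simp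
next
  case True
  have *: "(\<lambda>n. flat 0 (real (Suc n) * s)) \<longlonglongrightarrow> 1" if "0 < s" for s :: real
  proof -
    have "(\<lambda>n. exp (- ((1 / s) * inverse (real (Suc n))))) \<longlonglongrightarrow> exp (- ((1 / s) * 0))"
      by (intro tendsto_intros LIMSEQ_inverse_real_of_nat)
    then show ?thesis using that
      by (simp add: flat_def zero_less_mult_iff not_le[symmetric] mult_le_0_iff field_simps del: of_nat_Suc)
  qed
  have "(\<lambda>n. box_bump n l u x) \<longlonglongrightarrow> (\<Prod>b\<in>(Basis::'a set). 1 * 1)"
    unfolding box_bump_def using True
    by (intro tendsto_prod tendsto_mult *) (auto simp: mem_box)
  then show ?thesis using True by simp
qed

section \<open>Integrating a test function along a direction\<close>

lemma smooth_has_derivative: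
  assumes "smooth \<phi>"
  shows "(\<phi> has_derivative frechet_derivative \<phi> (at x)) (at x)"
proof -
  have "\<phi> differentiable_on UNIV"
    using assms[unfolded smooth_def, rule_format, of "[]"] by simp
  then show ?thesis by (auto simp: frechet_derivative_works[symmetric] differentiable_on_def)
qed

lemma smooth_partial_deriv:
  assumes "smooth \<phi>" "b \<in> Basis"
  shows "smooth (partial_deriv b \<phi>)"
  unfolding smooth_def
proof (intro allI impI)
  fix bs :: "'a list" assume "set bs \<subseteq> Basis"
  then show "fold partial_deriv bs (partial_deriv b \<phi>) differentiable_on UNIV"
    using assms(1)[unfolded smooth_def, rule_format, of "b # bs"] assms(2) by simp
qed

lemma smooth_continuous_on: "smooth \<phi> \<Longrightarrow> continuous_on A \<phi>"
  by (meson continuous_at_imp_continuous_on has_derivative_continuous smooth_has_derivative)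

lemma frechet_derivative_eq_sum:
  assumes "smooth \<phi>"
  shows "frechet_derivative \<phi> (at x) h = (\<Sum>b\<in>Basis. (h \<bullet> b) *\<^sub>R partial_deriv b \<phi> x)"
proof -
  have "linear (frechet_derivative \<phi> (at x))"
    using smooth_has_derivative[OF assms] has_derivative_linear by blast
  then have "frechet_derivative \<phi> (at x) (\<Sum>b\<in>Basis. (h \<bullet> b) *\<^sub>R b)
      = (\<Sum>b\<in>Basis. (h \<bullet> b) *\<^sub>R frechet_derivative \<phi> (at x) b)"
    by (simp add: linear_sum linear_cmul)
  then show ?thesis by (simp add: euclidean_representation partial_deriv_def)
qed

text \<open>
  The integral of \<open>\<phi>\<close> over a segment of direction \<open>-e\<close> that starts at \<open>x\<close>. As a test function its
  derivative along \<open>e\<close> is the difference of \<open>\<phi>\<close> and a translate of \<open>\<phi>\<close>, which turns the definition of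
  a weak derivative into a statement about increments.
\<close>

definition smear :: "real \<Rightarrow> 'a::euclidean_space \<Rightarrow> ('a \<Rightarrow> complex) \<Rightarrow> 'a \<Rightarrow> complex" where
  "smear t e \<phi> x = integral {0..t} (\<lambda>r. \<phi> (x - r *\<^sub>R e))"

text \<open>
  Differentiation under the integral sign. The derivative of \<open>\<phi>\<close> has to depend continuously on the
  point in operator norm, which is visible when it is written as a sum over partial derivatives.
\<close>

lemma smear_has_derivative:
  assumes "smooth \<phi>"
  shows "(smear t e \<phi> has_derivative (\<lambda>h. integral {0..t} (\<lambda>r. frechet_derivative \<phi> (at (x - r *\<^sub>R e)) h))) (at x)"
proof -
  define D where "D y = (\<Sum>b\<in>Basis. blinfun_scaleR_left (partial_deriv b \<phi> y) o\<^sub>L blinfun_inner_left b)" for y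
  have D: "blinfun_apply (D y) h = frechet_derivative \<phi> (at y) h" for y h
    unfolding D_def by (simp add: blinfun.sum_left frechet_derivative_eq_sum[OF assms])
  have c: "continuous_on A (\<lambda>z. partial_deriv b \<phi> (fst z - snd z *\<^sub>R e))" if "b \<in> Basis" for b A
    by (rule continuous_on_compose2[OF smooth_continuous_on[OF smooth_partial_deriv[OF assms that], of UNIV]])
      (auto intro!: continuous_intros)
  have cD: "continuous_on A (\<lambda>z. D (fst z - snd z *\<^sub>R e))" for A
    unfolding D_def by (intro continuous_intros c) 
  have i: "(\<lambda>r. D (x - r *\<^sub>R e)) integrable_on {0..t}"
    by (rule integrable_continuous_interval) (use continuous_on_compose2[OF cD[of UNIV], of "{0..t}" "\<lambda>r. (x, r)"] in \<open>simp add: continuous_intros\<close>)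
  have "((\<lambda>x. integral (cbox 0 t) (\<lambda>r. \<phi> (x - r *\<^sub>R e))) has_derivative
      integral (cbox 0 t) (\<lambda>r. D (x - r *\<^sub>R e))) (at x within UNIV)"
  proof (rule leibniz_rule)
    fix y r
    have "((\<lambda>y. \<phi> (y - r *\<^sub>R e)) has_derivative (\<lambda>h. frechet_derivative \<phi> (at (y - r *\<^sub>R e)) h)) (at y)"
      by (rule has_derivative_compose[OF _ smooth_has_derivative[OF assms], where f = "\<lambda>y. y - r *\<^sub>R e" and f' = "\<lambda>h. h"])
        (auto intro!: derivative_eq_intros)
    then show "((\<lambda>y. \<phi> (y - r *\<^sub>R e)) has_derivative blinfun_apply (D (y - r *\<^sub>R e))) (at y within UNIV)"
      by (simp add: D[THEN ext])
    show "(\<lambda>r. \<phi> (y - r *\<^sub>R e)) integrable_on cbox 0 t"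
      by (rule integrable_continuous, rule continuous_on_compose2[OF smooth_continuous_on[OF assms, of UNIV]])
        (auto intro!: continuous_intros)
  next
    show "continuous_on (UNIV \<times> cbox 0 t) (\<lambda>(x, r). D (x - r *\<^sub>R e))"
      using cD by (simp add: split_beta)
  qed auto
  moreover have "blinfun_apply (integral (cbox 0 t) (\<lambda>r. D (x - r *\<^sub>R e))) = 
     (\<lambda>h. integral {0..t} (\<lambda>r. frechet_derivative \<phi> (at (x - r *\<^sub>R e)) h))"
    by (rule ext, subst blinfun_apply_integral) (use i in \<open>auto simp: D\<close>)
  ultimately show ?thesis by (simp add: smear_def[abs_def])
qed

lemma smear_partial_deriv:
  assumes "smooth \<phi>"
  shows "partial_deriv b (smear t e \<phi>) = smear t e (partial_deriv b \<phi>)"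
  by (rule ext, subst partial_deriv_eqI[OF smear_has_derivative[OF assms]])
    (simp add: smear_def partial_deriv_def)

lemma smear_smooth:
  assumes "smooth \<phi>"
  shows "smooth (smear t e \<phi>)"
proof -
  have "fold partial_deriv bs (smear t e \<phi>) = smear t e (fold partial_deriv bs \<phi>) \<and> smooth (fold partial_deriv bs \<phi>)"
    if "set bs \<subseteq> Basis" for bs
    using that assms by (induction bs arbitrary: \<phi>) (auto simp: smear_partial_deriv smooth_partial_deriv)
  moreover have "smear t e \<psi> differentiable_on UNIV" if "smooth \<psi>" for \<psi>
    using smear_has_derivative[OF that] by (auto simp: differentiable_on_def differentiable_def)
  ultimately show ?thesis by (auto simp: smooth_def[of "smear t e \<phi>"])
qed

text \<open>
  Along the segment, \<open>D\<phi>(x - r e) e\<close> is minus the derivative of \<open>\<phi>(x - r e)\<close> in \<open>r\<close>, so its integral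
  telescopes to the values at the two ends.
\<close>

lemma smear_directional_derivative:
  assumes "smooth \<phi>" "0 \<le> t"
  shows "frechet_derivative (smear t e \<phi>) (at x) e = \<phi> x - \<phi> (x - t *\<^sub>R e)"
proof -
  have "((\<lambda>r. frechet_derivative \<phi> (at (x - r *\<^sub>R e)) e) has_integral (- \<phi> (x - t *\<^sub>R e)) - (- \<phi> (x - 0 *\<^sub>R e))) {0..t}"
  proof (rule fundamental_theorem_of_calculus[OF assms(2)])
    fix r
    let ?D = "frechet_derivative \<phi> (at (x - r *\<^sub>R e))"
    have lin: "linear ?D"
      using smooth_has_derivative[OF assms(1)] has_derivative_linear by blast
    have "((\<lambda>r. \<phi> (x - r *\<^sub>R e)) has_derivative (\<lambda>h. ?D (- (h *\<^sub>R e)))) (at r within {0..t})"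
      by (rule has_derivative_compose[OF _ smooth_has_derivative[OF assms(1)], where f = "\<lambda>r. x - r *\<^sub>R e"])
        (auto intro!: derivative_eq_intros)
    from has_derivative_minus[OF this]
    show "((\<lambda>r. - \<phi> (x - r *\<^sub>R e)) has_vector_derivative ?D e) (at r within {0..t})"
      by (simp add: has_vector_derivative_def linear_neg[OF lin] linear_cmul[OF lin])
  qed
  then have "integral {0..t} (\<lambda>r. frechet_derivative \<phi> (at (x - r *\<^sub>R e)) e) = \<phi> x - \<phi> (x - t *\<^sub>R e)"
    by (simp add: integral_unique)
  then show ?thesis
    by (metis frechet_derivative_at smear_has_derivative[OF assms(1)])
qed

lemma smear_test_function:
  assumes \<phi>: "smooth \<phi>" and K: "compact K" "\<And>x. \<phi> x \<noteq> 0 \<Longrightarrow> x \<in> K"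
    and seg: "\<And>x r. x \<in> K \<Longrightarrow> r \<in> {0..t} \<Longrightarrow> x + r *\<^sub>R e \<in> \<Omega>"
  shows "smear t e \<phi> \<in> test_functions \<Omega>"
proof -
  define K' where "K' = (\<lambda>(x, r). x + r *\<^sub>R e) ` (K \<times> {0..t})"
  have "compact K'"
    unfolding K'_def using K by (intro compact_continuous_image compact_Times) (auto simp: split_beta intro!: continuous_intros)
  have "x \<in> K'" if "smear t e \<phi> x \<noteq> 0" for x
  proof (rule ccontr)
    assume "x \<notin> K'"
    then have "\<phi> (x - r *\<^sub>R e) = 0" if "r \<in> {0..t}" for r
      using K(2)[of "x - r *\<^sub>R e"] that by (force simp: K'_def)
    then have "smear t e \<phi> x = integral {0..t} (\<lambda>r. 0)"
      unfolding smear_def by (intro integral_cong) auto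
    with that show False by simp
  qed
  then have sub: "{x. smear t e \<phi> x \<noteq> 0} \<subseteq> K'" by blast
  then have "closure {x. smear t e \<phi> x \<noteq> 0} \<subseteq> K'"
    using \<open>compact K'\<close> by (intro closure_minimal compact_imp_closed)
  moreover have "bounded {x. smear t e \<phi> x \<noteq> 0}"
    using sub \<open>compact K'\<close> by (meson bounded_subset compact_imp_bounded)
  moreover have "K' \<subseteq> \<Omega>" using seg by (auto simp: K'_def)
  ultimately show ?thesis
    using smear_smooth[OF \<phi>] by (auto simp: test_functions_def compact_closure)
qed

section \<open>Weak derivatives as increments along segments\<close>

lemma AE_lborel_cbox_minus_box: "AE x in lborel. x \<in> cbox l v \<longrightarrow> x \<in> box l (v::'a::euclidean_space)"
proof -
  have "negligible (cbox l v - box l v)" by (rule negligible_frontier_interval)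
  moreover have "cbox l v - box l v \<in> sets borel" by simp
  ultimately have "cbox l v - box l v \<in> null_sets lborel"
    by (simp add: negligible_iff_null_sets null_sets_completion_iff)
  then show ?thesis by (rule AE_I') auto
qed

text \<open>
  The fundamental lemma of the calculus of variations, for boxes. Inside a closed box in \<open>U\<close> the
  sub-boxes form an intersection-stable generator of the Borel sets, so all integrals of \<open>u\<close> over Borel
  sets vanish there; countably many closed boxes exhaust \<open>U\<close>.
\<close>

lemma AE_zero_if_box_integrals_zero:
  fixes u :: "'a::euclidean_space \<Rightarrow> complex"
  assumes u: "integrable lborel u" and "open U"
    and zero: "\<And>l v. cbox l v \<subseteq> U \<Longrightarrow> (LINT x:box l v|lborel. u x) = 0"
  shows "AE x in lborel. x \<in> U \<longrightarrow> u x = 0"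
proof -
  have *: "AE x in lborel. x \<in> box l v \<longrightarrow> u x = 0" if sub: "cbox l v \<subseteq> U" for l v
  proof -
    define w where "w x = indicat_real (box l v) x *\<^sub>R u x" for x
    have w: "integrable lborel w"
      unfolding w_def using u by (intro integrable_mult_indicator) auto
    have "AE x in lborel. w x = 0"
    proof (rule sigma_finite_measure.density_zero[OF lborel.sigma_finite_measure_axioms w])
      fix A :: "'a set" assume "A \<in> sets lborel"
      then have A: "A \<in> sigma_sets UNIV (range (\<lambda>(a, b). box a b))"
        unfolding sets_lborel borel_eq_box by simp
      have m: "A \<in> sets lborel" if "A \<in> sigma_sets UNIV (range (\<lambda>(a, b). box a b))" for A :: "'a set"
        using that unfolding sets_lborel borel_eq_box by simp
      have iw: "set_integrable lborel A w" if "A \<in> sets lborel" for A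
        unfolding set_integrable_def by (rule integrable_mult_indicator[OF that w])
      have box0: "(LINT x:box a b|lborel. w x) = 0" for a b
      proof -
        have "(LINT x:box a b|lborel. w x) = (LINT x:box a b \<inter> box l v|lborel. u x)"
          unfolding set_lebesgue_integral_def w_def
          by (intro Bochner_Integration.integral_cong) (auto simp: indicator_def)
        also have "\<dots> = 0"
        proof (cases "box a b \<inter> box l v = {}")
          case False
          obtain c d where cd: "box a b \<inter> box l v = box c d"
            using box_Int_box[of a b l v] by blast
          with False have "cbox c d = closure (box c d)" by (simp add: closure_box)
          also have "\<dots> \<subseteq> cbox l v"
            unfolding cd[symmetric] by (rule closure_minimal) (use box_subset_cbox[of l v] in auto)
          finally have "cbox c d \<subseteq> U" using sub by blast
          from zero[OF this] show ?thesis unfolding cd .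
        qed (simp add: set_lebesgue_integral_def)
        finally show ?thesis .
      qed
      have all0: "(LINT x|lborel. w x) = 0"
        using zero[OF sub] by (simp add: w_def set_lebesgue_integral_def)
      have "Int_stable (range (\<lambda>(a, b). box a b :: 'a set))"
        by (auto simp: Int_stable_def box_Int_box)
      moreover have "range (\<lambda>(a, b). box a b :: 'a set) \<subseteq> Pow UNIV" by simp
      ultimately show "(LINT x:A|lborel. w x) = 0"
        using A
      proof (induction rule: sigma_sets_induct_disjoint)
        case (basic A) then show ?case using box0 by auto
      next
        case empty then show ?case by (simp add: set_lebesgue_integral_def)
      next
        case (compl A)
        then have A: "A \<in> sets lborel" using m by blast
        then have "UNIV - A \<in> sets lborel" using sets.compl_sets[OF A] by simp
        have "(LINT x:UNIV|lborel. w x) = (LINT x:A|lborel. w x) + (LINT x:UNIV - A|lborel. w x)"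
          using set_integral_Un[of A "UNIV - A" lborel w] iw[OF A] iw[OF \<open>UNIV - A \<in> sets lborel\<close>] by auto
        then show ?case using compl all0 by (simp add: set_lebesgue_integral_def)
      next
        case (union F)
        then have F: "F i \<in> sets lborel" for i using m by auto
        then have "(\<Union>i. F i) \<in> sets lborel" by blast
        then have "(LINT x:(\<Union>i. F i)|lborel. w x) = (\<Sum>i. (LINT x:(F i)|lborel. w x))"
          using union F by (intro lebesgue_integral_countable_add iw) (auto simp: disjoint_family_on_def)
        then show ?case using union by simp
      qed
    qed
    then show ?thesis by eventually_elim (auto simp: w_def)
  qed
  obtain \<D> where D: "countable \<D>" "\<D> \<subseteq> Pow U" "\<And>X. X \<in> \<D> \<Longrightarrow> \<exists>a b. X = cbox a b" "\<Union>\<D> = U"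
    using open_countable_Union_open_cbox[OF \<open>open U\<close>] by metis
  have "AE x in lborel. x \<in> X \<longrightarrow> u x = 0" if X: "X \<in> \<D>" for X
  proof -
    obtain l v where lv: "X = cbox l v" using D(3)[OF X] by blast
    with X D(2) have "cbox l v \<subseteq> U" by blast
    from *[OF this] AE_lborel_cbox_minus_box[of l v] show ?thesis
      unfolding lv by eventually_elim auto
  qed
  then have "AE x in lborel. \<forall>X\<in>\<D>. x \<in> X \<longrightarrow> u x = 0"
    by (subst AE_ball_countable[OF D(1)]) blast
  then show ?thesis by eventually_elim (use D(4) in blast)
qed

lemma box_bump_measurable [measurable]: "box_bump n l v \<in> borel_measurable borel"
proof -
  have "continuous_on UNIV (\<lambda>x. complex_of_real (box_bump n l v x))"
    by (rule smooth_continuous_on[OF box_bump_smooth])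
  then have "continuous_on UNIV (\<lambda>x. Re (complex_of_real (box_bump n l v x)))"
    by (rule continuous_on_Re)
  then show ?thesis
    by (intro borel_measurable_continuous_onI) (simp only: Re_complex_of_real)
qed

lemma lborel_translate:
  fixes g :: "'a::euclidean_space \<Rightarrow> 'b::{banach, second_countable_topology}"
  assumes "g \<in> borel_measurable borel"
  shows "integrable lborel (\<lambda>x. g (x + c)) \<longleftrightarrow> integrable lborel g"
    and "(LINT x|lborel. g (x + c)) = (LINT x|lborel. g x)"
proof -
  have "integrable (distr lborel borel ((+) c)) g \<longleftrightarrow> integrable lborel (\<lambda>x. g (c + x))"
    using assms by (intro integrable_distr_eq) auto
  then show "integrable lborel (\<lambda>x. g (x + c)) \<longleftrightarrow> integrable lborel g"
    by (simp add: lborel_distr_plus add.commute)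
  have "integral\<^sup>L (distr lborel borel ((+) c)) g = (LINT x|lborel. g (c + x))"
    using assms by (intro integral_distr) auto
  then show "(LINT x|lborel. g (x + c)) = (LINT x|lborel. g x)"
    by (simp add: lborel_distr_plus add.commute)
qed

text \<open>
  The functions are defined on the whole space here, and are meant to vanish outside \<open>\<Omega>\<close>. This makes
  translations available and removes restricted measures from all later integrals.
\<close>

definition has_weak_derivative_along ::
    "'a::euclidean_space set \<Rightarrow> 'a \<Rightarrow> ('a \<Rightarrow> complex) \<Rightarrow> ('a \<Rightarrow> complex) \<Rightarrow> bool" where
  "has_weak_derivative_along \<Omega> e f g \<longleftrightarrow> (\<forall>\<phi>\<in>test_functions \<Omega>.
     (LINT x|lborel. f x * frechet_derivative \<phi> (at x) e) = - (LINT x|lborel. g x * \<phi> x))"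

lemma integrable_translates:
  fixes g :: "'a::euclidean_space \<Rightarrow> complex"
  assumes [measurable]: "g \<in> borel_measurable borel" and g: "integrable lborel g"
  shows "integrable (lborel \<Otimes>\<^sub>M lborel) (\<lambda>(r::real, x). indicat_real {0..t} r *\<^sub>R g (x + r *\<^sub>R e))"
proof (rule lborel_pair.Fubini_integrable)
  show "(\<lambda>(r::real, x). indicat_real {0..t} r *\<^sub>R g (x + r *\<^sub>R e)) \<in> borel_measurable (lborel \<Otimes>\<^sub>M lborel)"
    by measurable
  have *: "(LINT x|lborel. norm (indicat_real {0..t} r *\<^sub>R g (x + r *\<^sub>R e))) = indicat_real {0..t} r * (LINT x|lborel. norm (g x))" for r
    using lborel_translate(2)[of "\<lambda>x. norm (g x)" "r *\<^sub>R e"] by simp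
  show "integrable lborel (\<lambda>r. LINT x|lborel. norm (case (r, x) of (r, x) \<Rightarrow> indicat_real {0..t} r *\<^sub>R g (x + r *\<^sub>R e)))"
    unfolding prod.case * by (intro integrable_mult_left) (simp add: emeasure_lborel_Icc_eq)
  show "AE r in lborel. integrable lborel (\<lambda>x. case (r, x) of (r, x) \<Rightarrow> indicat_real {0..t} r *\<^sub>R g (x + r *\<^sub>R e))"
    using g lborel_translate(1)[of g] by auto
qed

lemma open_segment_domain:
  fixes \<Omega> :: "'a::euclidean_space set"
  assumes "open \<Omega>"
  shows "open {x. \<forall>r\<in>{0..t}. x + r *\<^sub>R e \<in> \<Omega>}"
proof -
  have "compact ((\<lambda>r. r *\<^sub>R e) ` {0..t})"
    by (intro compact_continuous_image) (auto intro!: continuous_intros)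
  then have "closed (\<Union>x\<in>- \<Omega>. \<Union>y\<in>(\<lambda>r. r *\<^sub>R e) ` {0..t}. {x - y})"
    using assms by (intro closed_compact_differences) auto
  moreover have "(\<Union>x\<in>- \<Omega>. \<Union>y\<in>(\<lambda>r. r *\<^sub>R e) ` {0..t}. {x - y}) = - {x. \<forall>r\<in>{0..t}. x + r *\<^sub>R e \<in> \<Omega>}"
    by (auto simp: algebra_simps) (metis ComplI atLeastAtMost_iff)
  ultimately show ?thesis by (simp add: open_closed)
qed

text \<open>
  Testing with the integral of a bump function \<open>\<phi>\<close> along segments of length \<open>t\<close>, and moving the
  translations from \<open>\<phi>\<close> to \<open>f\<close> and \<open>g\<close>, gives
  \<open>\<integral> (f(x) - f(x + t e) + \<integral>\<^sub>0\<^sup>t g(x + r e) dr) \<phi>(x) dx = 0\<close>.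
  The bumps may be supported in any box all of whose points are the start of a segment in \<open>\<Omega>\<close>, and
  such boxes determine the bracket.
\<close>

lemma weak_derivative_increment:
  fixes f g :: "'a::euclidean_space \<Rightarrow> complex"
  assumes "open \<Omega>" and fm[measurable]: "f \<in> borel_measurable borel" and gm[measurable]: "g \<in> borel_measurable borel"
    and f: "integrable lborel f" and g: "integrable lborel g"
    and weak: "has_weak_derivative_along \<Omega> e f g" and t: "0 \<le> t"
  shows "AE x in lborel. (\<forall>r\<in>{0..t}. x + r *\<^sub>R e \<in> \<Omega>) \<longrightarrow>
    f (x + t *\<^sub>R e) = f x + (LINT r:{0..t}|lborel. g (x + r *\<^sub>R e))"
proof -
  define U where "U = {x. \<forall>r\<in>{0..t}. x + r *\<^sub>R e \<in> \<Omega>}"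
  define G where "G x = (LINT r:{0..t}|lborel. g (x + r *\<^sub>R e))" for x
  define u where "u x = f x - f (x + t *\<^sub>R e) + G x" for x
  have "open U" unfolding U_def by (rule open_segment_domain[OF assms(1)])
  have G: "integrable lborel G"
    using lborel_pair.integrable_snd[OF integrable_translates[OF gm g, of t e]]
    by (simp add: G_def[abs_def] set_lebesgue_integral_def)
  have f': "integrable lborel (\<lambda>x. f (x + t *\<^sub>R e))" using lborel_translate(1)[OF fm] f by blast
  have u: "integrable lborel u"
    unfolding u_def by (intro Bochner_Integration.integrable_add Bochner_Integration.integrable_diff f f' G)
  have bump: "(LINT x|lborel. u x * complex_of_real (box_bump n l v x)) = 0" if sub: "cbox l v \<subseteq> U" for n l v
  proof -
    define \<phi> where "\<phi> x = complex_of_real (box_bump n l v x)" for x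
    have \<phi>: "smooth \<phi>" unfolding \<phi>_def by (rule box_bump_smooth)
    have \<phi>m[measurable]: "\<phi> \<in> borel_measurable borel"
      using smooth_continuous_on[OF \<phi>] by (rule borel_measurable_continuous_onI)
    have \<phi>1: "norm (\<phi> x) \<le> 1" for x using box_bump_bounds[of n l v x] by (simp add: \<phi>_def)
    have int\<phi>: "integrable lborel (\<lambda>x. h x * \<phi> (x - c))" if "integrable lborel h" for h c
      using that by (rule Bochner_Integration.integrable_bound)
        (use that \<phi>1 in \<open>auto simp: norm_mult mult_left_le dest: borel_measurable_integrable\<close>)
    have test: "smear t e \<phi> \<in> test_functions \<Omega>"
    proof (rule smear_test_function[OF \<phi> compact_cbox])
      show "x \<in> cbox l v" if "\<phi> x \<noteq> 0" for x
        using that box_bump_nonzero[of n l v x] box_subset_cbox[of l v] by (auto simp: \<phi>_def)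
    qed (use sub in \<open>auto simp: U_def\<close>)
    have "(LINT x|lborel. f x * (\<phi> x - \<phi> (x - t *\<^sub>R e))) = - (LINT x|lborel. g x * smear t e \<phi> x)"
      using weak[unfolded has_weak_derivative_along_def, rule_format, OF test]
      by (simp add: smear_directional_derivative[OF \<phi> t])
    moreover have "(LINT x|lborel. f x * (\<phi> x - \<phi> (x - t *\<^sub>R e))) =
        (LINT x|lborel. f x * \<phi> x) - (LINT x|lborel. f (x + t *\<^sub>R e) * \<phi> x)"
    proof -
      have "(LINT x|lborel. f x * \<phi> (x - t *\<^sub>R e)) = (LINT x|lborel. f (x + t *\<^sub>R e) * \<phi> x)"
        using lborel_translate(2)[of "\<lambda>x. f x * \<phi> (x - t *\<^sub>R e)" "t *\<^sub>R e"] by simp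
      moreover have "(LINT x|lborel. f x * (\<phi> x - \<phi> (x - t *\<^sub>R e))) =
         (LINT x|lborel. f x * \<phi> x) - (LINT x|lborel. f x * \<phi> (x - t *\<^sub>R e))"
        unfolding right_diff_distrib
        using int\<phi>[OF f, of 0] int\<phi>[OF f, of "t *\<^sub>R e"] by (intro Bochner_Integration.integral_diff) simp_all
      ultimately show ?thesis by simp
    qed
    moreover have "(LINT x|lborel. g x * smear t e \<phi> x) = (LINT x|lborel. G x * \<phi> x)"
    proof -
      let ?I = "indicat_real {0..t}"
      have sm: "smear t e \<phi> x = (LINT r|lborel. ?I r *\<^sub>R \<phi> (x - r *\<^sub>R e))" for x
      proof -
        have "continuous_on {0..t} (\<lambda>r. \<phi> (x - r *\<^sub>R e))"
          by (rule continuous_on_compose2[OF smooth_continuous_on[OF \<phi>, of UNIV]]) (auto intro!: continuous_intros)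
        then have "set_integrable lborel {0..t} (\<lambda>r. \<phi> (x - r *\<^sub>R e))"
          by (rule borel_integrable_atLeastAtMost')
        from set_borel_integral_eq_integral(2)[OF this] show ?thesis
          by (simp add: smear_def set_lebesgue_integral_def)
      qed
      have dom: "integrable (lborel \<Otimes>\<^sub>M lborel) (\<lambda>(r::real, x). ?I r *\<^sub>R g x)"
        using integrable_translates[OF gm g, of t 0] by simp
      have i1: "integrable (lborel \<Otimes>\<^sub>M lborel) (\<lambda>(r, x). ?I r *\<^sub>R (g x * \<phi> (x - r *\<^sub>R e)))"
        by (rule Bochner_Integration.integrable_bound[OF dom])
          (use \<phi>1 in \<open>auto simp: norm_mult split_beta intro!: mult_left_le mult_left_mono\<close>)
      have i2: "integrable (lborel \<Otimes>\<^sub>M lborel) (\<lambda>(r, x). ?I r *\<^sub>R (g (x + r *\<^sub>R e) * \<phi> x))"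
        by (rule Bochner_Integration.integrable_bound[OF integrable_translates[OF gm g, of t e]])
          (use \<phi>1 in \<open>auto simp: norm_mult split_beta intro!: mult_left_le mult_left_mono\<close>)
      have "(LINT x|lborel. g x * smear t e \<phi> x) = (LINT x|lborel. LINT r|lborel. ?I r *\<^sub>R (g x * \<phi> (x - r *\<^sub>R e)))"
        unfolding sm by (subst integral_mult_right_zero[symmetric]) simp
      also have "\<dots> = (LINT r|lborel. LINT x|lborel. ?I r *\<^sub>R (g x * \<phi> (x - r *\<^sub>R e)))"
        by (rule lborel_pair.Fubini_integral[OF i1])
      also have "\<dots> = (LINT r|lborel. LINT x|lborel. ?I r *\<^sub>R (g (x + r *\<^sub>R e) * \<phi> x))"
        using lborel_translate(2)[of "\<lambda>x. g x * \<phi> (x - r *\<^sub>R e)" "r *\<^sub>R e" for r]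
        by (simp del: integral_mult_left_zero integral_mult_right_zero)
      also have "\<dots> = (LINT x|lborel. LINT r|lborel. ?I r *\<^sub>R (g (x + r *\<^sub>R e) * \<phi> x))"
        by (rule lborel_pair.Fubini_integral[OF i2, symmetric])
      also have "\<dots> = (LINT x|lborel. G x * \<phi> x)"
        unfolding G_def set_lebesgue_integral_def by (subst integral_mult_left_zero[symmetric]) simp
      finally show ?thesis .
    qed
    moreover have "(LINT x|lborel. u x * \<phi> x) = (LINT x|lborel. f x * \<phi> x) - (LINT x|lborel. f (x + t *\<^sub>R e) * \<phi> x)
        + (LINT x|lborel. G x * \<phi> x)"
      unfolding u_def distrib_right left_diff_distrib
      using int\<phi>[OF f, of 0] int\<phi>[OF f', of 0] int\<phi>[OF G, of 0] by simp
    ultimately have "(LINT x|lborel. u x * \<phi> x) = 0"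
      by (simp only: minus_equation_iff[of "LINT x|lborel. G x * \<phi> x"]) simp
    then show ?thesis by (simp add: \<phi>_def)
  qed
  have "AE x in lborel. x \<in> U \<longrightarrow> u x = 0"
  proof (rule AE_zero_if_box_integrals_zero[OF u \<open>open U\<close>])
    fix l v assume sub: "cbox l v \<subseteq> U"
    have [measurable]: "u \<in> borel_measurable borel" using borel_measurable_integrable[OF u] by simp
    have "(\<lambda>n. LINT x|lborel. u x * complex_of_real (box_bump n l v x)) \<longlonglongrightarrow>
       (LINT x|lborel. u x * complex_of_real (indicat_real (box l v) x))"
    proof (rule integral_dominated_convergence[where w = "\<lambda>x. norm (u x)"])
      show "AE x in lborel. (\<lambda>n. u x * complex_of_real (box_bump n l v x)) \<longlonglongrightarrow> u x * complex_of_real (indicat_real (box l v) x)"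
        by (intro always_eventually allI tendsto_mult tendsto_const tendsto_of_real box_bump_tendsto)
      show "AE x in lborel. norm (u x * complex_of_real (box_bump n l v x)) \<le> norm (u x)" for n
        using box_bump_bounds[of n l v] by (intro AE_I2) (simp add: norm_mult mult_left_le)
    qed (use u in auto)
    then have "(LINT x|lborel. u x * complex_of_real (indicat_real (box l v) x)) = 0"
      by (simp only: bump[OF sub] tendsto_const_iff sequentially_bot not_False_eq_True)
    then show "(LINT x:box l v|lborel. u x) = 0"
      by (simp add: set_lebesgue_integral_def scaleR_conv_of_real mult.commute)
  qed
  then show ?thesis
  proof eventually_elim
    case (elim x)
    show ?case
    proof
      assume "\<forall>r\<in>{0..t}. x + r *\<^sub>R e \<in> \<Omega>"
      with elim have "f x - f (x + t *\<^sub>R e) + G x = 0" by (simp add: U_def u_def)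
      then show "f (x + t *\<^sub>R e) = f x + (LINT r:{0..t}|lborel. g (x + r *\<^sub>R e))"
        unfolding G_def[symmetric] by algebra
    qed
  qed
qed

section \<open>Hausdorff measure of transversal sets\<close>

lemma hausdorff_content_finite_cover:
  fixes C :: "'i \<Rightarrow> 'a::metric_space set"
  assumes "finite I" and cov: "A \<subseteq> (\<Union>i\<in>I. C i)" and C: "\<And>i. i \<in> I \<Longrightarrow> bounded (C i)" "\<And>i. i \<in> I \<Longrightarrow> diameter (C i) \<le> d"
    and d: "0 \<le> d" "d \<le> \<delta>"
  shows "hausdorff_content n \<delta> A \<le> ennreal (real (card I) * (unit_ball_vol (real n) * (d / 2) ^ n))"
proof -
  obtain h where h: "bij_betw h {..<card I} I"
    using ex_bij_betw_nat_finite[OF assms(1)] by (auto simp: atLeast0LessThan)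
  then have hI: "h k \<in> I" if "k < card I" for k using that by (auto simp: bij_betw_def)
  define E where "E k = (if k < card I then C (h k) else {})" for k
  have "hausdorff_content n \<delta> A \<le> (\<Sum>k. hausdorff_size n (E k))"
  proof (rule hausdorff_content_le)
    show "A \<subseteq> (\<Union>k. E k)"
    proof
      fix x assume "x \<in> A"
      then obtain i where "i \<in> I" "x \<in> C i" using cov by auto
      moreover from \<open>i \<in> I\<close> h obtain k where "k < card I" "h k = i"
        by (metis bij_betw_imp_surj_on image_iff lessThan_iff)
      ultimately have "x \<in> E k" by (simp add: E_def)
      then show "x \<in> (\<Union>k. E k)" by blast
    qed
    show "bounded (E k)" for k using C(1)[OF hI] by (simp add: E_def)
    show "diameter (E k) \<le> \<delta>" for k using C(2)[OF hI, of k] d by (auto simp: E_def)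
  qed
  also have "\<dots> = (\<Sum>k<card I. hausdorff_size n (E k))"
    by (rule suminf_finite) (auto simp: E_def)
  also have "\<dots> \<le> (\<Sum>k<card I. ennreal (unit_ball_vol (real n) * (d / 2) ^ n))"
  proof (rule sum_mono)
    fix k assume k: "k \<in> {..<card I}"
    have "diameter (E k) \<ge> 0" using C(1)[OF hI, of k] k by (auto simp: E_def intro: diameter_ge_0)
    then show "hausdorff_size n (E k) \<le> ennreal (unit_ball_vol (real n) * (d / 2) ^ n)"
      using C(2)[OF hI, of k] k
      by (auto simp: E_def hausdorff_size_def intro!: ennreal_leI mult_left_mono power_mono divide_right_mono)
  qed
  also have "\<dots> = ennreal (real (card I) * (unit_ball_vol (real n) * (d / 2) ^ n))"
    by (simp add: ennreal_mult' ennreal_of_nat_eq_real_of_nat)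
  finally show ?thesis .
qed

text \<open>
  The quantitative form of "every line of direction \<open>e\<close> meets \<open>S\<close> at most once": it says that \<open>S\<close> is a
  Lipschitz graph over a hyperplane complementary to \<open>e\<close>, without singling out a hyperplane.
\<close>

definition transversal :: "'a::euclidean_space set \<Rightarrow> 'a \<Rightarrow> real \<Rightarrow> bool" where
  "transversal S e L \<longleftrightarrow> (\<forall>y\<in>S. \<forall>y'\<in>S. \<forall>t. \<bar>t\<bar> \<le> L * norm (y - y' - t *\<^sub>R e))"

text \<open>
  Slide the part of \<open>S\<close> that lies in the tube along \<open>e\<close> into the hyperplane through \<open>c\<close> orthogonal to a
  basis vector \<open>b\<^sub>0\<close> with \<open>e \<bullet> b\<^sub>0 \<noteq> 0\<close>. The image lies in a cube of one dimension less and of side \<open>O(s)\<close>. Cutting this cube into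
  \<open>O(m\<^sup>n\<^sup>-\<^sup>1)\<close> small cubes cuts the part of \<open>S\<close> into pieces of diameter \<open>O(s/m)\<close>, by transversality,
  and the powers of \<open>m\<close> cancel.
\<close>

lemma hausdorff_tube_bound:
  fixes S :: "'a::euclidean_space set"
  assumes trans: "transversal S e L" and "e \<noteq> 0" "0 \<le> L"
  obtains C where "0 \<le> C" and "\<And>c s. 0 < s \<Longrightarrow>
    hausdorff_outer (DIM('a) - 1) {y \<in> S. \<exists>t. y + t *\<^sub>R e \<in> cbox c (c + s *\<^sub>R One)} \<le> ennreal (C * s ^ (DIM('a) - 1))"
proof -
  define N where "N = DIM('a) - 1"
  obtain b0 where b0: "b0 \<in> Basis" "e \<bullet> b0 \<noteq> 0"
    using \<open>e \<noteq> 0\<close> euclidean_all_zero_iff by blast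
  define B where "B = Basis - {b0}"
  have B: "finite B" "card B = N" using b0 by (auto simp: B_def N_def)
  \<comment> \<open>sliding into the hyperplane moves the other coordinates by at most \<open>K * s\<close>, so \<open>R * s\<close> is the side of the enlarged cube; \<open>M\<close> converts the side of a small cube into a diameter\<close>
  define K where "K = norm e / \<bar>e \<bullet> b0\<bar>"
  define R where "R = 1 + 2 * K"
  define M where "M = real DIM('a) * (1 + L * norm e)"
  have K: "0 \<le> K" by (simp add: K_def)
  have M: "0 < M" using \<open>0 \<le> L\<close> by (auto simp: M_def intro!: mult_pos_pos add_pos_nonneg)
  define C where "C = unit_ball_vol (real N) * (M * R) ^ N"
  show thesis
  proof (rule that[of C])
    show "0 \<le> C" using M K by (auto simp: C_def R_def)
    fix c :: 'a and s :: real assume s: "0 < s"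
    define U where "U = {y \<in> S. \<exists>t. y + t *\<^sub>R e \<in> cbox c (c + s *\<^sub>R One)}"
    have Rs: "0 < R * s" using K s by (simp add: R_def add_pos_nonneg)
    have "hausdorff_content N \<delta> U \<le> ennreal (C * s ^ N)" if \<delta>: "0 < \<delta>" for \<delta>
    proof -
      obtain m0 where m0: "M * (R * s) / \<delta> < real m0" using reals_Archimedean2 by blast
      define m where "m = Suc m0"
      define h where "h = R * s / real m"
      have h: "0 < h" using Rs by (simp add: h_def m_def)
      have "M * (R * s) \<le> \<delta> * real m" using m0 \<delta> by (simp add: m_def field_simps)
      then have small: "M * h \<le> \<delta>" by (simp add: h_def field_simps m_def)
      define I where "I = PiE B (\<lambda>_. {0..m})"
      have I: "finite I" "card I = (m + 1) ^ N"
        using B by (auto simp: I_def card_PiE intro!: finite_PiE)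
      \<comment> \<open>the points that slide into the small cube with index \<open>k\<close>\<close>
      define P where "P k = {y \<in> U. \<exists>t. (y + t *\<^sub>R e) \<bullet> b0 = c \<bullet> b0 \<and>
         (\<forall>b\<in>B. real (k b) * h \<le> (y + t *\<^sub>R e) \<bullet> b - c \<bullet> b + K * s \<and>
                 (y + t *\<^sub>R e) \<bullet> b - c \<bullet> b + K * s \<le> (real (k b) + 1) * h)}" for k
      have "hausdorff_content N \<delta> U \<le> ennreal (real (card I) * (unit_ball_vol (real N) * (M * h / 2) ^ N))"
      proof (rule hausdorff_content_finite_cover[OF I(1)])
        show "U \<subseteq> (\<Union>k\<in>I. P k)"
        proof
          fix y assume y: "y \<in> U"
          then obtain t where t: "y + t *\<^sub>R e \<in> cbox c (c + s *\<^sub>R One)" by (auto simp: U_def)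
          define x where "x = y + t *\<^sub>R e"
          define \<tau> where "\<tau> = (x \<bullet> b0 - c \<bullet> b0) / (e \<bullet> b0)"
          have x: "0 \<le> x \<bullet> b - c \<bullet> b" "x \<bullet> b - c \<bullet> b \<le> s" if "b \<in> Basis" for b
            using t that by (auto simp: x_def mem_box inner_add_left)
          have "\<bar>\<tau>\<bar> \<le> s / \<bar>e \<bullet> b0\<bar>"
            using x[OF b0(1)] by (auto simp: \<tau>_def abs_divide intro!: divide_right_mono)
          then have \<tau>: "\<bar>\<tau> * (e \<bullet> b)\<bar> \<le> K * s" if "b \<in> Basis" for b
            using mult_mono[of "\<bar>\<tau>\<bar>" "s / \<bar>e \<bullet> b0\<bar>" "\<bar>e \<bullet> b\<bar>" "norm e"] Basis_le_norm[OF that, of e] s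
            by (simp add: K_def abs_mult mult.commute)
          define q where "q b = (y + (t - \<tau>) *\<^sub>R e) \<bullet> b - c \<bullet> b + K * s" for b
          have q: "0 \<le> q b" "q b \<le> R * s" if "b \<in> Basis" for b
            using x[OF that] \<tau>[OF that] by (auto simp: q_def x_def R_def algebra_simps inner_add_left inner_diff_left)
          define k where "k = restrict (\<lambda>b. nat \<lfloor>q b / h\<rfloor>) B"
          have "k \<in> I" unfolding I_def k_def
          proof (intro PiE_I)
            fix b assume "b \<in> B"
            then have b: "b \<in> Basis" by (simp add: B_def)
            have "q b / h \<le> R * s / h" using q[OF b] h by (intro divide_right_mono) auto
            also have "R * s / h = real m" using Rs by (auto simp: h_def m_def zero_less_mult_iff)
            finally have "\<lfloor>q b / h\<rfloor> \<le> int m" by linarith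
            then show "restrict (\<lambda>b. nat \<lfloor>q b / h\<rfloor>) B b \<in> {0..m}" using \<open>b \<in> B\<close> by simp
          qed simp
          moreover have "y \<in> P k"
            unfolding P_def
          proof (intro CollectI conjI exI[of _ "t - \<tau>"] ballI y)
            have "(y + (t - \<tau>) *\<^sub>R e) \<bullet> b0 = x \<bullet> b0 - \<tau> * (e \<bullet> b0)"
              by (simp add: x_def algebra_simps inner_add_left inner_diff_left)
            then show "(y + (t - \<tau>) *\<^sub>R e) \<bullet> b0 = c \<bullet> b0" using b0 by (simp add: \<tau>_def)
            fix b assume "b \<in> B"
            then have b: "b \<in> Basis" by (simp add: B_def)
            have "0 \<le> q b / h" using q[OF b] h by simp
            then have "real (k b) = of_int \<lfloor>q b / h\<rfloor>" using \<open>b \<in> B\<close> by (simp add: k_def)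
            then have "real (k b) \<le> q b / h" "q b / h \<le> real (k b) + 1" by linarith+
            then show "real (k b) * h \<le> (y + (t - \<tau>) *\<^sub>R e) \<bullet> b - c \<bullet> b + K * s"
              "(y + (t - \<tau>) *\<^sub>R e) \<bullet> b - c \<bullet> b + K * s \<le> (real (k b) + 1) * h"
              using h unfolding q_def[symmetric] by (simp_all add: field_simps)
          qed
          ultimately show "y \<in> (\<Union>k\<in>I. P k)" by blast
        qed
        have dist: "norm (y1 - y2) \<le> M * h" if y: "y1 \<in> P k" "y2 \<in> P k" for y1 y2 k
        proof -
          obtain t1 where t1: "(y1 + t1 *\<^sub>R e) \<bullet> b0 = c \<bullet> b0"
            "\<And>b. b \<in> B \<Longrightarrow> real (k b) * h \<le> (y1 + t1 *\<^sub>R e) \<bullet> b - c \<bullet> b + K * s \<and> (y1 + t1 *\<^sub>R e) \<bullet> b - c \<bullet> b + K * s \<le> (real (k b) + 1) * h"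
            using y(1) unfolding P_def by blast
          obtain t2 where t2: "(y2 + t2 *\<^sub>R e) \<bullet> b0 = c \<bullet> b0"
            "\<And>b. b \<in> B \<Longrightarrow> real (k b) * h \<le> (y2 + t2 *\<^sub>R e) \<bullet> b - c \<bullet> b + K * s \<and> (y2 + t2 *\<^sub>R e) \<bullet> b - c \<bullet> b + K * s \<le> (real (k b) + 1) * h"
            using y(2) unfolding P_def by blast
          define v where "v = (y1 + t1 *\<^sub>R e) - (y2 + t2 *\<^sub>R e)"
          have "\<bar>v \<bullet> b\<bar> \<le> h" if "b \<in> Basis" for b
          proof (cases "b = b0")
            case True then show ?thesis using t1(1) t2(1) h by (simp add: v_def inner_diff_left)
          next
            case False
            with that have "b \<in> B" by (simp add: B_def)
            from t1(2)[OF this] t2(2)[OF this] show ?thesis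
              by (simp add: v_def inner_diff_left algebra_simps abs_le_iff)
          qed
          then have "(\<Sum>b\<in>Basis. \<bar>v \<bullet> b\<bar>) \<le> real DIM('a) * h"
            by (intro sum_bounded_above) auto
          then have v: "norm v \<le> real DIM('a) * h" using norm_le_l1[of v] by linarith
          have v': "y1 - y2 - (t2 - t1) *\<^sub>R e = v" by (simp add: v_def algebra_simps)
          have "y1 \<in> S" "y2 \<in> S" using y by (auto simp: P_def U_def)
          then have "\<bar>t2 - t1\<bar> \<le> L * norm v"
            using trans v' unfolding transversal_def by metis
          also have "\<dots> \<le> L * (real DIM('a) * h)" using v \<open>0 \<le> L\<close> by (rule mult_left_mono)
          finally have t: "\<bar>t2 - t1\<bar> \<le> L * (real DIM('a) * h)" .
          have "y1 - y2 = v + (t2 - t1) *\<^sub>R e" using v' by (simp add: algebra_simps)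
          then have "norm (y1 - y2) \<le> norm v + \<bar>t2 - t1\<bar> * norm e"
            by (metis norm_scaleR norm_triangle_ineq)
          also have "\<dots> \<le> real DIM('a) * h + L * (real DIM('a) * h) * norm e"
            by (intro add_mono v mult_right_mono t) auto
          finally show ?thesis by (simp add: M_def algebra_simps)
        qed
        have Mh: "0 \<le> M * h" using M h by simp
        show "bounded (P k)" for k
          unfolding bounded_def dist_norm using dist[of _ k] by blast
        show "diameter (P k) \<le> M * h" for k
          using dist[of _ k] Mh by (intro diameter_le) auto
        show "0 \<le> M * h" "M * h \<le> \<delta>" using Mh small by auto
      qed
      also have "real (card I) * (unit_ball_vol (real N) * (M * h / 2) ^ N) \<le> C * s ^ N"
      proof -
        have "real (card I) \<le> (2 * real m) ^ N"
          unfolding I(2) of_nat_power by (rule power_mono) (auto simp: m_def)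
        then have "real (card I) * (unit_ball_vol (real N) * (M * h / 2) ^ N) \<le>
            (2 * real m) ^ N * (unit_ball_vol (real N) * (M * h / 2) ^ N)"
          using M h by (intro mult_right_mono) auto
        also have "\<dots> = unit_ball_vol (real N) * ((2 * real m) * (M * h / 2)) ^ N"
          unfolding power_mult_distrib[of "2 * real m" "M * h / 2"] by simp
        also have "(2 * real m) * (M * h / 2) = M * R * s"
          using m_def by (simp add: h_def del: of_nat_Suc)
        finally show ?thesis by (simp add: C_def power_mult_distrib)
      qed
      finally show ?thesis by (simp add: ennreal_leI)
    qed
    then show "hausdorff_outer (DIM('a) - 1) {y \<in> S. \<exists>t. y + t *\<^sub>R e \<in> cbox c (c + s *\<^sub>R One)} \<le> ennreal (C * s ^ (DIM('a) - 1))"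
      unfolding hausdorff_outer_def U_def[symmetric] N_def[symmetric] by (intro SUP_least) auto
  qed
qed

section \<open>Lines through a transversal set\<close>

text \<open>
  A bounded Borel set is covered up to \<open>\<epsilon>\<close> by countably many dyadic cubes with disjoint interiors,
  whose Lebesgue measures therefore add up; for \<open>M\<close> subadditivity is enough.
\<close>

lemma emeasure_le_lborel_if_cubes:
  fixes M :: "'a::euclidean_space measure"
  assumes [simp, measurable_cong]: "sets M = sets borel" and "0 \<le> C"
    and cube: "\<And>c s. 0 < s \<Longrightarrow> emeasure M (cbox c (c + s *\<^sub>R One)) \<le> ennreal C * emeasure lborel (cbox c (c + s *\<^sub>R One))"
    and A: "A \<in> sets borel"
  shows "emeasure M A \<le> ennreal C * emeasure lborel A"
proof -
  have bounded: "emeasure M A \<le> ennreal C * emeasure lborel A"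
    if A: "A \<in> sets borel" and sub: "A \<subseteq> cbox (- (real (Suc n) *\<^sub>R One)) (real (Suc n) *\<^sub>R One)" for A n
  proof (rule ennreal_le_epsilon)
    fix \<epsilon> :: real assume "0 < \<epsilon>"
    define \<epsilon>' where "\<epsilon>' = \<epsilon> / (C + 1)"
    have \<epsilon>': "0 < \<epsilon>'" "C * \<epsilon>' \<le> \<epsilon>" using \<open>0 < \<epsilon>\<close> \<open>0 \<le> C\<close> by (auto simp: \<epsilon>'_def field_simps)
    let ?a = "- (real (Suc n) *\<^sub>R One) :: 'a" and ?b = "real (Suc n) *\<^sub>R One :: 'a"
    have lA: "A \<in> lmeasurable"
      using A bounded_subset[OF bounded_cbox sub] by (simp add: bounded_set_imp_lmeasurable)
    have "box ?a ?b \<noteq> {}" by (simp add: box_ne_empty)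
    obtain \<D> where D: "countable \<D>"
        "\<And>K. K \<in> \<D> \<Longrightarrow> K \<subseteq> cbox ?a ?b \<and> K \<noteq> {} \<and> (\<exists>c d. K = cbox c d)"
        "pairwise (\<lambda>A B. interior A \<inter> interior B = {}) \<D>"
        "\<And>u v. cbox u v \<in> \<D> \<Longrightarrow> \<exists>k. \<forall>i \<in> Basis. v \<bullet> i - u \<bullet> i = (?b \<bullet> i - ?a \<bullet> i) / 2 ^ k"
        "A \<subseteq> \<Union>\<D>" "\<Union>\<D> \<in> lmeasurable" "measure lebesgue (\<Union>\<D>) \<le> measure lebesgue A + \<epsilon>'"
      using measurable_outer_intervals_bounded[OF lA sub \<epsilon>'(1)] by metis
    have cubes: "\<exists>c s. K = cbox c (c + s *\<^sub>R One) \<and> 0 < s" if K: "K \<in> \<D>" for K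
    proof -
      obtain u v where uv: "K = cbox u v" using D(2)[OF K] by blast
      obtain k where k: "\<And>i. i \<in> Basis \<Longrightarrow> v \<bullet> i - u \<bullet> i = (?b \<bullet> i - ?a \<bullet> i) / 2 ^ k"
        using D(4) K uv by metis
      define s where "s = 2 * real (Suc n) / 2 ^ k"
      have "v = u + s *\<^sub>R One"
      proof (rule euclidean_eqI)
        fix i :: 'a assume i: "i \<in> Basis"
        have "v \<bullet> i = u \<bullet> i + (?b \<bullet> i - ?a \<bullet> i) / 2 ^ k" using k[OF i] by simp
        then show "v \<bullet> i = (u + s *\<^sub>R One) \<bullet> i" using i by (simp add: s_def inner_add_left add_divide_distrib algebra_simps)
      qed
      moreover have "0 < s" by (simp add: s_def)
      ultimately show ?thesis using uv by blast
    qed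
    \<comment> \<open>interiors are disjoint but the cubes may share faces, hence the detour through divisions\<close>
    have fin: "emeasure M (\<Union>F) \<le> ennreal (C * measure lebesgue A + \<epsilon>)" if F: "finite F" "F \<subseteq> \<D>" for F
    proof -
      have "F division_of \<Union>F"
        unfolding division_of_def using F D(2,3) by (auto simp: pairwise_def) blast+
      then have cd: "(\<Sum>K\<in>F. measure lebesgue K) = measure lebesgue (\<Union>F)" by (rule content_division)
      have K: "emeasure M K \<le> ennreal (C * measure lebesgue K) \<and> K \<in> sets borel" if "K \<in> F" for K
      proof -
        from cubes that F obtain c s where cs: "K = cbox c (c + s *\<^sub>R One)" "0 < s" by blast
        have "emeasure lborel K = ennreal (measure lebesgue K)"
          unfolding cs(1) using emeasure_lborel_cbox_finite[of c "c + s *\<^sub>R One"]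
          by (subst emeasure_eq_ennreal_measure) auto
        then show ?thesis using cube[OF cs(2), of c] \<open>0 \<le> C\<close> by (simp add: cs(1) ennreal_mult')
      qed
      have "emeasure M (\<Union>K\<in>F. K) \<le> (\<Sum>K\<in>F. emeasure M K)"
        by (rule emeasure_subadditive_finite) (use F K in auto)
      also have "\<dots> \<le> (\<Sum>K\<in>F. ennreal (C * measure lebesgue K))" by (rule sum_mono) (use K in blast)
      also have "\<dots> = ennreal (C * measure lebesgue (\<Union>F))"
        using \<open>0 \<le> C\<close> by (simp add: cd[symmetric] sum_distrib_left)
      also have "\<dots> \<le> ennreal (C * measure lebesgue A + \<epsilon>)"
      proof (rule ennreal_leI)
        have "\<Union>F \<in> lmeasurable" using F D(2) by (intro fmeasurable.finite_Union) (use F D(2) in blast)+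
        then have "measure lebesgue (\<Union>F) \<le> measure lebesgue (\<Union>\<D>)"
          using D(6) F by (intro measure_mono_fmeasurable) (auto intro: fmeasurableD)
        with D(7) have "measure lebesgue (\<Union>F) \<le> measure lebesgue A + \<epsilon>'" by linarith
        then have "C * measure lebesgue (\<Union>F) \<le> C * (measure lebesgue A + \<epsilon>')"
          using \<open>0 \<le> C\<close> by (rule mult_left_mono)
        then show "C * measure lebesgue (\<Union>F) \<le> C * measure lebesgue A + \<epsilon>"
          using \<epsilon>'(2) by (simp add: algebra_simps)
      qed
      finally show ?thesis by simp
    qed
    have "emeasure M (\<Union>\<D>) \<le> ennreal (C * measure lebesgue A + \<epsilon>)"
    proof (cases "\<D> = {}")
      case False
      define E where "E k = \<Union>(from_nat_into \<D> ` {..k})" for k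
      have E: "from_nat_into \<D> ` {..k} \<subseteq> \<D>" for k using from_nat_into[OF False] by auto
      have "emeasure M (\<Union>\<D>) = (SUP k. emeasure M (E k))"
      proof (subst SUP_emeasure_incseq)
        show "range E \<subseteq> sets M"
        proof -
          have "K \<in> sets borel" if "K \<in> \<D>" for K using D(2)[OF that] by auto
          then have "E k \<in> sets borel" for k unfolding E_def using E[of k] by (intro sets.finite_Union) auto
          then show ?thesis by auto
        qed
        show "incseq E" unfolding E_def incseq_def by (intro allI impI Union_mono image_mono) auto
        have "\<Union>\<D> = \<Union>(range (from_nat_into \<D>))"
          using range_from_nat_into[OF False D(1)] by simp
        also have "\<dots> = (\<Union>k. E k)" unfolding E_def by auto
        finally show "emeasure M (\<Union>\<D>) = emeasure M (\<Union>k. E k)" by simp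
      qed
      also have "\<dots> \<le> ennreal (C * measure lebesgue A + \<epsilon>)"
        unfolding E_def by (intro SUP_least fin E) auto
      finally show ?thesis .
    qed simp
    moreover have "emeasure M A \<le> emeasure M (\<Union>\<D>)"
    proof (rule emeasure_mono[OF D(5)])
      show "\<Union>\<D> \<in> sets M" 
      proof (rule sets.countable_Union[OF D(1)], rule subsetI)
        fix K assume "K \<in> \<D>"
        from D(2)[OF this] show "K \<in> sets M" by auto
      qed
    qed
    moreover have "ennreal C * emeasure lborel A = ennreal (C * measure lebesgue A)"
    proof -
      have "emeasure lborel A = emeasure lebesgue A" using A by simp
      also have "\<dots> = ennreal (measure lebesgue A)" using lA by (rule emeasure_eq_measure2)
      finally show ?thesis using \<open>0 \<le> C\<close> by (simp add: ennreal_mult')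
    qed
    ultimately show "emeasure M A \<le> ennreal C * emeasure lborel A + ennreal \<epsilon>"
      using \<open>0 < \<epsilon>\<close> \<open>0 \<le> C\<close> by (simp add: ennreal_plus[symmetric] del: ennreal_plus)
  qed
  define A' where "A' n = A \<inter> cbox (- (real (Suc n) *\<^sub>R One)) (real (Suc n) *\<^sub>R One)" for n
  have A': "A' n \<in> sets borel" for n using A by (simp add: A'_def)
  have "incseq A'"
    unfolding A'_def incseq_def by (intro allI impI Int_mono subset_box_imp) auto
  moreover have "(\<Union>n. A' n) = A"
  proof -
    have "\<exists>n. x \<in> cbox (- (real (Suc n) *\<^sub>R One)) (real (Suc n) *\<^sub>R One)" for x :: 'a
    proof -
      obtain n where n: "norm x \<le> real n" using real_arch_simple by blast
      then have "x \<in> cbox (- (real (Suc n) *\<^sub>R One)) (real (Suc n) *\<^sub>R One)"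
        unfolding mem_box using Basis_le_norm[of _ x] by (auto simp: abs_le_iff) (smt (verit))+
      then show ?thesis ..
    qed
    then show ?thesis unfolding A'_def by blast
  qed
  ultimately have "emeasure M A = (SUP n. emeasure M (A' n))"
    using A' by (metis SUP_emeasure_incseq assms(1) image_subset_iff)
  also have "\<dots> \<le> ennreal C * emeasure lborel A"
  proof (rule SUP_least)
    fix n
    have "emeasure M (A' n) \<le> ennreal C * emeasure lborel (A' n)"
      using A' by (rule bounded) (auto simp: A'_def)
    also have "\<dots> \<le> ennreal C * emeasure lborel A"
      using A by (intro mult_left_mono emeasure_mono) (auto simp: A'_def)
    finally show "emeasure M (A' n) \<le> ennreal C * emeasure lborel A" .
  qed
  finally show ?thesis .
qed

text \<open>
  A half of Fubini's theorem in the coordinates \<open>(y, t) \<mapsto> y + t e\<close>. The push-forward of the product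
  of the surface measure and Lebesgue measure is compared with Lebesgue measure on cubes: of the points \<open>y\<close>
  whose line meets a cube of side \<open>s\<close> there are \<open>O(s\<^sup>n\<^sup>-\<^sup>1)\<close> in measure, and each line spends time \<open>O(s)\<close>
  in the cube.
\<close>

lemma transversal_line_integral_bound:
  fixes S :: "'a::euclidean_space set"
  assumes S: "S \<in> sets borel" "bounded S" and trans: "transversal S e L" "e \<noteq> 0" "0 \<le> L"
  shows "finite_measure (restrict_space (hausdorff_measure (DIM('a) - 1)) S)"
    and "\<exists>C\<ge>0. \<forall>h\<in>borel_measurable borel.
      (\<integral>\<^sup>+y. \<integral>\<^sup>+t. h (y + t *\<^sub>R e) \<partial>lborel \<partial>restrict_space (hausdorff_measure (DIM('a) - 1)) S) \<le> ennreal C * (\<integral>\<^sup>+x. h x \<partial>lborel)"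
proof -
  define N where "N = DIM('a) - 1"
  define H where "H = restrict_space (hausdorff_measure N) S"
  obtain C where C: "0 \<le> C" "\<And>c s. 0 < s \<Longrightarrow>
      hausdorff_outer N {y \<in> S. \<exists>t. y + t *\<^sub>R e \<in> cbox c (c + s *\<^sub>R One)} \<le> ennreal (C * s ^ N)"
    using hausdorff_tube_bound[OF trans] unfolding N_def by blast
  have spH[simp]: "space H = S" by (simp add: H_def space_restrict_space)
  have H: "emeasure H V = hausdorff_outer N V" if "V \<in> sets H" for V
  proof -
    from that S have "V \<subseteq> S" "V \<in> sets borel" by (auto simp: H_def sets_restrict_space_iff)
    then show ?thesis using S by (simp add: H_def emeasure_restrict_space emeasure_hausdorff_measure)
  qed
  have idm: "(\<lambda>y. y) \<in> measurable H borel"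
    unfolding H_def by (rule measurable_restrict_space1) simp
  note idm[measurable]
  interpret H: finite_measure H
  proof
    obtain r where r: "0 < r" "\<And>x. x \<in> S \<Longrightarrow> norm x \<le> r" using S(2) bounded_pos by blast
    have "{y \<in> S. \<exists>t. y + t *\<^sub>R e \<in> cbox (- r *\<^sub>R One) (- r *\<^sub>R One + (2 * r) *\<^sub>R One)} = S"
    proof -
      have "y + 0 *\<^sub>R e \<in> cbox (- r *\<^sub>R One) (- r *\<^sub>R One + (2 * r) *\<^sub>R One)" if "y \<in> S" for y
      proof -
        have "\<bar>y \<bullet> b\<bar> \<le> r" if "b \<in> Basis" for b
          using Basis_le_norm[OF that, of y] r(2)[OF \<open>y \<in> S\<close>] by linarith
        then have "- r \<le> y \<bullet> b \<and> y \<bullet> b \<le> r" if "b \<in> Basis" for b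
          using that by (fastforce simp: abs_le_iff)
        then show ?thesis by (auto simp: mem_box inner_add_left inner_diff_left)
      qed
      then show ?thesis by blast
    qed
    with C(2)[of "2 * r" "- r *\<^sub>R One"] r(1) have "hausdorff_outer N S \<le> ennreal (C * (2 * r) ^ N)" by simp
    moreover have "S \<in> sets H" using sets.top[of H] by simp
    ultimately show "emeasure H (space H) \<noteq> \<infinity>"
      using H[of S] by (auto simp: top_unique)
  qed
  interpret P: pair_sigma_finite H lborel ..
  define \<mu> where "\<mu> = distr (H \<Otimes>\<^sub>M lborel) borel (\<lambda>(y, t). y + t *\<^sub>R e)"
  have nn: "(\<integral>\<^sup>+x. h x \<partial>\<mu>) = (\<integral>\<^sup>+y. \<integral>\<^sup>+t. h (y + t *\<^sub>R e) \<partial>lborel \<partial>H)" if [measurable]: "h \<in> borel_measurable borel" for h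
  proof -
    have "(\<integral>\<^sup>+x. h x \<partial>\<mu>) = (\<integral>\<^sup>+z. h (case z of (y, t) \<Rightarrow> y + t *\<^sub>R e) \<partial>(H \<Otimes>\<^sub>M lborel))"
      unfolding \<mu>_def by (rule nn_integral_distr) simp_all
    also have "\<dots> = (\<integral>\<^sup>+y. \<integral>\<^sup>+t. h (y + t *\<^sub>R e) \<partial>lborel \<partial>H)"
      by (subst lborel.nn_integral_fst[symmetric]) simp_all
    finally show ?thesis .
  qed
  define D where "D = 2 * real DIM('a) / norm e"
  have D: "0 \<le> D" by (simp add: D_def)
  have cubes: "emeasure \<mu> (cbox c (c + s *\<^sub>R One)) \<le> ennreal (C * D) * emeasure lborel (cbox c (c + s *\<^sub>R One))" if s: "0 < s" for c s
  proof -
    let ?Q = "cbox c (c + s *\<^sub>R One)"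
    define j where "j y = (\<integral>\<^sup>+t. indicator ?Q (y + t *\<^sub>R e) \<partial>lborel)" for y
    have jm[measurable]: "j \<in> borel_measurable H" unfolding j_def by measurable
    have jle: "j y \<le> ennreal (D * s)" for y
    proof (cases "\<exists>t0. y + t0 *\<^sub>R e \<in> ?Q")
      case True
      then obtain t0 where t0: "y + t0 *\<^sub>R e \<in> ?Q" by blast
      let ?d = "real DIM('a) * s / norm e"
      have ind: "indicator ?Q (y + t *\<^sub>R e) \<le> (indicator {t0 - ?d..t0 + ?d} t :: ennreal)" for t
      proof (cases "y + t *\<^sub>R e \<in> ?Q")
        case True
        let ?v = "(y + t *\<^sub>R e) - (y + t0 *\<^sub>R e)"
        have "\<bar>?v \<bullet> b\<bar> \<le> s" if "b \<in> Basis" for b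
          using True t0 that unfolding mem_box inner_add_left inner_diff_left by (force simp: abs_le_iff)
        then have "(\<Sum>b\<in>Basis. \<bar>?v \<bullet> b\<bar>) \<le> real DIM('a) * s" by (intro sum_bounded_above) auto
        then have "norm ?v \<le> real DIM('a) * s" using norm_le_l1[of ?v] by linarith
        moreover have "?v = (t - t0) *\<^sub>R e" by (simp add: algebra_simps)
        ultimately have "\<bar>t - t0\<bar> * norm e \<le> real DIM('a) * s" by simp
        then have "\<bar>t - t0\<bar> \<le> ?d" using \<open>e \<noteq> 0\<close> by (simp add: pos_le_divide_eq)
        then have "t \<in> {t0 - ?d..t0 + ?d}" by (auto simp: abs_le_iff)
        then show ?thesis by (simp add: indicator_def)
      qed simp
      have "j y \<le> (\<integral>\<^sup>+t. indicator {t0 - ?d..t0 + ?d} t \<partial>lborel)"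
        unfolding j_def by (intro nn_integral_mono ind)
      also have "\<dots> = ennreal (D * s)"
        using s by (simp add: emeasure_lborel_Icc_eq D_def)
      finally show ?thesis .
    next
      case False
      then have "indicator ?Q (y + t *\<^sub>R e) = (0 :: ennreal)" for t by (simp add: indicator_def)
      then have "j y = 0" unfolding j_def by (simp only: nn_integral_const mult_zero_left)
      then show ?thesis by simp
    qed
    define V where "V = {y \<in> space H. j y \<noteq> 0}"
    have V: "V \<in> sets H" unfolding V_def using jm by measurable
    have "emeasure H V \<le> hausdorff_outer N {y \<in> S. \<exists>t. y + t *\<^sub>R e \<in> ?Q}"
      unfolding H[OF V]
    proof (rule hausdorff_outer_mono, rule subsetI)
      fix y assume y: "y \<in> V"
      have "\<exists>t. y + t *\<^sub>R e \<in> ?Q"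
      proof (rule ccontr)
        assume "\<nexists>t. y + t *\<^sub>R e \<in> ?Q"
        then have "indicator ?Q (y + t *\<^sub>R e) = (0 :: ennreal)" for t by (simp add: indicator_def)
        then have "j y = 0" unfolding j_def by (simp only: nn_integral_const mult_zero_left)
        with y show False by (simp add: V_def)
      qed
      with y show "y \<in> {y \<in> S. \<exists>t. y + t *\<^sub>R e \<in> ?Q}" by (simp add: V_def)
    qed
    also have "\<dots> \<le> ennreal (C * s ^ N)" by (rule C(2)[OF s])
    finally have V_le: "emeasure H V \<le> ennreal (C * s ^ N)" .
    have "emeasure \<mu> ?Q = (\<integral>\<^sup>+x. indicator ?Q x \<partial>\<mu>)" by (simp add: \<mu>_def)
    also have "\<dots> = (\<integral>\<^sup>+y. j y \<partial>H)" unfolding j_def by (rule nn) simp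
    also have "\<dots> \<le> (\<integral>\<^sup>+y. ennreal (D * s) * indicator V y \<partial>H)"
      using jle by (intro nn_integral_mono) (auto simp: V_def indicator_def)
    also have "\<dots> = ennreal (D * s) * emeasure H V" by (rule nn_integral_cmult_indicator[OF V])
    also have "\<dots> \<le> ennreal (D * s) * ennreal (C * s ^ N)" by (intro mult_left_mono V_le) simp
    also have "\<dots> = ennreal (C * D * s ^ DIM('a))"
    proof -
      have "DIM('a) = Suc N" by (simp add: N_def)
      then have "C * D * s ^ DIM('a) = (D * s) * (C * s ^ N)" by simp
      then show ?thesis using C(1) D s by (simp only:) (rule ennreal_mult[symmetric], auto)
    qed
    also have "\<dots> = ennreal (C * D) * emeasure lborel ?Q"
    proof -
      have "emeasure lborel ?Q = ennreal (s ^ DIM('a))"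
        using s by (simp add: emeasure_lborel_cbox_eq inner_add_left)
      then show ?thesis using C(1) D s by (simp only:) (rule ennreal_mult, auto)
    qed
    finally show ?thesis .
  qed
  have le: "emeasure \<mu> A \<le> ennreal (C * D) * emeasure lborel A" if "A \<in> sets borel" for A
    by (rule emeasure_le_lborel_if_cubes[OF _ _ cubes that]) (use C(1) D in \<open>auto simp: \<mu>_def\<close>)
  have "(\<integral>\<^sup>+y. \<integral>\<^sup>+t. h (y + t *\<^sub>R e) \<partial>lborel \<partial>H) \<le> ennreal (C * D) * (\<integral>\<^sup>+x. h x \<partial>lborel)"
    if h: "h \<in> borel_measurable borel" for h
  proof -
    have "\<mu> \<le> scale_measure (ennreal (C * D)) lborel"
      by (subst le_measure) (use le in \<open>auto simp: \<mu>_def\<close>)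
    then have "nn_integral \<mu> h \<le> nn_integral (scale_measure (ennreal (C * D)) lborel) h"
      by (rule nn_integral_mono_measure[rotated]) (simp add: \<mu>_def)
    with h show ?thesis by (simp add: nn nn_integral_scale_measure)
  qed
  with C(1) D show "\<exists>C\<ge>0. \<forall>h\<in>borel_measurable borel.
      (\<integral>\<^sup>+y. \<integral>\<^sup>+t. h (y + t *\<^sub>R e) \<partial>lborel \<partial>restrict_space (hausdorff_measure (DIM('a) - 1)) S) \<le> ennreal C * (\<integral>\<^sup>+x. h x \<partial>lborel)"
    unfolding H_def[symmetric] N_def[symmetric] by (intro exI[of _ "C * D"] conjI ballI) auto
  show "finite_measure (restrict_space (hausdorff_measure (DIM('a) - 1)) S)"
    using H.finite_measure_axioms by (simp add: H_def N_def)
qed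

section \<open>The trace at the end of one line\<close>

lemma AE_lborel_negligible:
  assumes "AE x in (lborel :: 'a::euclidean_space measure). P x"
  shows "negligible {x. \<not> P x}"
proof -
  obtain N where "{x \<in> space lborel. \<not> P x} \<subseteq> N" "emeasure lborel N = 0" "N \<in> sets lborel"
    using AE_E[OF assms] by metis
  then have "N \<in> null_sets lborel" by auto
  then have "negligible N" by (simp add: negligible_iff_null_sets null_sets_completionI)
  then show ?thesis by (rule negligible_subset) (use \<open>_ \<subseteq> N\<close> in simp)
qed

text \<open>
  The averages only see the almost-everywhere class of \<open>F\<close>, hence may be computed from a continuous
  representative \<open>K\<close>.
\<close>

lemma average_tendsto:
  fixes F K :: "real \<Rightarrow> complex"
  assumes "0 < d" and K: "continuous_on {0..d} K"
    and eq: "AE t in lborel. 0 < t \<and> t < d \<longrightarrow> F t = K t"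
  shows "(\<lambda>n. real (Suc n) *\<^sub>R integral {0..1 / real (Suc n)} F) \<longlonglongrightarrow> K 0"
proof (rule metric_LIMSEQ_I)
  fix \<epsilon> :: real assume "0 < \<epsilon>"
  obtain \<eta> where \<eta>: "0 < \<eta>" "\<And>t. t \<in> {0..d} \<Longrightarrow> dist t 0 < \<eta> \<Longrightarrow> dist (K t) (K 0) < \<epsilon> / 2"
    using K \<open>0 < \<epsilon>\<close> \<open>0 < d\<close> unfolding continuous_on_iff by (metis atLeastAtMost_iff half_gt_zero less_eq_real_def)
  obtain n0 where n0: "1 / real (Suc n0) < min \<eta> d"
    using nat_approx_posE[of "min \<eta> d"] \<eta>(1) \<open>0 < d\<close> by auto
  have "dist (real (Suc n) *\<^sub>R integral {0..1 / real (Suc n)} F) (K 0) < \<epsilon>" if "n0 \<le> n" for n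
  proof -
    define s where "s = 1 / real (Suc n)"
    have "s \<le> 1 / real (Suc n0)" unfolding s_def using that by (intro divide_left_mono) auto
    with n0 have s: "0 < s" "s < \<eta>" "s < d" by (auto simp: s_def)
    have "integral {0..s} F = integral {0..s} K"
    proof (rule integral_spike)
      show "negligible ({t. \<not> (0 < t \<and> t < d \<longrightarrow> F t = K t)} \<union> {0})"
        using AE_lborel_negligible[OF eq] by (simp add: negligible_Un)
    qed (use s in auto)
    moreover have cK: "continuous_on {0..s} K" using K s by (auto intro: continuous_on_subset)
    then have "integral {0..s} K - s *\<^sub>R K 0 = integral {0..s} (\<lambda>t. K t - K 0)"
      using s by (subst Henstock_Kurzweil_Integration.integral_diff) (auto intro: integrable_continuous_interval)
    moreover have "norm (integral {0..s} (\<lambda>t. K t - K 0)) \<le> \<epsilon> / 2 * (s - 0)"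
    proof (rule integral_bound)
      show "continuous_on {0..s} (\<lambda>t. K t - K 0)" by (intro continuous_intros cK)
      show "norm (K t - K 0) \<le> \<epsilon> / 2" if "t \<in> {0..s}" for t
        using \<eta>(2)[of t] that s by (auto simp: dist_norm)
    qed (use s in simp)
    ultimately have "norm (integral {0..s} F - s *\<^sub>R K 0) \<le> \<epsilon> / 2 * s" by simp
    then have "real (Suc n) * norm (integral {0..s} F - s *\<^sub>R K 0) \<le> real (Suc n) * (\<epsilon> / 2 * s)"
      by (rule mult_left_mono) simp
    also have "\<dots> < \<epsilon>" using \<open>0 < \<epsilon>\<close> by (simp add: s_def del: of_nat_Suc)
    finally have "real (Suc n) * norm (integral {0..s} F - s *\<^sub>R K 0) < \<epsilon>" .
    moreover have "real (Suc n) *\<^sub>R integral {0..s} F - K 0 = real (Suc n) *\<^sub>R (integral {0..s} F - s *\<^sub>R K 0)"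
      by (simp add: s_def scaleR_diff_right del: of_nat_Suc)
    ultimately show ?thesis unfolding dist_norm s_def[symmetric] by simp
  qed
  then show "\<exists>n0. \<forall>n\<ge>n0. dist (real (Suc n) *\<^sub>R integral {0..1 / real (Suc n)} F) (K 0) < \<epsilon>" by blast
qed

lemma square_integrable_on_interval:
  fixes G :: "real \<Rightarrow> complex"
  assumes [measurable]: "G \<in> borel_measurable borel" and "0 \<le> b" "0 < \<delta>"
    and G2: "(\<integral>\<^sup>+t. indicator {0..\<delta>} t * ennreal ((cmod (G t))\<^sup>2) \<partial>lborel) = ennreal b"
  shows "set_integrable lborel {0..\<delta>} G" and "(LINT t:{0..\<delta>}|lborel. cmod (G t))\<^sup>2 \<le> \<delta> * b"
proof -
  let ?I = "indicator {0..\<delta>} :: real \<Rightarrow> ennreal"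
  have "(\<integral>\<^sup>+t. ?I t * (?I t * ennreal (cmod (G t))) \<partial>lborel)\<^sup>2 \<le>
      (\<integral>\<^sup>+t. (?I t)\<^sup>2 \<partial>lborel) * (\<integral>\<^sup>+t. (?I t * ennreal (cmod (G t)))\<^sup>2 \<partial>lborel)"
    by (rule Cauchy_Schwarz_nn_integral) auto
  also have "(\<integral>\<^sup>+t. (?I t)\<^sup>2 \<partial>lborel) = (\<integral>\<^sup>+t. ?I t \<partial>lborel)"
    by (intro nn_integral_cong) (auto simp: indicator_def)
  also have "\<dots> = ennreal \<delta>" using \<open>0 < \<delta>\<close> by (simp add: emeasure_lborel_Icc_eq)
  also have "(\<integral>\<^sup>+t. (?I t * ennreal (cmod (G t)))\<^sup>2 \<partial>lborel) = ennreal b"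
    unfolding G2[symmetric] by (intro nn_integral_cong) (auto simp: indicator_def ennreal_power)
  also have "(\<integral>\<^sup>+t. ?I t * (?I t * ennreal (cmod (G t))) \<partial>lborel) = (\<integral>\<^sup>+t. ennreal (norm (indicat_real {0..\<delta>} t *\<^sub>R G t)) \<partial>lborel)"
    by (intro nn_integral_cong) (auto simp: indicator_def)
  finally have le: "(\<integral>\<^sup>+t. ennreal (norm (indicat_real {0..\<delta>} t *\<^sub>R G t)) \<partial>lborel)\<^sup>2 \<le> ennreal (\<delta> * b)"
    using assms by (simp add: ennreal_mult')
  have "(\<integral>\<^sup>+t. ennreal (norm (indicat_real {0..\<delta>} t *\<^sub>R G t)) \<partial>lborel)\<^sup>2 < top"
    by (rule le_less_trans[OF le]) simp
  then have "(\<integral>\<^sup>+t. ennreal (norm (indicat_real {0..\<delta>} t *\<^sub>R G t)) \<partial>lborel) < \<infinity>"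
    by (simp add: power_less_top_ennreal)
  then show int: "set_integrable lborel {0..\<delta>} G"
    unfolding set_integrable_def by (intro integrableI_bounded) auto
  have "(\<integral>\<^sup>+t. ennreal (norm (indicat_real {0..\<delta>} t *\<^sub>R G t)) \<partial>lborel) = ennreal (LINT t|lborel. norm (indicat_real {0..\<delta>} t *\<^sub>R G t))"
    by (rule nn_integral_eq_integral[OF integrable_norm[OF int[unfolded set_integrable_def]]]) auto
  also have "(LINT t|lborel. norm (indicat_real {0..\<delta>} t *\<^sub>R G t)) = (LINT t:{0..\<delta>}|lborel. cmod (G t))"
    by (simp add: set_lebesgue_integral_def)
  finally show "(LINT t:{0..\<delta>}|lborel. cmod (G t))\<^sup>2 \<le> \<delta> * b"
    using le assms by (simp add: ennreal_power set_lebesgue_integral_def)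
qed

text \<open>
  With \<open>H\<close> the primitive of \<open>G\<close> that vanishes at \<open>0\<close>, the hypothesis says that \<open>F - H\<close> is almost everywhere
  constant to the right of almost every point \<open>s\<close>; any two of these constants agree because the two
  half-intervals overlap, so \<open>F = c + H\<close> almost everywhere. Then \<open>|c|\<^sup>2 \<le> 2|F|\<^sup>2 + 2|H|\<^sup>2\<close>, with \<open>|H|\<^sup>2\<close>
  controlled by the Cauchy-Schwarz inequality, is integrated over \<open>[0, \<delta>]\<close>.
\<close>

lemma line_trace:
  fixes F G :: "real \<Rightarrow> complex"
  assumes [measurable]: "F \<in> borel_measurable borel" "G \<in> borel_measurable borel"
    and "0 < \<delta>" "0 \<le> a" "0 \<le> b"
    and F2: "(\<integral>\<^sup>+t. indicator {0..\<delta>} t * ennreal ((cmod (F t))\<^sup>2) \<partial>lborel) = ennreal a"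
    and G2: "(\<integral>\<^sup>+t. indicator {0..\<delta>} t * ennreal ((cmod (G t))\<^sup>2) \<partial>lborel) = ennreal b"
    and inc: "AE s in lborel. AE r in lborel. 0 < s \<and> 0 < r \<and> s + r < \<delta> \<longrightarrow>
       F (s + r) = F s + (LINT u:{0..r}|lborel. G (s + u))"
  obtains c where "(\<lambda>n. real (Suc n) *\<^sub>R integral {0..1 / real (Suc n)} F) \<longlonglongrightarrow> c"
    and "(cmod c)\<^sup>2 \<le> 2 / \<delta> * a + 2 * \<delta> * b"
proof -
  note G = square_integrable_on_interval[OF assms(2,5,3) G2]
  define H where "H t = (LINT u:{0..t}|lborel. G u)" for t
  define K where "K t = F t - H t" for t
  have Gi: "set_integrable lborel A G" if "A \<subseteq> {0..\<delta>}" "A \<in> sets borel" for A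
    using set_integrable_subset[OF G(1)] that by auto
  have Hadd: "H (s + r) = H s + (LINT u:{0..r}|lborel. G (s + u))" if "0 < s" "0 < r" "s + r < \<delta>" for s r
  proof -
    have "(LINT u:{0..r}|lborel. G (s + u)) = (LINT u|lborel. indicat_real {s..s + r} (u + s) *\<^sub>R G (u + s))"
      unfolding set_lebesgue_integral_def by (intro Bochner_Integration.integral_cong) (auto simp: indicator_def add.commute)
    also have "\<dots> = (LINT u:{s..s + r}|lborel. G u)"
      unfolding set_lebesgue_integral_def by (rule lborel_translate(2)) simp
    finally have 1: "(LINT u:{0..r}|lborel. G (s + u)) = (LINT u:{s..s + r}|lborel. G u)" .
    have "H (s + r) = (LINT u|lborel. indicat_real {0..s} u *\<^sub>R G u + indicat_real {s..s + r} u *\<^sub>R G u)"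
      unfolding H_def set_lebesgue_integral_def
    proof (rule integral_cong_AE)
      show "AE u in lborel. indicat_real {0..s + r} u *\<^sub>R G u = indicat_real {0..s} u *\<^sub>R G u + indicat_real {s..s + r} u *\<^sub>R G u"
        using AE_lborel_singleton[of s] by eventually_elim (use that in \<open>auto simp: indicator_def\<close>)
    qed auto
    also have "\<dots> = H s + (LINT u:{s..s + r}|lborel. G u)"
      unfolding H_def set_lebesgue_integral_def
      using Gi[of "{0..s}"] Gi[of "{s..s + r}"] that
      by (intro Bochner_Integration.integral_add) (auto simp: set_integrable_def)
    finally show ?thesis by (simp add: 1)
  qed
  have Hc: "continuous_on {0..\<delta>} H"
  proof -
    have e: "integral {0..t} G = H t" if "t \<in> {0..\<delta>}" for t
      unfolding H_def using Gi[of "{0..t}"] that by (intro set_borel_integral_eq_integral(2)[symmetric]) auto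
    have "continuous_on {0..\<delta>} (\<lambda>t. integral {0..t} G)"
      by (intro indefinite_integral_continuous_1 set_borel_integral_eq_integral(1) G(1))
    then show ?thesis by (rule continuous_on_eq) (rule e)
  qed
  have H0: "H 0 = 0"
  proof -
    have "AE u in lborel. indicat_real {0..0} u *\<^sub>R G u = 0"
      using AE_lborel_singleton[of "0::real"] by eventually_elim (simp add: indicator_def)
    then show ?thesis
      unfolding H_def set_lebesgue_integral_def by (rule integral_eq_zero_AE)
  qed
  have [measurable]: "H \<in> borel_measurable borel"
  proof -
    have "(\<lambda>t. LINT u|lborel. indicat_real {u. 0 \<le> u \<and> u \<le> t} u *\<^sub>R G u) \<in> borel_measurable borel"
      by measurable
    then show ?thesis by (simp add: H_def[abs_def] set_lebesgue_integral_def atLeastAtMost_def atLeast_def atMost_def Int_def)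
  qed
  have [measurable]: "K \<in> borel_measurable borel" unfolding K_def by measurable
  \<comment> \<open>almost every point \<open>s\<close> determines a constant for the half-interval to its right\<close>
  define good where "good s \<longleftrightarrow> (AE t in lborel. s < t \<and> t < \<delta> \<longrightarrow> K t = K s)" for s
  have good: "AE s in lborel. 0 < s \<and> s < \<delta> \<longrightarrow> good s"
    using inc
  proof eventually_elim
    case (elim s)
    show ?case
    proof
      assume s: "0 < s \<and> s < \<delta>"
      have "AE t in distr lborel borel ((+) s). s < t \<and> t < \<delta> \<longrightarrow> K t = K s"
      proof (subst AE_distr_iff)
        show "AE r in lborel. s < s + r \<and> s + r < \<delta> \<longrightarrow> K (s + r) = K s"
          using elim by eventually_elim (use s Hadd in \<open>auto simp: K_def\<close>)
      qed auto
      then show "good s" unfolding good_def lborel_distr_plus .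
    qed
  qed
  have ex: "\<exists>t. P t \<and> l < t \<and> t < \<delta>" if "AE t in lborel. P t" "l < \<delta>" for P l
  proof (rule ccontr)
    assume "\<not> ?thesis"
    then have none: "\<And>t. P t \<Longrightarrow> t \<notin> {l<..<\<delta>}" by auto
    have "AE t in lborel. t \<notin> {l<..<\<delta>}"
      using that(1) by eventually_elim (rule none)
    then have "{l<..<\<delta>} \<in> null_sets lborel"
      by (subst AE_iff_null_sets) auto
    then show False using that(2) by (simp add: null_sets_def)
  qed
  obtain s0 where s0: "0 < s0" "s0 < \<delta>" "good s0" using ex[OF good \<open>0 < \<delta>\<close>] by blast
  define c where "c = K s0"
  have "K s = c" if "0 < s" "s < \<delta>" "good s" for s
  proof -
    have "AE t in lborel. (s < t \<and> t < \<delta> \<longrightarrow> K t = K s) \<and> (s0 < t \<and> t < \<delta> \<longrightarrow> K t = K s0)"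
      using that(3) s0(3) by (auto simp: good_def)
    from ex[OF this, of "max s s0"] that s0 show ?thesis by (auto simp: c_def)
  qed
  with good have Fc: "AE t in lborel. 0 < t \<and> t < \<delta> \<longrightarrow> F t = c + H t"
    by (auto elim!: eventually_mono simp: K_def algebra_simps)
  have "(\<lambda>n. real (Suc n) *\<^sub>R integral {0..1 / real (Suc n)} F) \<longlonglongrightarrow> c + H 0"
    by (rule average_tendsto[OF \<open>0 < \<delta>\<close> _ Fc]) (intro continuous_intros Hc)
  then have lim: "(\<lambda>n. real (Suc n) *\<^sub>R integral {0..1 / real (Suc n)} F) \<longlonglongrightarrow> c" by (simp add: H0)
  have Hb: "(cmod (H t))\<^sup>2 \<le> \<delta> * b" if "0 < t" "t < \<delta>" for t
  proof -
    have "cmod (H t) \<le> (LINT u|lborel. norm (indicat_real {0..t} u *\<^sub>R G u))"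
      unfolding H_def set_lebesgue_integral_def by (rule integral_norm_bound)
    also have "\<dots> \<le> (LINT u:{0..\<delta>}|lborel. cmod (G u))"
      unfolding set_lebesgue_integral_def
      using Gi[of "{0..t}"] G(1) that
      by (intro integral_mono) (auto simp: set_integrable_def indicator_def dest: integrable_norm)
    finally have "(cmod (H t))\<^sup>2 \<le> (LINT u:{0..\<delta>}|lborel. cmod (G u))\<^sup>2" by (intro power_mono) auto
    with G(2) show ?thesis by linarith
  qed
  have "AE t in lborel. indicator {0..\<delta>} t * ennreal ((cmod c)\<^sup>2) \<le>
      2 * (indicator {0..\<delta>} t * ennreal ((cmod (F t))\<^sup>2)) + ennreal (2 * \<delta> * b) * indicator {0..\<delta>} t"
    using Fc AE_lborel_singleton[of "0::real"] AE_lborel_singleton[of \<delta>]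
  proof eventually_elim
    case (elim t)
    show ?case
    proof (cases "t \<in> {0..\<delta>}")
      case True
      with elim have t: "0 < t" "t < \<delta>" "c = F t - H t" by auto
      then have "(cmod c)\<^sup>2 \<le> (cmod (F t) + cmod (H t))\<^sup>2"
        by (intro power_mono) (auto intro: norm_triangle_ineq4)
      also have "\<dots> \<le> 2 * (cmod (F t))\<^sup>2 + 2 * (cmod (H t))\<^sup>2"
        using sum_squares_bound[of "cmod (F t)" "cmod (H t)"] by (simp add: power2_sum)
      also have "\<dots> \<le> 2 * (cmod (F t))\<^sup>2 + 2 * \<delta> * b" using Hb[OF t(1,2)] by simp
      finally have "ennreal ((cmod c)\<^sup>2) \<le> ennreal (2 * (cmod (F t))\<^sup>2 + 2 * \<delta> * b)" by (rule ennreal_leI)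
      with True assms show ?thesis by (simp add: ennreal_mult' flip: ennreal_numeral)
    qed simp
  qed
  then have "(\<integral>\<^sup>+t. indicator {0..\<delta>} t * ennreal ((cmod c)\<^sup>2) \<partial>lborel) \<le>
      (\<integral>\<^sup>+t. 2 * (indicator {0..\<delta>} t * ennreal ((cmod (F t))\<^sup>2)) + ennreal (2 * \<delta> * b) * indicator {0..\<delta>} t \<partial>lborel)"
    by (rule nn_integral_mono_AE)
  also have "\<dots> = 2 * ennreal a + ennreal (2 * \<delta> * b) * ennreal \<delta>"
    using \<open>0 < \<delta>\<close> by (simp add: nn_integral_add nn_integral_cmult F2 emeasure_lborel_Icc_eq)
  also have "(\<integral>\<^sup>+t. indicator {0..\<delta>} t * ennreal ((cmod c)\<^sup>2) \<partial>lborel) = ennreal \<delta> * ennreal ((cmod c)\<^sup>2)"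
    using \<open>0 < \<delta>\<close> by (simp add: nn_integral_multc emeasure_lborel_Icc_eq)
  finally have "ennreal (\<delta> * (cmod c)\<^sup>2) \<le> ennreal (2 * a + 2 * \<delta> * b * \<delta>)"
    using assms(3-5) by (simp add: ennreal_mult' flip: ennreal_numeral)
  then have "\<delta> * (cmod c)\<^sup>2 \<le> 2 * a + 2 * \<delta> * b * \<delta>"
    using assms(3-5) by (subst (asm) ennreal_le_iff) auto
  then have "(cmod c)\<^sup>2 \<le> 2 / \<delta> * a + 2 * \<delta> * b"
    using \<open>0 < \<delta>\<close> by (simp add: field_simps)
  with lim show thesis by (rule that)
qed

section \<open>Borel representatives of Sobolev functions\<close>

text \<open>
  Members of \<open>L\<^sup>2(\<Omega>)\<close> are only Lebesgue measurable, and Lebesgue measurability does not survive the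
  restriction to lines. A Borel version, extended by zero, does.
\<close>

lemma L2_representative:
  fixes h :: "'a::euclidean_space \<Rightarrow> complex"
  assumes h: "h \<in> L2_space (lebesgue_on \<Omega>)" and "open \<Omega>" "bounded \<Omega>"
  obtains h' where "h' \<in> borel_measurable borel" "\<And>x. x \<notin> \<Omega> \<Longrightarrow> h' x = 0" "AE x in lebesgue_on \<Omega>. h x = h' x"
    "(\<integral>\<^sup>+x. ennreal ((cmod (h' x))\<^sup>2) \<partial>lborel) = ennreal ((L2_norm (lebesgue_on \<Omega>) h)\<^sup>2)"
    "\<And>\<phi>. \<phi> \<in> borel_measurable borel \<Longrightarrow> (LINT x|lebesgue_on \<Omega>. h x * \<phi> x) = (LINT x|lborel. h' x * \<phi> x)"
    "integrable lborel h'"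
proof -
  have \<Omega>[measurable]: "\<Omega> \<in> sets borel" "\<Omega> \<in> sets lebesgue" using assms(2) by auto
  have hm: "h \<in> borel_measurable (lebesgue_on \<Omega>)" and hi: "integrable (lebesgue_on \<Omega>) (\<lambda>x. (cmod (h x))\<^sup>2)"
    using h by (auto simp: L2_space_def)
  define h0 where "h0 x = (if x \<in> \<Omega> then h x else 0)" for x
  have h0[measurable]: "h0 \<in> borel_measurable lebesgue"
    unfolding h0_def using hm \<Omega>(2) by (subst borel_measurable_if) auto
  obtain p where p[measurable]: "p \<in> borel_measurable lborel" "AE x in lborel. Re (h0 x) = p x"
    using completion_ex_borel_measurable_real[of "\<lambda>x. Re (h0 x)" lborel] h0 by auto
  obtain q where q[measurable]: "q \<in> borel_measurable lborel" "AE x in lborel. Im (h0 x) = q x"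
    using completion_ex_borel_measurable_real[of "\<lambda>x. Im (h0 x)" lborel] h0 by auto
  define h' where "h' x = indicat_real \<Omega> x *\<^sub>R (complex_of_real (p x) + \<i> * complex_of_real (q x))" for x
  have h'm[measurable]: "h' \<in> borel_measurable borel"
    unfolding h'_def using p(1) q(1) by simp
  have ae: "AE x in lborel. h0 x = h' x"
    using p(2) q(2)
  proof eventually_elim
    case (elim x)
    have "h0 x = complex_of_real (p x) + \<i> * complex_of_real (q x)" using elim by (metis complex_eq)
    then show ?case by (cases "x \<in> \<Omega>") (auto simp: h'_def h0_def)
  qed
  then have ae': "AE x in lebesgue. h0 x = h' x" by (simp add: AE_completion_iff)
  have zero: "h' x = 0" if "x \<notin> \<Omega>" for x using that by (simp add: h'_def)
  have "AE x in lebesgue_on \<Omega>. h x = h' x"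
    by (subst AE_restrict_space_iff) (use ae' in \<open>auto simp: h0_def elim!: eventually_mono\<close>)
  have nn: "(\<integral>\<^sup>+x. ennreal ((cmod (h' x))\<^sup>2) \<partial>lborel) = ennreal ((L2_norm (lebesgue_on \<Omega>) h)\<^sup>2)"
  proof -
    have "(\<integral>\<^sup>+x. ennreal ((cmod (h' x))\<^sup>2) \<partial>lborel) = (\<integral>\<^sup>+x. ennreal ((cmod (h' x))\<^sup>2) \<partial>lebesgue)"
      by (rule nn_integral_completion[symmetric])
    also have "\<dots> = (\<integral>\<^sup>+x. ennreal ((cmod (h0 x))\<^sup>2) \<partial>lebesgue)"
      by (rule nn_integral_cong_AE) (use ae' in \<open>auto elim!: eventually_mono\<close>)
    also have "\<dots> = (\<integral>\<^sup>+x. ennreal ((cmod (h x))\<^sup>2) * indicator \<Omega> x \<partial>lebesgue)"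
      by (intro nn_integral_cong) (auto simp: h0_def indicator_def)
    also have "\<dots> = (\<integral>\<^sup>+x. ennreal ((cmod (h x))\<^sup>2) \<partial>lebesgue_on \<Omega>)"
      by (subst nn_integral_restrict_space) auto
    also have "\<dots> = ennreal (LINT x|lebesgue_on \<Omega>. (cmod (h x))\<^sup>2)"
      by (rule nn_integral_eq_integral[OF hi]) auto
    finally show ?thesis by (simp add: L2_norm_def)
  qed
  have test: "(LINT x|lebesgue_on \<Omega>. h x * \<phi> x) = (LINT x|lborel. h' x * \<phi> x)"
    if [measurable]: "\<phi> \<in> borel_measurable borel" for \<phi>
  proof -
    have \<phi>l[measurable]: "\<phi> \<in> borel_measurable lebesgue" "h' \<in> borel_measurable lebesgue"
      using that h'm by (auto intro: measurable_completion)
    have "(LINT x|lebesgue_on \<Omega>. h x * \<phi> x) = (LINT x|lebesgue. indicat_real \<Omega> x *\<^sub>R (h x * \<phi> x))"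
      by (subst integral_restrict_space) auto
    also have "\<dots> = (LINT x|lebesgue. h0 x * \<phi> x)"
      by (intro Bochner_Integration.integral_cong) (auto simp: h0_def)
    also have "\<dots> = (LINT x|lebesgue. h' x * \<phi> x)"
      by (intro integral_cong_AE) (use ae' in \<open>auto elim!: eventually_mono\<close>)
    also have "\<dots> = (LINT x|lborel. h' x * \<phi> x)"
      by (rule integral_completion) measurable
    finally show ?thesis .
  qed
  have int: "integrable lborel h'"
  proof (rule integrableI_bounded)
    have "(\<integral>\<^sup>+x. ennreal (norm (h' x)) \<partial>lborel) \<le> (\<integral>\<^sup>+x. ennreal ((cmod (h' x))\<^sup>2) + indicator \<Omega> x \<partial>lborel)"
    proof (rule nn_integral_mono)
      fix x
      show "ennreal (norm (h' x)) \<le> ennreal ((cmod (h' x))\<^sup>2) + indicator \<Omega> x"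
      proof (cases "x \<in> \<Omega>")
        case True
        have "0 \<le> (cmod (h' x) - 1)\<^sup>2 + cmod (h' x)" by simp
        then have "cmod (h' x) \<le> (cmod (h' x))\<^sup>2 + 1" by (simp add: power2_diff)
        with True show ?thesis by (simp flip: ennreal_plus ennreal_1)
      qed (simp add: zero)
    qed
    also have "\<dots> = ennreal ((L2_norm (lebesgue_on \<Omega>) h)\<^sup>2) + emeasure lborel \<Omega>"
      by (subst nn_integral_add) (auto simp: nn)
    also have "\<dots> < \<infinity>"
      using emeasure_bounded_finite[OF assms(3)] by simp
    finally show "(\<integral>\<^sup>+x. ennreal (norm (h' x)) \<partial>lborel) < \<infinity>" .
  qed simp
  show thesis by (rule that[OF h'm zero \<open>AE x in lebesgue_on \<Omega>. h x = h' x\<close> nn test int])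
qed

lemma W1_norm_power2:
  "(W1_norm \<Omega> f)\<^sup>2 = (L2_norm (lebesgue_on \<Omega>) f)\<^sup>2 + (\<Sum>b\<in>Basis. (L2_norm (lebesgue_on \<Omega>) (weak_deriv \<Omega> b f))\<^sup>2)"
  unfolding W1_norm_def by (intro real_sqrt_pow2 add_nonneg_nonneg sum_nonneg) auto

text \<open>
  The derivative along \<open>e\<close> is the combination of the partial weak derivatives with the coordinates of
  \<open>e\<close>; its norm is estimated by the Cauchy-Schwarz inequality in these coordinates.
\<close>

lemma W1_representative:
  fixes f :: "'a::euclidean_space \<Rightarrow> complex" and e :: 'a
  assumes f: "f \<in> W1_space \<Omega>" and \<Omega>: "open \<Omega>" "bounded \<Omega>"
  obtains f' g' where "f' \<in> borel_measurable borel" "g' \<in> borel_measurable borel"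
    "AE x in lebesgue_on \<Omega>. f x = f' x" "integrable lborel f'" "integrable lborel g'"
    "(\<integral>\<^sup>+x. ennreal ((cmod (f' x))\<^sup>2) \<partial>lborel) \<le> ennreal ((W1_norm \<Omega> f)\<^sup>2)"
    "(\<integral>\<^sup>+x. ennreal ((cmod (g' x))\<^sup>2) \<partial>lborel) \<le> ennreal ((norm e)\<^sup>2 * (W1_norm \<Omega> f)\<^sup>2)"
    "has_weak_derivative_along \<Omega> e f' g'"
proof -
  let ?M = "lebesgue_on \<Omega>"
  have f2: "f \<in> L2_space ?M" using f by (simp add: W1_space_def)
  obtain f' where f': "f' \<in> borel_measurable borel" "AE x in ?M. f x = f' x"
    "(\<integral>\<^sup>+x. ennreal ((cmod (f' x))\<^sup>2) \<partial>lborel) = ennreal ((L2_norm ?M f)\<^sup>2)"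
    "\<And>\<phi>. \<phi> \<in> borel_measurable borel \<Longrightarrow> (LINT x|?M. f x * \<phi> x) = (LINT x|lborel. f' x * \<phi> x)"
    "integrable lborel f'"
    by (rule L2_representative[OF f2 \<Omega>]) blast
  have wd: "weak_deriv \<Omega> b f \<in> L2_space ?M \<and> is_weak_deriv \<Omega> b f (weak_deriv \<Omega> b f)" if "b \<in> Basis" for b
  proof -
    have "\<exists>g. g \<in> L2_space ?M \<and> is_weak_deriv \<Omega> b f g" using f that by (auto simp: W1_space_def)
    from someI_ex[OF this] show ?thesis unfolding weak_deriv_def .
  qed
  have "\<exists>k. k \<in> borel_measurable borel \<and>
    (\<integral>\<^sup>+x. ennreal ((cmod (k x))\<^sup>2) \<partial>lborel) = ennreal ((L2_norm ?M (weak_deriv \<Omega> b f))\<^sup>2) \<and>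
    (\<forall>\<phi>. \<phi> \<in> borel_measurable borel \<longrightarrow> (LINT x|?M. weak_deriv \<Omega> b f x * \<phi> x) = (LINT x|lborel. k x * \<phi> x)) \<and>
    integrable lborel k" if "b \<in> Basis" for b
    by (rule L2_representative[OF conjunct1[OF wd[OF that]] \<Omega>]) blast
  then have "\<exists>k. \<forall>b\<in>Basis. k b \<in> borel_measurable borel \<and>
    (\<integral>\<^sup>+x. ennreal ((cmod (k b x))\<^sup>2) \<partial>lborel) = ennreal ((L2_norm ?M (weak_deriv \<Omega> b f))\<^sup>2) \<and>
    (\<forall>\<phi>. \<phi> \<in> borel_measurable borel \<longrightarrow> (LINT x|?M. weak_deriv \<Omega> b f x * \<phi> x) = (LINT x|lborel. k b x * \<phi> x)) \<and>
    integrable lborel (k b)"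
    by (intro bchoice ballI)
  then obtain k where k: "\<And>b. b \<in> Basis \<Longrightarrow> k b \<in> borel_measurable borel"
    "\<And>b. b \<in> Basis \<Longrightarrow> (\<integral>\<^sup>+x. ennreal ((cmod (k b x))\<^sup>2) \<partial>lborel) = ennreal ((L2_norm ?M (weak_deriv \<Omega> b f))\<^sup>2)"
    "\<And>b \<phi>. b \<in> Basis \<Longrightarrow> \<phi> \<in> borel_measurable borel \<Longrightarrow> (LINT x|?M. weak_deriv \<Omega> b f x * \<phi> x) = (LINT x|lborel. k b x * \<phi> x)"
    "\<And>b. b \<in> Basis \<Longrightarrow> integrable lborel (k b)"
    by blast
  define g' where "g' x = (\<Sum>b\<in>Basis. (e \<bullet> b) *\<^sub>R k b x)" for x
  have g'm: "g' \<in> borel_measurable borel"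
    unfolding g'_def by (intro borel_measurable_sum borel_measurable_scaleR borel_measurable_const k(1))
  have g'i: "integrable lborel g'"
    unfolding g'_def by (intro Bochner_Integration.integrable_sum integrable_scaleR_right k(4))
  have "(\<integral>\<^sup>+x. ennreal ((cmod (f' x))\<^sup>2) \<partial>lborel) \<le> ennreal ((W1_norm \<Omega> f)\<^sup>2)"
    unfolding f'(3) W1_norm_power2 by (intro ennreal_leI) (simp add: sum_nonneg)
  moreover have "(\<integral>\<^sup>+x. ennreal ((cmod (g' x))\<^sup>2) \<partial>lborel) \<le> ennreal ((norm e)\<^sup>2 * (W1_norm \<Omega> f)\<^sup>2)"
  proof -
    have "(cmod (g' x))\<^sup>2 \<le> (norm e)\<^sup>2 * (\<Sum>b\<in>Basis. (cmod (k b x))\<^sup>2)" for x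
    proof -
      have "cmod (g' x) \<le> (\<Sum>b\<in>Basis. \<bar>e \<bullet> b\<bar> * cmod (k b x))"
        unfolding g'_def by (rule order_trans[OF norm_sum]) simp
      then have "(cmod (g' x))\<^sup>2 \<le> (\<Sum>b\<in>Basis. \<bar>e \<bullet> b\<bar> * cmod (k b x))\<^sup>2"
        by (intro power_mono) auto
      also have "\<dots> \<le> (\<Sum>b\<in>Basis. \<bar>e \<bullet> b\<bar>\<^sup>2) * (\<Sum>b\<in>Basis. (cmod (k b x))\<^sup>2)"
        by (rule Cauchy_Schwarz_ineq_sum)
      also have "(\<Sum>b\<in>Basis. \<bar>e \<bullet> b\<bar>\<^sup>2) = (norm e)\<^sup>2"
        by (subst power2_norm_eq_inner, subst (2) euclidean_inner) (simp add: power2_eq_square)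
      finally show ?thesis .
    qed
    then have "(\<integral>\<^sup>+x. ennreal ((cmod (g' x))\<^sup>2) \<partial>lborel) \<le>
       (\<integral>\<^sup>+x. ennreal ((norm e)\<^sup>2) * (\<Sum>b\<in>Basis. ennreal ((cmod (k b x))\<^sup>2)) \<partial>lborel)"
      by (intro nn_integral_mono) (auto simp: sum_ennreal ennreal_mult[symmetric] sum_nonneg)
    also have "\<dots> = ennreal ((norm e)\<^sup>2) * (\<Sum>b\<in>Basis. ennreal ((L2_norm ?M (weak_deriv \<Omega> b f))\<^sup>2))"
      using k(1,2) by (subst nn_integral_cmult, simp, subst nn_integral_sum) auto
    also have "\<dots> \<le> ennreal ((norm e)\<^sup>2 * (W1_norm \<Omega> f)\<^sup>2)"
      unfolding W1_norm_power2
      by (auto simp: sum_ennreal ennreal_mult[symmetric] sum_nonneg intro!: ennreal_leI mult_left_mono)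
    finally show ?thesis .
  qed
  moreover have "has_weak_derivative_along \<Omega> e f' g'"
    unfolding has_weak_derivative_along_def
  proof
    fix \<phi> assume \<phi>: "\<phi> \<in> test_functions \<Omega>"
    then have sm: "smooth \<phi>" by (simp add: test_functions_def)
    have \<phi>m: "\<phi> \<in> borel_measurable borel"
      by (rule borel_measurable_continuous_onI[OF smooth_continuous_on[OF sm]])
    have pm: "partial_deriv b \<phi> \<in> borel_measurable borel" if "b \<in> Basis" for b
      by (rule borel_measurable_continuous_onI[OF smooth_continuous_on[OF smooth_partial_deriv[OF sm that]]])
    have K: "compact (closure {x. \<phi> x \<noteq> 0})" using \<phi> by (simp add: test_functions_def)
    have bdd: "\<exists>B. \<forall>x. cmod (\<psi> x) \<le> B" if c: "continuous_on UNIV \<psi>" and z: "\<And>x. x \<notin> closure {x. \<phi> x \<noteq> 0} \<Longrightarrow> \<psi> x = 0" for \<psi> :: "'a \<Rightarrow> complex"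
    proof -
      have "compact (\<psi> ` closure {x. \<phi> x \<noteq> 0})"
        by (rule compact_continuous_image[OF continuous_on_subset[OF c] K]) simp
      then obtain B where "\<And>x. x \<in> closure {x. \<phi> x \<noteq> 0} \<Longrightarrow> cmod (\<psi> x) \<le> B"
        using compact_imp_bounded bounded_iff by (metis imageI)
      then have "cmod (\<psi> x) \<le> max B 0" for x using z[of x] by (cases "x \<in> closure {x. \<phi> x \<noteq> 0}") force+
      then show ?thesis by blast
    qed
    have pz: "partial_deriv b \<phi> x = 0" if "x \<notin> closure {x. \<phi> x \<noteq> 0}" for b x
    proof -
      have "((\<lambda>x. 0 :: complex) has_derivative (\<lambda>h. 0)) (at x)" by (rule has_derivative_const)
      then have "(\<phi> has_derivative (\<lambda>h. 0)) (at x)"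
      proof (rule has_derivative_transform_within_open[of _ _ _ _ "- closure {x. \<phi> x \<noteq> 0}"])
        show "0 = \<phi> y" if "y \<in> - closure {x. \<phi> x \<noteq> 0}" for y
          using that closure_subset[of "{x. \<phi> x \<noteq> 0}"] by auto
      qed (use that in auto)
      from partial_deriv_eqI[OF this] show ?thesis .
    qed
    have int: "integrable lborel (\<lambda>x. u x * \<psi> x)"
      if u: "integrable lborel u" and \<psi>: "\<psi> \<in> borel_measurable borel" "\<forall>x. cmod (\<psi> x) \<le> B" for u \<psi> :: "'a \<Rightarrow> complex" and B
    proof (rule Bochner_Integration.integrable_bound[of _ "\<lambda>x. B *\<^sub>R u x"])
      show "integrable lborel (\<lambda>x. B *\<^sub>R u x)" using u by simp
      show "(\<lambda>x. u x * \<psi> x) \<in> borel_measurable lborel"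
        using borel_measurable_integrable[OF u] \<psi>(1) by simp
      have "0 \<le> B" using \<psi>(2) norm_ge_zero order_trans by blast
      then show "AE x in lborel. cmod (u x * \<psi> x) \<le> cmod (B *\<^sub>R u x)"
        using \<psi>(2) by (auto simp: norm_mult mult.commute[of "cmod (u _)"] intro!: mult_right_mono)
    qed
    obtain B0 where B0: "\<forall>x. cmod (\<phi> x) \<le> B0"
      using bdd[OF smooth_continuous_on[OF sm]] closure_subset[of "{x. \<phi> x \<noteq> 0}"] by blast
    have fp: "integrable lborel (\<lambda>x. f' x * partial_deriv b \<phi> x)" if "b \<in> Basis" for b
      using bdd[OF smooth_continuous_on[OF smooth_partial_deriv[OF sm that]] pz] int[OF f'(5) pm[OF that]] by blast
    have kp: "integrable lborel (\<lambda>x. k b x * \<phi> x)" if "b \<in> Basis" for b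
      by (rule int[OF k(4)[OF that] \<phi>m B0])
    have "(LINT x|lborel. f' x * frechet_derivative \<phi> (at x) e) = (LINT x|lborel. (\<Sum>b\<in>Basis. (e \<bullet> b) *\<^sub>R (f' x * partial_deriv b \<phi> x)))"
      by (simp add: frechet_derivative_eq_sum[OF sm] sum_distrib_left)
    also have "\<dots> = (\<Sum>b\<in>Basis. (e \<bullet> b) *\<^sub>R (LINT x|lborel. f' x * partial_deriv b \<phi> x))"
      using fp by (subst Bochner_Integration.integral_sum) auto
    also have "\<dots> = (\<Sum>b\<in>Basis. (e \<bullet> b) *\<^sub>R (- (LINT x|lborel. k b x * \<phi> x)))"
    proof (rule sum.cong[OF refl])
      fix b :: 'a assume b: "b \<in> Basis"
      have "(LINT x|lborel. f' x * partial_deriv b \<phi> x) = - (LINT x|lborel. k b x * \<phi> x)"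
        using wd[OF b] \<phi> f'(4)[OF pm[OF b]] k(3)[OF b \<phi>m] unfolding is_weak_deriv_def by metis
      then show "(e \<bullet> b) *\<^sub>R (LINT x|lborel. f' x * partial_deriv b \<phi> x) = (e \<bullet> b) *\<^sub>R (- (LINT x|lborel. k b x * \<phi> x))"
        by simp
    qed
    also have "\<dots> = - (\<Sum>b\<in>Basis. (e \<bullet> b) *\<^sub>R (LINT x|lborel. k b x * \<phi> x))"
      by (simp add: sum_negf)
    also have "(\<Sum>b\<in>Basis. (e \<bullet> b) *\<^sub>R (LINT x|lborel. k b x * \<phi> x)) = (LINT x|lborel. (\<Sum>b\<in>Basis. (e \<bullet> b) *\<^sub>R (k b x * \<phi> x)))"
      using kp by (subst Bochner_Integration.integral_sum) auto
    also have "\<dots> = (LINT x|lborel. g' x * \<phi> x)"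
      by (simp add: g'_def sum_distrib_right)
    finally show "(LINT x|lborel. f' x * frechet_derivative \<phi> (at x) e) = - (LINT x|lborel. g' x * \<phi> x)" .
  qed
  ultimately show thesis using f' g'm g'i that by blast
qed

section \<open>The trace on a transversal piece\<close>

definition surface_on :: "'a::euclidean_space set \<Rightarrow> 'a measure" where
  "surface_on S = restrict_space (hausdorff_measure (DIM('a) - 1)) S"

text \<open>
  The averages are formed with the Henstock-Kurzweil integral, which ignores changes on a negligible set
  even when measurability of the function on the line is not known.
\<close>

definition line_average :: "'a::euclidean_space \<Rightarrow> ('a \<Rightarrow> complex) \<Rightarrow> nat \<Rightarrow> 'a \<Rightarrow> complex" where
  "line_average e f n y = real (Suc n) *\<^sub>R integral {0..1 / real (Suc n)} (\<lambda>t. f (y + t *\<^sub>R e))"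

locale transversal_piece =
  fixes \<Omega> S :: "'a::euclidean_space set" and e :: 'a and L \<delta> :: real
  assumes \<Omega>: "open \<Omega>" "bounded \<Omega>"
    and S: "S \<in> sets borel" "bounded S"
    and trans: "transversal S e L" "e \<noteq> 0" "0 \<le> L"
    and \<delta>: "0 < \<delta>" "\<And>y t. y \<in> S \<Longrightarrow> 0 < t \<Longrightarrow> t < \<delta> \<Longrightarrow> y + t *\<^sub>R e \<in> \<Omega>"
begin

lemma surface_measurable: "(\<lambda>y. y) \<in> measurable (surface_on S) borel"
  unfolding surface_on_def by (rule measurable_restrict_space1) simp

lemma space_surface_on [simp]: "space (surface_on S) = S"
  by (simp add: surface_on_def space_restrict_space)

text \<open>
  The line integral bound, applied to the indicator of a null set.
\<close>

lemma null_on_lines: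
  assumes "AE x in lborel. P x"
  shows "AE y in surface_on S. AE t in lborel. P (y + t *\<^sub>R e)"
proof -
  note surface_measurable[measurable]
  obtain N where N: "{x \<in> space lborel. \<not> P x} \<subseteq> N" "emeasure lborel N = 0" "N \<in> sets lborel"
    using AE_E[OF assms] by metis
  have [measurable]: "N \<in> sets borel" using N(3) by simp
  obtain C where C: "\<And>h. h \<in> borel_measurable borel \<Longrightarrow>
      (\<integral>\<^sup>+y. \<integral>\<^sup>+t. h (y + t *\<^sub>R e) \<partial>lborel \<partial>surface_on S) \<le> ennreal C * (\<integral>\<^sup>+x. h x \<partial>lborel)"
    using transversal_line_integral_bound(2)[OF S trans, folded surface_on_def] by blast
  have "(\<integral>\<^sup>+y. \<integral>\<^sup>+t. indicator N (y + t *\<^sub>R e) \<partial>lborel \<partial>surface_on S) = 0"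
    using C[of "indicator N"] N(2,3) by simp
  then have "AE y in surface_on S. (\<integral>\<^sup>+t. indicator N (y + t *\<^sub>R e) \<partial>lborel) = 0"
    by (subst (asm) nn_integral_0_iff_AE) measurable
  then show ?thesis
  proof eventually_elim
    case (elim y)
    then have "AE t in lborel. indicator N (y + t *\<^sub>R e) = (0 :: ennreal)"
      by (subst (asm) nn_integral_0_iff_AE) measurable
    then show ?case by eventually_elim (use N(1) in \<open>auto simp: indicator_def split: if_splits\<close>)
  qed
qed

lemma equal_on_lines:
  assumes "AE x in lebesgue_on \<Omega>. f x = f' x"
  shows "AE y in surface_on S. negligible {t. 0 < t \<and> t < \<delta> \<and> f (y + t *\<^sub>R e) \<noteq> f' (y + t *\<^sub>R e)}"
proof -
  have "AE x in lebesgue. x \<in> \<Omega> \<longrightarrow> f x = f' x"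
    using assms \<Omega>(1) by (subst (asm) AE_restrict_space_iff) auto
  then have "AE x in lborel. x \<in> \<Omega> \<longrightarrow> f x = f' x" by (simp add: AE_completion_iff)
  from null_on_lines[OF this] show ?thesis
  proof (rule AE_mp, intro AE_I2 impI)
    fix y assume y: "y \<in> space (surface_on S)"
      and ae: "AE t in lborel. y + t *\<^sub>R e \<in> \<Omega> \<longrightarrow> f (y + t *\<^sub>R e) = f' (y + t *\<^sub>R e)"
    show "negligible {t. 0 < t \<and> t < \<delta> \<and> f (y + t *\<^sub>R e) \<noteq> f' (y + t *\<^sub>R e)}"
      by (rule negligible_subset[OF AE_lborel_negligible[OF ae]]) (use \<delta>(2) y in auto)
  qed
qed

lemma line_average_cong:
  assumes neg: "negligible {t. 0 < t \<and> t < \<delta> \<and> f (y + t *\<^sub>R e) \<noteq> f' (y + t *\<^sub>R e)}"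
  shows "\<forall>\<^sub>F n in sequentially. line_average e f n y = line_average e f' n y"
    and "(\<lambda>t. f' (y + t *\<^sub>R e)) integrable_on {0..\<delta>} \<Longrightarrow> (\<lambda>t. f (y + t *\<^sub>R e)) integrable_on {0..\<delta>}"
proof -
  define N where "N = {t. 0 < t \<and> t < \<delta> \<and> f (y + t *\<^sub>R e) \<noteq> f' (y + t *\<^sub>R e)} \<union> {0, \<delta>}"
  have N: "negligible N" using neg by (simp add: N_def negligible_Un)
  have off: "f (y + t *\<^sub>R e) = f' (y + t *\<^sub>R e)" if "t \<in> {0..\<delta>} - N" for t
    using that by (auto simp: N_def)
  obtain n0 where n0: "1 / real (Suc n0) < \<delta>" using nat_approx_posE[OF \<delta>(1)] by blast
  have "line_average e f n y = line_average e f' n y" if "n0 \<le> n" for n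
  proof -
    have "1 / real (Suc n) \<le> 1 / real (Suc n0)" using that by (intro divide_left_mono) auto
    with n0 have "1 / real (Suc n) \<le> \<delta>" by linarith
    then have "integral {0..1 / real (Suc n)} (\<lambda>t. f (y + t *\<^sub>R e)) = integral {0..1 / real (Suc n)} (\<lambda>t. f' (y + t *\<^sub>R e))"
      by (intro integral_spike[OF N]) (use off in auto)
    then show ?thesis by (simp add: line_average_def)
  qed
  then show "\<forall>\<^sub>F n in sequentially. line_average e f n y = line_average e f' n y"
    using eventually_sequentially by blast
  show "(\<lambda>t. f (y + t *\<^sub>R e)) integrable_on {0..\<delta>}" if "(\<lambda>t. f' (y + t *\<^sub>R e)) integrable_on {0..\<delta>}"
    using that N by (rule integrable_spike) (use off in auto)
qed

text \<open>
  For each fixed length \<open>r\<close> the increment formula holds for almost every starting point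
  in space, hence for almost every \<open>(y, s)\<close>. Fubini's theorem exchanges \<open>r\<close> with \<open>(y, s)\<close>; this is
  where Borel measurability in all variables is used.
\<close>

lemma increments_on_lines:
  assumes [measurable]: "f' \<in> borel_measurable borel" "g' \<in> borel_measurable borel"
    and "integrable lborel f'" "integrable lborel g'" and weak: "has_weak_derivative_along \<Omega> e f' g'"
  shows "AE y in surface_on S. AE s in lborel. AE r in lborel. 0 < s \<and> 0 < r \<and> s + r < \<delta> \<longrightarrow>
    f' (y + (s + r) *\<^sub>R e) = f' (y + s *\<^sub>R e) + (LINT u:{0..r}|lborel. g' (y + (s + u) *\<^sub>R e))"
proof -
  note surface_measurable[measurable]
  interpret H: finite_measure "surface_on S" by (rule transversal_line_integral_bound(1)[OF S trans, folded surface_on_def])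
  interpret P: pair_sigma_finite "surface_on S" lborel ..
  interpret R: pair_sigma_finite lborel "surface_on S \<Otimes>\<^sub>M lborel" ..
  define J where "J x r = (LINT u|lborel. indicat_real {u. 0 \<le> u \<and> u \<le> r} u *\<^sub>R g' (x + u *\<^sub>R e))" for x r
  have J: "(LINT u:{0..r}|lborel. g' (x + u *\<^sub>R e)) = J x r" for x r
    by (simp add: J_def set_lebesgue_integral_def atLeastAtMost_def atLeast_def atMost_def Int_def)
  have [measurable]: "(\<lambda>p. J (fst p) (snd p)) \<in> borel_measurable (borel \<Otimes>\<^sub>M borel)"
    unfolding J_def by measurable
  define Q where "Q r y s \<longleftrightarrow> (0 < s \<and> 0 < r \<and> s + r < \<delta> \<longrightarrow>
     f' (y + (s + r) *\<^sub>R e) = f' (y + s *\<^sub>R e) + J (y + s *\<^sub>R e) r)" for r y s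
  have Jm: "(\<lambda>z. J (fst (snd z) + snd (snd z) *\<^sub>R e) (fst z)) \<in> borel_measurable (lborel \<Otimes>\<^sub>M (surface_on S \<Otimes>\<^sub>M lborel))"
    using measurable_compose[of "\<lambda>z. (fst (snd z) + snd (snd z) *\<^sub>R e, fst z)" "lborel \<Otimes>\<^sub>M (surface_on S \<Otimes>\<^sub>M lborel)" "borel \<Otimes>\<^sub>M borel" "\<lambda>p. J (fst p) (snd p)" borel]
    by simp
  note Jm[measurable]
  have meas: "{z \<in> space (lborel \<Otimes>\<^sub>M (surface_on S \<Otimes>\<^sub>M lborel)). Q (fst z) (fst (snd z)) (snd (snd z))} \<in> sets (lborel \<Otimes>\<^sub>M (surface_on S \<Otimes>\<^sub>M lborel))"
    unfolding Q_def by measurable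
  have "AE z in surface_on S \<Otimes>\<^sub>M lborel. Q r (fst z) (snd z)" for r
  proof (rule P.AE_pair_measure)
    have "(\<lambda>z. (r, z)) \<in> measurable (surface_on S \<Otimes>\<^sub>M lborel) (lborel \<Otimes>\<^sub>M (surface_on S \<Otimes>\<^sub>M lborel))"
      by measurable
    from measurable_sets[OF this meas]
    have "(\<lambda>z. (r, z)) -` {z \<in> space (lborel \<Otimes>\<^sub>M (surface_on S \<Otimes>\<^sub>M lborel)). Q (fst z) (fst (snd z)) (snd (snd z))} \<inter> space (surface_on S \<Otimes>\<^sub>M lborel)
      \<in> sets (surface_on S \<Otimes>\<^sub>M lborel)" .
    also have "(\<lambda>z. (r, z)) -` {z \<in> space (lborel \<Otimes>\<^sub>M (surface_on S \<Otimes>\<^sub>M lborel)). Q (fst z) (fst (snd z)) (snd (snd z))} \<inter> space (surface_on S \<Otimes>\<^sub>M lborel)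
      = {x \<in> space (surface_on S \<Otimes>\<^sub>M lborel). Q r (fst x) (snd x)}"
      by (auto simp: space_pair_measure)
    finally show "{x \<in> space (surface_on S \<Otimes>\<^sub>M lborel). Q r (fst x) (snd x)} \<in> sets (surface_on S \<Otimes>\<^sub>M lborel)" .
    show "AE y in surface_on S. AE s in lborel. Q r (fst (y, s)) (snd (y, s))"
    proof (cases "0 < r")
      case True
      have "AE x in lborel. (\<forall>u\<in>{0..r}. x + u *\<^sub>R e \<in> \<Omega>) \<longrightarrow> f' (x + r *\<^sub>R e) = f' x + J x r"
        using weak_derivative_increment[OF \<Omega>(1) assms(1-5), of r] True by (simp add: J)
      from null_on_lines[OF this]
      show ?thesis
      proof (rule AE_mp, intro AE_I2[where M = "surface_on S"] impI)
        fix y assume y: "y \<in> space (surface_on S)"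
          and ae: "AE s in lborel. (\<forall>u\<in>{0..r}. y + s *\<^sub>R e + u *\<^sub>R e \<in> \<Omega>) \<longrightarrow>
             f' (y + s *\<^sub>R e + r *\<^sub>R e) = f' (y + s *\<^sub>R e) + J (y + s *\<^sub>R e) r"
        show "AE s in lborel. Q r (fst (y, s)) (snd (y, s))"
          using ae
        proof eventually_elim
          case (elim s)
          have "y + s *\<^sub>R e + u *\<^sub>R e \<in> \<Omega>" if "0 < s" "s + r < \<delta>" "u \<in> {0..r}" for u
            using \<delta>(2)[of y "s + u"] that y by (simp add: scaleR_add_left add.assoc)
          with elim show ?case by (auto simp: Q_def scaleR_add_left add.assoc)
        qed
      qed
    qed (simp add: Q_def)
  qed
  then have "AE r in lborel. AE z in surface_on S \<Otimes>\<^sub>M lborel. Q r (fst z) (snd z)" by simp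
  then have "AE z in surface_on S \<Otimes>\<^sub>M lborel. AE r in lborel. Q r (fst z) (snd z)"
    using R.AE_commute[of "\<lambda>r z. Q r (fst z) (snd z)"] meas by simp
  from P.AE_pair[OF this] show ?thesis
    by (simp add: Q_def J[symmetric] scaleR_add_left add.assoc)
qed

text \<open>
  On almost every line the restrictions of \<open>f\<close> and its derivative are square integrable and satisfy
  the increment formula, so \<open>line_trace\<close> applies; its estimate is then integrated over \<open>S\<close>. The
  limit is realised as the limit of averages of a Borel representative in order to be measurable
  in \<open>y\<close>.
\<close>

lemma trace_bound_exists:
  "\<exists>C\<ge>0. \<forall>f\<in>W1_space \<Omega>. \<exists>h. h \<in> borel_measurable (surface_on S) \<and>
     (AE y in surface_on S. (\<lambda>n. line_average e f n y) \<longlonglongrightarrow> h y) \<and>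
     (AE y in surface_on S. (\<lambda>t. f (y + t *\<^sub>R e)) integrable_on {0..\<delta>}) \<and>
     (\<integral>\<^sup>+y. ennreal ((cmod (h y))\<^sup>2) \<partial>surface_on S) \<le> ennreal (C * (W1_norm \<Omega> f)\<^sup>2)"
proof -
  note surface_measurable[measurable]
  obtain C where C: "0 \<le> C" "\<And>h. h \<in> borel_measurable borel \<Longrightarrow>
      (\<integral>\<^sup>+y. \<integral>\<^sup>+t. h (y + t *\<^sub>R e) \<partial>lborel \<partial>surface_on S) \<le> ennreal C * (\<integral>\<^sup>+x. h x \<partial>lborel)"
    using transversal_line_integral_bound(2)[OF S trans, folded surface_on_def] by blast
  define D where "D = 2 / \<delta> * C + 2 * \<delta> * (C * (norm e)\<^sup>2)"
  have "0 \<le> D" using C(1) \<delta>(1) by (simp add: D_def)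
  moreover have "\<exists>h. h \<in> borel_measurable (surface_on S) \<and>
     (AE y in surface_on S. (\<lambda>n. line_average e f n y) \<longlonglongrightarrow> h y) \<and>
     (AE y in surface_on S. (\<lambda>t. f (y + t *\<^sub>R e)) integrable_on {0..\<delta>}) \<and>
     (\<integral>\<^sup>+y. ennreal ((cmod (h y))\<^sup>2) \<partial>surface_on S) \<le> ennreal (D * (W1_norm \<Omega> f)\<^sup>2)"
    if f: "f \<in> W1_space \<Omega>" for f
  proof -
    let ?W = "(W1_norm \<Omega> f)\<^sup>2"
    obtain f' g' where fg[measurable]: "f' \<in> borel_measurable borel" "g' \<in> borel_measurable borel"
      and ff': "AE x in lebesgue_on \<Omega>. f x = f' x" and int: "integrable lborel f'" "integrable lborel g'"
      and f2: "(\<integral>\<^sup>+x. ennreal ((cmod (f' x))\<^sup>2) \<partial>lborel) \<le> ennreal ?W"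
      and g2: "(\<integral>\<^sup>+x. ennreal ((cmod (g' x))\<^sup>2) \<partial>lborel) \<le> ennreal ((norm e)\<^sup>2 * ?W)"
      and weak: "has_weak_derivative_along \<Omega> e f' g'"
      using W1_representative[OF f \<Omega>, of e] by blast
    define A where "A k y = (\<integral>\<^sup>+t. indicator {0..\<delta>} t * ennreal ((cmod (k (y + t *\<^sub>R e)))\<^sup>2) \<partial>lborel)" for k :: "'a \<Rightarrow> complex" and y
    have Am: "A k \<in> borel_measurable (surface_on S)" if [measurable]: "k \<in> borel_measurable borel" for k
      unfolding A_def by measurable
    have Ale: "(\<integral>\<^sup>+y. A k y \<partial>surface_on S) \<le> ennreal (C * B)"
      if [measurable]: "k \<in> borel_measurable borel" and B: "(\<integral>\<^sup>+x. ennreal ((cmod (k x))\<^sup>2) \<partial>lborel) \<le> ennreal B" for k B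
    proof -
      have "(\<integral>\<^sup>+y. A k y \<partial>surface_on S) \<le> (\<integral>\<^sup>+y. \<integral>\<^sup>+t. ennreal ((cmod (k (y + t *\<^sub>R e)))\<^sup>2) \<partial>lborel \<partial>surface_on S)"
        unfolding A_def by (intro nn_integral_mono) (auto simp: indicator_def)
      also have "\<dots> \<le> ennreal C * (\<integral>\<^sup>+x. ennreal ((cmod (k x))\<^sup>2) \<partial>lborel)" by (rule C(2)) measurable
      also have "\<dots> \<le> ennreal C * ennreal B" by (intro mult_left_mono B) simp
      finally show ?thesis using C(1) by (simp add: ennreal_mult')
    qed
    have Afin: "AE y in surface_on S. A k y \<noteq> \<infinity>"
      if "k \<in> borel_measurable borel" "(\<integral>\<^sup>+x. ennreal ((cmod (k x))\<^sup>2) \<partial>lborel) \<le> ennreal B" for k B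
      by (rule nn_integral_PInf_AE[OF Am[OF that(1)]]) (use Ale[OF that] in \<open>auto simp: top_unique\<close>)
    define V where "V n y = real (Suc n) *\<^sub>R (LINT t:{0..1 / real (Suc n)}|lborel. f' (y + t *\<^sub>R e))" for n y
    have Vm[measurable]: "V n \<in> borel_measurable (surface_on S)" for n
      unfolding V_def set_lebesgue_integral_def by measurable
    define h where "h y = lim (\<lambda>n. V n y)" for y
    have hm: "h \<in> borel_measurable (surface_on S)"
      unfolding h_def by measurable
    have main: "AE y in surface_on S. (\<lambda>n. line_average e f n y) \<longlonglongrightarrow> h y \<and> (\<lambda>t. f (y + t *\<^sub>R e)) integrable_on {0..\<delta>} \<and>
       ennreal ((cmod (h y))\<^sup>2) \<le> ennreal (2 / \<delta>) * A f' y + ennreal (2 * \<delta>) * A g' y"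
      using increments_on_lines[OF fg int weak] equal_on_lines[OF ff'] Afin[OF fg(1) f2] Afin[OF fg(2) g2]
    proof eventually_elim
      case (elim y)
      define F where "F t = f' (y + t *\<^sub>R e)" for t
      define G where "G t = g' (y + t *\<^sub>R e)" for t
      have [measurable]: "F \<in> borel_measurable borel" "G \<in> borel_measurable borel"
        unfolding F_def G_def by measurable
      obtain a where a: "0 \<le> a" "A f' y = ennreal a" using elim(3) by (cases "A f' y") auto
      obtain b where b: "0 \<le> b" "A g' y = ennreal b" using elim(4) by (cases "A g' y") auto
      have F2: "(\<integral>\<^sup>+t. indicator {0..\<delta>} t * ennreal ((cmod (F t))\<^sup>2) \<partial>lborel) = ennreal a"
        and G2: "(\<integral>\<^sup>+t. indicator {0..\<delta>} t * ennreal ((cmod (G t))\<^sup>2) \<partial>lborel) = ennreal b"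
        using a b by (auto simp: A_def F_def G_def)
      obtain c where c: "(\<lambda>n. real (Suc n) *\<^sub>R integral {0..1 / real (Suc n)} F) \<longlonglongrightarrow> c"
        "(cmod c)\<^sup>2 \<le> 2 / \<delta> * a + 2 * \<delta> * b"
      proof (rule line_trace[OF _ _ \<delta>(1) a(1) b(1) F2 G2])
        show "AE s in lborel. AE r in lborel. 0 < s \<and> 0 < r \<and> s + r < \<delta> \<longrightarrow> F (s + r) = F s + (LINT u:{0..r}|lborel. G (s + u))"
          using elim(1) by (simp add: F_def G_def)
      qed auto
      have lim': "(\<lambda>n. line_average e f' n y) \<longlonglongrightarrow> c" using c(1) by (simp add: line_average_def F_def[abs_def])
      have Fi: "set_integrable lborel {0..\<delta>} F" by (rule square_integrable_on_interval(1)[OF _ a(1) \<delta>(1) F2]) simp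
      obtain n0 where n0: "1 / real (Suc n0) < \<delta>" using nat_approx_posE[OF \<delta>(1)] by blast
      have "line_average e f' n y = V n y" if "n0 \<le> n" for n
      proof -
        have "1 / real (Suc n) \<le> 1 / real (Suc n0)" using that by (intro divide_left_mono) auto
        with n0 have "{0..1 / real (Suc n)} \<subseteq> {0..\<delta>}" by auto
        from set_borel_integral_eq_integral(2)[OF set_integrable_subset[OF Fi _ this]]
        show ?thesis by (simp add: line_average_def V_def F_def[abs_def])
      qed
      then have "\<forall>\<^sub>F n in sequentially. line_average e f' n y = V n y"
        using eventually_sequentially by blast
      from Lim_transform_eventually[OF lim' this] have hy: "h y = c" unfolding h_def by (rule limI)
      have "\<forall>\<^sub>F n in sequentially. line_average e f' n y = line_average e f n y"
        using line_average_cong(1)[OF elim(2)] by (auto elim: eventually_mono)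
      from Lim_transform_eventually[OF lim' this] have "(\<lambda>n. line_average e f n y) \<longlonglongrightarrow> h y" by (simp add: hy)
      moreover have "(\<lambda>t. f (y + t *\<^sub>R e)) integrable_on {0..\<delta>}"
        using line_average_cong(2)[OF elim(2)] set_borel_integral_eq_integral(1)[OF Fi] by (simp add: F_def[abs_def])
      moreover have "ennreal ((cmod (h y))\<^sup>2) \<le> ennreal (2 / \<delta>) * A f' y + ennreal (2 * \<delta>) * A g' y"
      proof -
        have "ennreal ((cmod (h y))\<^sup>2) \<le> ennreal (2 / \<delta> * a + 2 * \<delta> * b)" unfolding hy by (rule ennreal_leI[OF c(2)])
        also have "\<dots> = ennreal (2 / \<delta> * a) + ennreal (2 * \<delta> * b)" by (rule ennreal_plus) (use a b \<delta>(1) in auto)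
        also have "\<dots> = ennreal (2 / \<delta>) * A f' y + ennreal (2 * \<delta>) * A g' y"
          unfolding a(2) b(2) using a b \<delta>(1) by (intro arg_cong2[where f = plus] ennreal_mult) auto
        finally show ?thesis .
      qed
      ultimately show ?case by blast
    qed
    have "(\<integral>\<^sup>+y. ennreal ((cmod (h y))\<^sup>2) \<partial>surface_on S) \<le> (\<integral>\<^sup>+y. ennreal (2 / \<delta>) * A f' y + ennreal (2 * \<delta>) * A g' y \<partial>surface_on S)"
      by (rule nn_integral_mono_AE) (use main in \<open>auto elim!: eventually_mono\<close>)
    also have "\<dots> = ennreal (2 / \<delta>) * (\<integral>\<^sup>+y. A f' y \<partial>surface_on S) + ennreal (2 * \<delta>) * (\<integral>\<^sup>+y. A g' y \<partial>surface_on S)"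
      using Am[OF fg(1)] Am[OF fg(2)] by (simp add: nn_integral_add nn_integral_cmult)
    also have "\<dots> \<le> ennreal (2 / \<delta>) * ennreal (C * ?W) + ennreal (2 * \<delta>) * ennreal (C * ((norm e)\<^sup>2 * ?W))"
      by (intro add_mono mult_left_mono Ale[OF fg(1) f2] Ale[OF fg(2) g2]) auto
    also have "\<dots> = ennreal (2 / \<delta> * (C * ?W)) + ennreal (2 * \<delta> * (C * ((norm e)\<^sup>2 * ?W)))"
      using C(1) \<delta>(1) by (intro arg_cong2[where f = plus] ennreal_mult[symmetric]) auto
    also have "\<dots> = ennreal (2 / \<delta> * (C * ?W) + 2 * \<delta> * (C * ((norm e)\<^sup>2 * ?W)))"
      using C(1) \<delta>(1) by (intro ennreal_plus[symmetric]) auto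
    also have "2 / \<delta> * (C * ?W) + 2 * \<delta> * (C * ((norm e)\<^sup>2 * ?W)) = D * ?W"
      by (simp add: D_def algebra_simps)
    finally have "(\<integral>\<^sup>+y. ennreal ((cmod (h y))\<^sup>2) \<partial>surface_on S) \<le> ennreal (D * ?W)" .
    moreover have "AE y in surface_on S. (\<lambda>n. line_average e f n y) \<longlonglongrightarrow> h y"
      "AE y in surface_on S. (\<lambda>t. f (y + t *\<^sub>R e)) integrable_on {0..\<delta>}"
      using main by (auto elim!: eventually_mono)
    ultimately show ?thesis using hm by blast
  qed
  ultimately show ?thesis by blast
qed

end

section \<open>The boundary of the Hartogs triangle\<close>

text \<open>
  The direction of a coordinate half-axis nearest to \<open>w\<close>.
\<close>

definition axis :: "complex \<Rightarrow> complex" where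
  "axis w = (if \<bar>Im w\<bar> \<le> \<bar>Re w\<bar> then (if 0 \<le> Re w then 1 else -1) else (if 0 \<le> Im w then \<i> else -\<i>))"

text \<open>
  The component of \<open>w\<close> along its half-axis. It is at least \<open>|w| / sqrt 2\<close>.
\<close>

definition axis_part :: "complex \<Rightarrow> real" where
  "axis_part w = Re (w * cnj (axis w))"

lemma axis_cases: "axis w \<in> {1, -1, \<i>, -\<i>}"
  by (simp add: axis_def)

lemma norm_axis [simp]: "cmod (axis w) = 1"
  by (simp add: axis_def)

lemma axis_mult_cnj [simp]: "axis w * cnj (axis w) = 1"
  by (simp add: axis_def)

lemma axis_measurable [measurable]: "axis \<in> borel_measurable borel"
  unfolding axis_def[abs_def] by measurable

lemma abs_Im_le_axis_part: "\<bar>Im (w * cnj (axis w))\<bar> \<le> axis_part w"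
  by (auto simp: axis_part_def axis_def)

lemma axis_part_bounds: "0 \<le> axis_part w" "(cmod w)\<^sup>2 \<le> 2 * (axis_part w)\<^sup>2" "axis_part w \<le> cmod w"
proof -
  let ?u = "w * cnj (axis w)"
  have i: "\<bar>Im ?u\<bar> \<le> axis_part w" by (rule abs_Im_le_axis_part)
  then show "0 \<le> axis_part w" by linarith
  have n: "cmod ?u = cmod w" by (simp add: norm_mult)
  have "(Im ?u)\<^sup>2 \<le> (axis_part w)\<^sup>2"
    using power_mono[OF i abs_ge_zero, of 2] by simp
  then show "(cmod w)\<^sup>2 \<le> 2 * (axis_part w)\<^sup>2"
    unfolding n[symmetric] cmod_power2 axis_part_def by simp
  show "axis_part w \<le> cmod w"
    unfolding n[symmetric] axis_part_def by (rule complex_Re_le_cmod)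
qed

lemma cmod_move_along_axis:
  "(cmod (w + of_real c * axis w))\<^sup>2 = (cmod w)\<^sup>2 + 2 * c * axis_part w + c\<^sup>2"
proof -
  have "(cmod (w + of_real c * axis w))\<^sup>2 = (cmod ((w + of_real c * axis w) * cnj (axis w)))\<^sup>2"
    by (simp add: norm_mult)
  also have "(w + of_real c * axis w) * cnj (axis w) = w * cnj (axis w) + of_real c"
    by (simp add: distrib_right mult.assoc)
  also have "(cmod (w * cnj (axis w) + of_real c))\<^sup>2 = (cmod (w * cnj (axis w)))\<^sup>2 + 2 * c * axis_part w + c\<^sup>2"
    unfolding cmod_power2 axis_part_def by (simp add: power2_eq_square algebra_simps)
  also have "cmod (w * cnj (axis w)) = cmod w" by (simp add: norm_mult)
  finally show ?thesis .
qed

text \<open>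
  In the sector around the positive half-axis the real part is determined by the imaginary part and
  the modulus, and depends on them in a Lipschitz way up to the vertex:
  \<open>(Re u - Re v)(Re u + Re v)\<close> is a combination of \<open>Im v - Im u\<close> and \<open>cmod u - cmod v\<close>
  whose coefficients are at most \<open>2 (Re u + Re v)\<close>.
\<close>

lemma sector_lipschitz:
  fixes u v :: complex
  assumes "\<bar>Im u\<bar> \<le> Re u" "\<bar>Im v\<bar> \<le> Re v"
  shows "\<bar>Re u - Re v\<bar> \<le> \<bar>Im u - Im v\<bar> + 2 * \<bar>cmod u - cmod v\<bar>"
proof (cases "Re u + Re v = 0")
  case True
  with assms have "Re u = 0" "Re v = 0" by linarith+
  then show ?thesis by simp
next
  case False
  let ?s = "Re u + Re v"
  have s: "0 < ?s" using False assms by linarith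
  have "\<bar>Re u\<bar> = Re u" "\<bar>Re v\<bar> = Re v" using assms by simp_all
  then have c: "cmod u + cmod v \<le> 2 * ?s"
    using cmod_le[of u] cmod_le[of v] assms unfolding distrib_left by linarith
  have "(Re u - Re v) * ?s = (Im v - Im u) * (Im u + Im v) + (cmod u - cmod v) * (cmod u + cmod v)"
    using cmod_power2[of u] cmod_power2[of v] by (simp add: power2_eq_square algebra_simps)
  then have "\<bar>Re u - Re v\<bar> * ?s = \<bar>(Im v - Im u) * (Im u + Im v) + (cmod u - cmod v) * (cmod u + cmod v)\<bar>"
    using s by (metis abs_mult abs_of_pos)
  also have "\<dots> \<le> \<bar>Im u - Im v\<bar> * \<bar>Im u + Im v\<bar> + \<bar>cmod u - cmod v\<bar> * (cmod u + cmod v)"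
    by (rule order_trans[OF abs_triangle_ineq]) (simp add: abs_mult abs_minus_commute)
  also have "\<dots> \<le> \<bar>Im u - Im v\<bar> * ?s + \<bar>cmod u - cmod v\<bar> * (2 * ?s)"
    using assms c by (intro add_mono mult_left_mono) auto
  finally have "\<bar>Re u - Re v\<bar> * ?s \<le> (\<bar>Im u - Im v\<bar> + 2 * \<bar>cmod u - cmod v\<bar>) * ?s"
    by (simp add: algebra_simps)
  then show ?thesis using s by simp
qed

text \<open>
  Once the modulus of \<open>w\<close> is a Lipschitz function of the other complex variable, the last term is a distance in that
  variable and this becomes a transversality estimate. The sign \<open>s\<close> allows motion in either sense.
\<close>

lemma axis_transversal:
  assumes q: "axis w = q" "axis w' = q" and s: "\<bar>s\<bar> = (1::real)"
  shows "\<bar>t\<bar> \<le> 2 * cmod (w - w' - of_real (t * s) * q) + 2 * \<bar>cmod w - cmod w'\<bar>"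
proof -
  let ?v = "w - w' - of_real (t * s) * q"
  let ?u = "w * cnj q" and ?u' = "w' * cnj q"
  have qq: "q * cnj q = 1" "cmod q = 1" using q(1) by auto
  have v: "?v * cnj q = ?u - ?u' - of_real (t * s)"
    using qq(1) by (simp add: left_diff_distrib mult.assoc)
  have "\<bar>Re ?u - Re ?u'\<bar> \<le> \<bar>Im ?u - Im ?u'\<bar> + 2 * \<bar>cmod ?u - cmod ?u'\<bar>"
    using abs_Im_le_axis_part[of w] abs_Im_le_axis_part[of w'] q by (intro sector_lipschitz) (auto simp: axis_part_def)
  moreover have "cmod ?u = cmod w" "cmod ?u' = cmod w'" using qq by (simp_all add: norm_mult)
  moreover have "\<bar>Im (?v * cnj q)\<bar> \<le> cmod ?v" "\<bar>Re (?v * cnj q)\<bar> \<le> cmod ?v"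
    using abs_Im_le_cmod[of "?v * cnj q"] abs_Re_le_cmod[of "?v * cnj q"] qq by (simp_all add: norm_mult)
  moreover have "\<bar>t\<bar> = \<bar>t * s\<bar>" using s by (simp add: abs_mult)
  ultimately show ?thesis unfolding v by simp
qed

text \<open>
  On the boundary, \<open>0\<close> and \<open>1\<close> stand for the face \<open>|w| = 1\<close>, and \<open>2\<close> and \<open>3\<close> for the cone
  \<open>|z| = |w| < 1\<close>. The edge \<open>|z| = |w| = 1\<close> has to belong to the face: the direction used on the cone far from the
  origin keeps \<open>w\<close> fixed and does not enter the domain from there.
\<close>

definition kind :: "complex \<times> complex \<Rightarrow> nat" where
  "kind y = (if cmod (snd y) = 1 then (if cmod (fst y) \<le> 1/2 then 0 else 1) else (if cmod (fst y) \<le> 1/2 then 2 else 3))"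

text \<open>
  For \<open>|z| \<le> 1/2\<close> only \<open>w\<close> moves, into the wide annulus \<open>|z| < |w| < 1\<close>. On the rest of the
  cone \<open>z\<close> moves towards the origin, since \<open>w\<close> has no room near \<open>|w| = 1\<close>. On the rest of the face \<open>|w| = 1\<close>
  both move inwards; the factor \<open>4\<close> makes \<open>|z|\<close> decrease faster than \<open>|w|\<close>, also at the corner
  \<open>|z| = |w| = 1\<close>.
\<close>

fun direction :: "nat \<times> complex \<times> complex \<Rightarrow> complex \<times> complex" where
  "direction (k, p, q) = (if k = 0 then (0, - q) else if k = 1 then (- 4 * p, - q) else if k = 2 then (0, q) else (- p, 0))"

definition piece_index :: "complex \<times> complex \<Rightarrow> nat \<times> complex \<times> complex" where
  "piece_index y = (kind y, axis (fst y), axis (snd y))"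

definition index_set :: "(nat \<times> complex \<times> complex) set" where
  "index_set = {0, 1, 2, 3} \<times> {1, -1, \<i>, -\<i>} \<times> {1, -1, \<i>, -\<i>}"

definition piece :: "nat \<times> complex \<times> complex \<Rightarrow> (complex \<times> complex) set" where
  "piece i = {y \<in> frontier hartogs_triangle. piece_index y = i}"

lemma finite_index_set: "finite index_set"
  by (simp add: index_set_def)

lemma piece_index_in: "piece_index y \<in> index_set"
  using axis_cases[of "fst y"] axis_cases[of "snd y"] by (auto simp: piece_index_def index_set_def kind_def)

lemma open_hartogs: "open hartogs_triangle"
proof -
  have "hartogs_triangle = {y. cmod (fst y) < cmod (snd y)} \<inter> {y. cmod (snd y) < 1}"
    by (auto simp: hartogs_triangle_def)
  moreover have "open \<dots>"
    by (intro open_Int open_Collect_less continuous_intros)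
  ultimately show ?thesis by simp
qed

lemma closure_hartogs_subset: "closure hartogs_triangle \<subseteq> {y. cmod (fst y) \<le> cmod (snd y) \<and> cmod (snd y) \<le> 1}"
proof (rule closure_minimal)
  have "{y :: complex \<times> complex. cmod (fst y) \<le> cmod (snd y) \<and> cmod (snd y) \<le> 1} = {y. cmod (fst y) \<le> cmod (snd y)} \<inter> {y. cmod (snd y) \<le> 1}"
    by auto
  then show "closed {y :: complex \<times> complex. cmod (fst y) \<le> cmod (snd y) \<and> cmod (snd y) \<le> 1}"
    by (auto intro!: closed_Int closed_Collect_le continuous_intros)
qed (auto simp: hartogs_triangle_def)

lemma bounded_hartogs: "bounded hartogs_triangle" "bounded (frontier hartogs_triangle)"
proof -
  have "norm y \<le> 2" if "y \<in> closure hartogs_triangle" for y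
  proof -
    have "norm y \<le> cmod (fst y) + cmod (snd y)" using norm_Pair_le[of "fst y" "snd y"] by simp
    also have "\<dots> \<le> 2" using closure_hartogs_subset that by fastforce
    finally show ?thesis .
  qed
  then have "bounded (closure hartogs_triangle)" unfolding bounded_iff by blast
  then show "bounded hartogs_triangle" "bounded (frontier hartogs_triangle)"
    by (rule bounded_subset; simp add: frontier_def closure_subset)+
qed

lemma frontier_hartogs_cases:
  assumes "y \<in> frontier hartogs_triangle"
  shows "cmod (fst y) \<le> cmod (snd y)" "cmod (snd y) \<le> 1" "cmod (snd y) \<noteq> 1 \<Longrightarrow> cmod (fst y) = cmod (snd y)"
proof -
  have "y \<in> closure hartogs_triangle" "y \<notin> hartogs_triangle"
    using assms open_hartogs by (auto simp: frontier_def interior_open)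
  then show "cmod (fst y) \<le> cmod (snd y)" "cmod (snd y) \<le> 1" "cmod (snd y) \<noteq> 1 \<Longrightarrow> cmod (fst y) = cmod (snd y)"
    using closure_hartogs_subset by (fastforce simp: hartogs_triangle_def)+
qed

text \<open>
  Moving by \<open>c\<close> along the half-axis changes the squared modulus by \<open>2 c axis_part + c\<^sup>2\<close>, so the claims are
  quadratic inequalities in \<open>t\<close>; the bound \<open>1/20\<close> makes the linear terms dominate.
\<close>

lemma direction_enters:
  assumes y: "y \<in> frontier hartogs_triangle" and t: "0 < t" "t < 1/20"
  shows "y + t *\<^sub>R direction (piece_index y) \<in> hartogs_triangle"
proof -
  obtain z w where zw: "y = (z, w)" by (cases y)
  note fr = frontier_hartogs_cases[OF y, unfolded zw fst_conv snd_conv]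
  have mv: "(cmod (v - of_real c * axis v))\<^sup>2 = (cmod v)\<^sup>2 - 2 * c * axis_part v + c\<^sup>2" for v c
    using cmod_move_along_axis[of v "- c"] by simp
  \<comment> \<open>\<open>7/20\<close> is slightly below \<open>1 / sqrt 8\<close>; the corner case needs \<open>4 * 7/20 > 1\<close> with some room\<close>
  have ax: "7/20 \<le> axis_part v" if "1/2 \<le> cmod v" for v
  proof (rule power2_le_imp_le)
    have "(1/2)\<^sup>2 \<le> (cmod v)\<^sup>2" using that by (intro power_mono) auto
    then show "(7/20)\<^sup>2 \<le> (axis_part v)\<^sup>2" using axis_part_bounds(2)[of v] by (simp add: power2_eq_square)
  qed (rule axis_part_bounds)
  have tt: "0 < t\<^sup>2" using t by simp
  consider "cmod w = 1" "cmod z \<le> 1/2" | "cmod w = 1" "\<not> cmod z \<le> 1/2"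
    | "cmod w \<noteq> 1" "cmod z \<le> 1/2" | "cmod w \<noteq> 1" "\<not> cmod z \<le> 1/2" by blast
  then show ?thesis
  proof cases
    case 1
    have "t * t < t * (2 * axis_part w)" using t ax[of w] 1 by (intro mult_strict_left_mono) auto
    then have "(cmod (w - of_real t * axis w))\<^sup>2 < 1\<^sup>2" unfolding mv using 1 by (simp add: power2_eq_square)
    then have "cmod (w - of_real t * axis w) < 1" by (rule power2_less_imp_less) simp
    moreover have "cmod w - cmod (of_real t * axis w) \<le> cmod (w - of_real t * axis w)" by (rule norm_triangle_ineq2)
    then have "cmod z < cmod (w - of_real t * axis w)" using 1 t by (simp add: norm_mult)
    ultimately show ?thesis using 1 by (simp add: zw piece_index_def kind_def hartogs_triangle_def scaleR_conv_of_real)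
  next
    case 2
    have "t * t < t * (2 * axis_part w)" using t ax[of w] 2 by (intro mult_strict_left_mono) auto
    then have "(cmod (w - of_real t * axis w))\<^sup>2 < 1\<^sup>2" unfolding mv using 2 by (simp add: power2_eq_square)
    then have "cmod (w - of_real t * axis w) < 1" by (rule power2_less_imp_less) simp
    moreover have "(cmod (z - of_real (4 * t) * axis z))\<^sup>2 < (cmod (w - of_real t * axis w))\<^sup>2"
    proof -
      \<comment> \<open>the linear gain is at least \<open>2 * (4 * 7/20 - 1) * t\<close>, the quadratic loss is \<open>15 * t\<^sup>2\<close>\<close>
      have "t * (7/20) \<le> t * axis_part z" using t ax[of z] 2 by (intro mult_left_mono) auto
      moreover have "t * axis_part w \<le> t * 1" using t axis_part_bounds(3)[of w] 2 by (intro mult_left_mono) auto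
      moreover have "t * t < t * (1/20)" using t by (intro mult_strict_left_mono) auto
      moreover have "(cmod z)\<^sup>2 \<le> 1" using fr 2 by (simp add: power_le_one)
      moreover have "(4 * t)\<^sup>2 = 16 * (t * t)" "t\<^sup>2 = t * t" by (simp_all add: power2_eq_square)
      moreover have "(cmod w)\<^sup>2 = 1" using 2 by simp
      ultimately show ?thesis unfolding mv using t(1) by linarith
    qed
    then have "cmod (z - of_real (4 * t) * axis z) < cmod (w - of_real t * axis w)" by (rule power2_less_imp_less) simp
    ultimately show ?thesis using 2
      by (simp add: zw piece_index_def kind_def hartogs_triangle_def scaleR_conv_of_real mult.assoc mult.left_commute)
  next
    case 3
    have "0 \<le> t * axis_part w" using t axis_part_bounds(1)[of w] by simp
    then have "(cmod z)\<^sup>2 < (cmod (w + of_real t * axis w))\<^sup>2"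
      unfolding cmod_move_along_axis fr(3)[OF 3(1)] using tt by linarith
    then have "cmod z < cmod (w + of_real t * axis w)" by (rule power2_less_imp_less) simp
    moreover have "cmod (w + of_real t * axis w) \<le> cmod w + t"
      using norm_triangle_ineq[of w "of_real t * axis w"] t by (simp add: norm_mult)
    then have "cmod (w + of_real t * axis w) < 1" using fr(3) 3 t by simp
    ultimately show ?thesis using 3 by (simp add: zw piece_index_def kind_def hartogs_triangle_def scaleR_conv_of_real)
  next
    case 4
    have "t * t < t * (2 * axis_part z)" using t ax[of z] 4 by (intro mult_strict_left_mono) auto
    then have "(cmod (z - of_real t * axis z))\<^sup>2 < (cmod w)\<^sup>2" unfolding mv using 4 fr(3) by (simp add: power2_eq_square)
    then have "cmod (z - of_real t * axis z) < cmod w" by (rule power2_less_imp_less) simp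
    moreover have "cmod w < 1" using fr(2) 4 by simp
    ultimately show ?thesis using 4 by (simp add: zw piece_index_def kind_def hartogs_triangle_def scaleR_conv_of_real)
  qed
qed

text \<open>
  On \<open>|w| = 1\<close> the modulus of \<open>w\<close> is constant; on the cone the modulus of the moving variable equals that
  of the other one. Both are Lipschitz functions of the remaining variables.
\<close>

lemma piece_transversal: "transversal (piece i) (direction i) 4"
  unfolding transversal_def
proof (intro ballI allI)
  fix y y' t assume y: "y \<in> piece i" and y': "y' \<in> piece i"
  obtain z w z' w' where zw: "y = (z, w)" "y' = (z', w')" by (cases y, cases y') auto
  obtain k p q where i: "i = (k, p, q)" by (cases i)
  have ax: "axis z = p" "axis z' = p" "axis w = q" "axis w' = q" and kd: "kind (z, w) = k" "kind (z', w') = k"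
    using y y' by (auto simp: piece_def piece_index_def zw i)
  note fr = frontier_hartogs_cases[of "(z, w)", unfolded fst_conv snd_conv] frontier_hartogs_cases[of "(z', w')", unfolded fst_conv snd_conv]
  have f: "(z, w) \<in> frontier hartogs_triangle" "(z', w') \<in> frontier hartogs_triangle"
    using y y' by (auto simp: piece_def zw)
  let ?e = "direction i"
  let ?n = "norm (y - y' - t *\<^sub>R ?e)"
  have nz: "cmod (z - z' - t *\<^sub>R fst ?e) \<le> ?n" and nw: "cmod (w - w' - t *\<^sub>R snd ?e) \<le> ?n"
    using norm_fst_le[of "z - z' - t *\<^sub>R fst ?e" "w - w' - t *\<^sub>R snd ?e"]
      norm_snd_le[of "w - w' - t *\<^sub>R snd ?e" "z - z' - t *\<^sub>R fst ?e"]
    by (simp_all add: zw minus_prod_def scaleR_prod_def)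
  have k4: "k = 0 \<or> k = 1 \<or> k = 2 \<or> k = 3" using kd by (auto simp: kind_def split: if_splits)
  then consider (outer) "k = 0 \<or> k = 1" | (inner) "k = 2" | (corner) "k = 3" by blast
  then show "\<bar>t\<bar> \<le> 4 * ?n"
  proof cases
    case outer
    then have "cmod w = 1" "cmod w' = 1" using kd by (auto simp: kind_def split: if_splits)
    moreover have "snd ?e = - q" using outer by (auto simp: i)
    ultimately have "\<bar>t\<bar> \<le> 2 * ?n"
      using axis_transversal[of w q w' "-1" t] ax nw by (simp add: scaleR_conv_of_real)
    then show ?thesis by simp
  next
    case inner
    then have "cmod z = cmod w" "cmod z' = cmod w'" using kd fr f by (auto simp: kind_def split: if_splits)
    moreover have "?e = (0, q)" using inner by (simp add: i)
    moreover have "\<bar>cmod z - cmod z'\<bar> \<le> cmod (z - z')" by (rule norm_triangle_ineq3)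
    ultimately show ?thesis
      using axis_transversal[of w q w' 1 t] ax nw nz by (simp add: scaleR_conv_of_real)
  next
    case corner
    then have "cmod z = cmod w" "cmod z' = cmod w'" using kd fr f by (auto simp: kind_def split: if_splits)
    moreover have "?e = (- p, 0)" using corner by (simp add: i)
    moreover have "\<bar>cmod w - cmod w'\<bar> \<le> cmod (w - w')" by (rule norm_triangle_ineq3)
    ultimately show ?thesis
      using axis_transversal[of z p z' "-1" t] ax nw nz by (simp add: scaleR_conv_of_real)
  qed
qed

lemma kind_measurable: "{y. kind y = k} \<in> sets borel"
proof -
  have [measurable]: "Measurable.pred borel (\<lambda>y :: complex \<times> complex. cmod (snd y) = 1)"
    "Measurable.pred borel (\<lambda>y :: complex \<times> complex. cmod (fst y) \<le> 1/2)"
    by (auto intro!: borel_closed closed_Collect_eq closed_Collect_le continuous_intros simp: pred_def)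
  have "Measurable.pred borel (\<lambda>y. kind y = k)"
    unfolding kind_def by measurable
  then show ?thesis by (simp add: pred_def)
qed

lemma piece_borel: "piece i \<in> sets borel"
proof -
  obtain k p q where i: "i = (k, p, q)" by (cases i)
  have "(\<lambda>y :: complex \<times> complex. axis (fst y)) \<in> borel_measurable borel" "(\<lambda>y :: complex \<times> complex. axis (snd y)) \<in> borel_measurable borel"
    by (simp_all flip: borel_prod)
  from measurable_sets[OF this(1), of "{p}"] measurable_sets[OF this(2), of "{q}"]
  have "{y :: complex \<times> complex. axis (fst y) = p} \<in> sets borel" "{y :: complex \<times> complex. axis (snd y) = q} \<in> sets borel"
    by (simp_all add: vimage_def)
  moreover have "frontier hartogs_triangle \<in> sets borel" by simp
  moreover have "piece i = frontier hartogs_triangle \<inter> {y. kind y = k} \<inter> {y. axis (fst y) = p} \<inter> {y. axis (snd y) = q}"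
    by (auto simp: piece_def piece_index_def i)
  ultimately show ?thesis using kind_measurable[of k] by auto
qed

lemma transversal_piece_hartogs:
  assumes "i \<in> index_set"
  shows "transversal_piece hartogs_triangle (piece i) (direction i) 4 (1/20)"
proof
  show "bounded (piece i)" using bounded_hartogs(2) by (rule bounded_subset) (auto simp: piece_def)
  show "direction i \<noteq> 0" using assms by (auto simp: index_set_def zero_prod_def)
  show "y + t *\<^sub>R direction i \<in> hartogs_triangle" if "y \<in> piece i" "0 < t" "t < 1/20" for y t
    using direction_enters[of y t] that by (auto simp: piece_def)
qed (use open_hartogs bounded_hartogs piece_borel piece_transversal in auto)

section \<open>The trace operator\<close>

lemma hartogs_surface_measure_eq: "hartogs_surface_measure = surface_on (frontier hartogs_triangle)"
  by (simp add: hartogs_surface_measure_def surface_on_def)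

lemma AE_surface_on_iff:
  assumes "S \<in> sets borel"
  shows "(AE y in surface_on S. P y) \<longleftrightarrow> (AE y in hausdorff_measure (DIM('a) - 1). y \<in> (S :: 'a::euclidean_space set) \<longrightarrow> P y)"
  unfolding surface_on_def using assms by (intro AE_restrict_space_iff) simp

lemma AE_hartogs_surfaceI:
  assumes "\<And>i. i \<in> index_set \<Longrightarrow> AE y in surface_on (piece i). P i y"
  shows "AE y in hartogs_surface_measure. P (piece_index y) y"
proof -
  have "AE y in hausdorff_measure (DIM(complex \<times> complex) - 1). \<forall>i\<in>index_set. y \<in> piece i \<longrightarrow> P i y"
    using assms by (intro AE_finite_allI finite_index_set) (simp only: AE_surface_on_iff[OF piece_borel, symmetric])
  then have "AE y in hausdorff_measure (DIM(complex \<times> complex) - 1). y \<in> frontier hartogs_triangle \<longrightarrow> P (piece_index y) y"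
    by eventually_elim (use piece_index_in in \<open>auto simp: piece_def\<close>)
  then show ?thesis
    unfolding hartogs_surface_measure_eq by (subst AE_surface_on_iff) auto
qed

text \<open>
  Determined only up to null sets: the operator below chooses a Borel function with this property.
\<close>

definition is_trace :: "(complex \<times> complex \<Rightarrow> complex) \<Rightarrow> (complex \<times> complex \<Rightarrow> complex) \<Rightarrow> bool" where
  "is_trace f h \<longleftrightarrow> h \<in> borel_measurable hartogs_surface_measure \<and>
     (AE y in hartogs_surface_measure. (\<lambda>n. line_average (direction (piece_index y)) f n y) \<longlonglongrightarrow> h y)"

lemma trace_unique:
  assumes "is_trace f h" "is_trace f k"
  shows "AE y in hartogs_surface_measure. h y = k y"
proof -
  from assms have "AE y in hartogs_surface_measure. (\<lambda>n. line_average (direction (piece_index y)) f n y) \<longlonglongrightarrow> h y"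
    "AE y in hartogs_surface_measure. (\<lambda>n. line_average (direction (piece_index y)) f n y) \<longlonglongrightarrow> k y"
    by (auto simp: is_trace_def)
  then show ?thesis by eventually_elim (rule LIMSEQ_unique)
qed

lemma trace_exists:
  "\<exists>C\<ge>0. \<forall>f\<in>W1_space hartogs_triangle. \<exists>h. is_trace f h \<and>
     (\<integral>\<^sup>+y. ennreal ((cmod (h y))\<^sup>2) \<partial>hartogs_surface_measure) \<le> ennreal (C * (W1_norm hartogs_triangle f)\<^sup>2)"
proof -
  let ?H = "hausdorff_measure (DIM(complex \<times> complex) - 1) :: (complex \<times> complex) measure"
  have "\<forall>i\<in>index_set. \<exists>C\<ge>0. \<forall>f\<in>W1_space hartogs_triangle. \<exists>h. h \<in> borel_measurable (surface_on (piece i)) \<and>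
     (AE y in surface_on (piece i). (\<lambda>n. line_average (direction i) f n y) \<longlonglongrightarrow> h y) \<and>
     (\<integral>\<^sup>+y. ennreal ((cmod (h y))\<^sup>2) \<partial>surface_on (piece i)) \<le> ennreal (C * (W1_norm hartogs_triangle f)\<^sup>2)"
    using transversal_piece.trace_bound_exists[OF transversal_piece_hartogs] by meson
  from bchoice[OF this] obtain C where C: "\<And>i. i \<in> index_set \<Longrightarrow> 0 \<le> C i"
    "\<And>i f. i \<in> index_set \<Longrightarrow> f \<in> W1_space hartogs_triangle \<Longrightarrow> \<exists>h. h \<in> borel_measurable (surface_on (piece i)) \<and>
     (AE y in surface_on (piece i). (\<lambda>n. line_average (direction i) f n y) \<longlonglongrightarrow> h y) \<and>
     (\<integral>\<^sup>+y. ennreal ((cmod (h y))\<^sup>2) \<partial>surface_on (piece i)) \<le> ennreal (C i * (W1_norm hartogs_triangle f)\<^sup>2)"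
    by blast
  have "\<exists>h. is_trace f h \<and>
     (\<integral>\<^sup>+y. ennreal ((cmod (h y))\<^sup>2) \<partial>hartogs_surface_measure) \<le> ennreal ((\<Sum>i\<in>index_set. C i) * (W1_norm hartogs_triangle f)\<^sup>2)"
    if f: "f \<in> W1_space hartogs_triangle" for f
  proof -
    let ?W = "(W1_norm hartogs_triangle f)\<^sup>2"
    have "\<forall>i\<in>index_set. \<exists>h. h \<in> borel_measurable (surface_on (piece i)) \<and>
     (AE y in surface_on (piece i). (\<lambda>n. line_average (direction i) f n y) \<longlonglongrightarrow> h y) \<and>
     (\<integral>\<^sup>+y. ennreal ((cmod (h y))\<^sup>2) \<partial>surface_on (piece i)) \<le> ennreal (C i * ?W)"
      using C(2)[OF _ f] by blast
    from bchoice[OF this] obtain h where h: "\<And>i. i \<in> index_set \<Longrightarrow> h i \<in> borel_measurable (surface_on (piece i))"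
      "\<And>i. i \<in> index_set \<Longrightarrow> AE y in surface_on (piece i). (\<lambda>n. line_average (direction i) f n y) \<longlonglongrightarrow> h i y"
      "\<And>i. i \<in> index_set \<Longrightarrow> (\<integral>\<^sup>+y. ennreal ((cmod (h i y))\<^sup>2) \<partial>surface_on (piece i)) \<le> ennreal (C i * ?W)"
      by blast
    define k where "k y = (\<Sum>i\<in>index_set. indicat_real (piece i) y *\<^sub>R h i y)" for y
    have hm: "(\<lambda>y. indicat_real (piece i) y *\<^sub>R h i y) \<in> borel_measurable ?H" if "i \<in> index_set" for i
      using h(1)[OF that] unfolding surface_on_def by (subst (asm) borel_measurable_restrict_space_iff) (auto simp: piece_borel)
    have km: "k \<in> borel_measurable ?H"
      unfolding k_def by (intro borel_measurable_sum hm)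
    have k: "k y = h (piece_index y) y" if "y \<in> frontier hartogs_triangle" for y
    proof -
      have "k y = (\<Sum>i\<in>index_set. if i = piece_index y then h i y else 0)"
        unfolding k_def using that by (intro sum.cong) (auto simp: piece_def)
      then show ?thesis using piece_index_in finite_index_set by simp
    qed
    have "is_trace f k"
      unfolding is_trace_def
    proof
      show "k \<in> borel_measurable hartogs_surface_measure"
        unfolding hartogs_surface_measure_eq surface_on_def by (rule measurable_restrict_space1[OF km])
      have "AE y in hartogs_surface_measure. (\<lambda>n. line_average (direction (piece_index y)) f n y) \<longlonglongrightarrow> h (piece_index y) y"
        by (rule AE_hartogs_surfaceI[OF h(2)])
      moreover have "AE y in hartogs_surface_measure. y \<in> frontier hartogs_triangle"
        by (rule AE_I2) (simp add: hartogs_surface_measure_def space_restrict_space)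
      ultimately show "AE y in hartogs_surface_measure. (\<lambda>n. line_average (direction (piece_index y)) f n y) \<longlonglongrightarrow> k y"
        by eventually_elim (simp add: k)
    qed
    moreover have "(\<integral>\<^sup>+y. ennreal ((cmod (k y))\<^sup>2) \<partial>hartogs_surface_measure) \<le> ennreal ((\<Sum>i\<in>index_set. C i) * ?W)"
    proof -
      have "(\<integral>\<^sup>+y. ennreal ((cmod (k y))\<^sup>2) \<partial>hartogs_surface_measure) = (\<integral>\<^sup>+y. ennreal ((cmod (k y))\<^sup>2) * indicator (frontier hartogs_triangle) y \<partial>?H)"
        unfolding hartogs_surface_measure_eq surface_on_def by (rule nn_integral_restrict_space) simp
      also have "\<dots> \<le> (\<integral>\<^sup>+y. (\<Sum>i\<in>index_set. ennreal ((cmod (indicat_real (piece i) y *\<^sub>R h i y))\<^sup>2)) \<partial>?H)"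
      proof (rule nn_integral_mono)
        fix y
        show "ennreal ((cmod (k y))\<^sup>2) * indicator (frontier hartogs_triangle) y \<le> (\<Sum>i\<in>index_set. ennreal ((cmod (indicat_real (piece i) y *\<^sub>R h i y))\<^sup>2))"
        proof (cases "y \<in> frontier hartogs_triangle")
          case True
          then have "y \<in> piece (piece_index y)" by (simp add: piece_def)
          then have "ennreal ((cmod (k y))\<^sup>2) * indicator (frontier hartogs_triangle) y = ennreal ((cmod (indicat_real (piece (piece_index y)) y *\<^sub>R h (piece_index y) y))\<^sup>2)"
            using True by (simp add: k)
          also have "\<dots> \<le> (\<Sum>i\<in>index_set. ennreal ((cmod (indicat_real (piece i) y *\<^sub>R h i y))\<^sup>2))"
            by (rule member_le_sum[OF piece_index_in]) (auto simp: finite_index_set)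
          finally show ?thesis .
        qed simp
      qed
      also have "\<dots> = (\<Sum>i\<in>index_set. \<integral>\<^sup>+y. ennreal ((cmod (indicat_real (piece i) y *\<^sub>R h i y))\<^sup>2) \<partial>?H)"
      proof (rule nn_integral_sum)
        fix i assume "i \<in> index_set"
        from measurable_compose[OF hm[OF this], of "\<lambda>z. ennreal ((cmod z)\<^sup>2)" borel]
        show "(\<lambda>y. ennreal ((cmod (indicat_real (piece i) y *\<^sub>R h i y))\<^sup>2)) \<in> borel_measurable ?H" by simp
      qed
      also have "\<dots> = (\<Sum>i\<in>index_set. \<integral>\<^sup>+y. ennreal ((cmod (h i y))\<^sup>2) \<partial>surface_on (piece i))"
      proof (rule sum.cong[OF refl])
        fix i
        have "(\<integral>\<^sup>+y. ennreal ((cmod (h i y))\<^sup>2) \<partial>surface_on (piece i)) = (\<integral>\<^sup>+y. ennreal ((cmod (h i y))\<^sup>2) * indicator (piece i) y \<partial>?H)"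
          unfolding surface_on_def by (rule nn_integral_restrict_space) (simp add: piece_borel)
        also have "\<dots> = (\<integral>\<^sup>+y. ennreal ((cmod (indicat_real (piece i) y *\<^sub>R h i y))\<^sup>2) \<partial>?H)"
          by (intro nn_integral_cong) (auto simp: indicator_def)
        finally show "(\<integral>\<^sup>+y. ennreal ((cmod (indicat_real (piece i) y *\<^sub>R h i y))\<^sup>2) \<partial>?H) = (\<integral>\<^sup>+y. ennreal ((cmod (h i y))\<^sup>2) \<partial>surface_on (piece i))" ..
      qed
      also have "\<dots> \<le> (\<Sum>i\<in>index_set. ennreal (C i * ?W))" by (intro sum_mono h(3))
      also have "\<dots> = ennreal (\<Sum>i\<in>index_set. C i * ?W)" using C(1) by (intro sum_ennreal) auto
      finally show ?thesis by (simp add: sum_distrib_right)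
    qed
    ultimately show ?thesis by blast
  qed
  moreover have "0 \<le> (\<Sum>i\<in>index_set. C i)" using C(1) by (rule sum_nonneg)
  ultimately show ?thesis by blast
qed

lemma integrable_on_lines:
  assumes "f \<in> W1_space hartogs_triangle"
  shows "AE y in hartogs_surface_measure. (\<lambda>t. f (y + t *\<^sub>R direction (piece_index y))) integrable_on {0..1/20}"
proof (rule AE_hartogs_surfaceI)
  fix i assume "i \<in> index_set"
  from transversal_piece.trace_bound_exists[OF transversal_piece_hartogs[OF this]] assms
  show "AE y in surface_on (piece i). (\<lambda>t. f (y + t *\<^sub>R direction i)) integrable_on {0..1/20}" by blast
qed

lemma is_trace_cong:
  assumes "is_trace g h" and eq: "AE x in lebesgue_on hartogs_triangle. f x = g x"
  shows "is_trace f h"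
proof -
  have "AE y in hartogs_surface_measure. \<forall>\<^sub>F n in sequentially. line_average (direction (piece_index y)) f n y = line_average (direction (piece_index y)) g n y"
  proof (rule AE_hartogs_surfaceI)
    fix i assume "i \<in> index_set"
    then interpret transversal_piece hartogs_triangle "piece i" "direction i" 4 "1/20" by (rule transversal_piece_hartogs)
    show "AE y in surface_on (piece i). \<forall>\<^sub>F n in sequentially. line_average (direction i) f n y = line_average (direction i) g n y"
      using equal_on_lines[OF eq] by eventually_elim (rule line_average_cong(1))
  qed
  moreover have "AE y in hartogs_surface_measure. (\<lambda>n. line_average (direction (piece_index y)) g n y) \<longlonglongrightarrow> h y"
    using assms(1) by (simp add: is_trace_def)
  ultimately have "AE y in hartogs_surface_measure. (\<lambda>n. line_average (direction (piece_index y)) f n y) \<longlonglongrightarrow> h y"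
  proof eventually_elim
    case (elim y)
    from elim(1) have "\<forall>\<^sub>F n in sequentially. line_average (direction (piece_index y)) g n y = line_average (direction (piece_index y)) f n y"
      by eventually_elim simp
    with elim(2) show ?case by (rule Lim_transform_eventually)
  qed
  with assms(1) show ?thesis by (simp add: is_trace_def)
qed

lemma is_trace_add:
  assumes "is_trace f h" "is_trace g k" and W: "f \<in> W1_space hartogs_triangle" "g \<in> W1_space hartogs_triangle"
  shows "is_trace (\<lambda>x. f x + g x) (\<lambda>y. h y + k y)"
proof -
  have "AE y in hartogs_surface_measure. (\<lambda>n. line_average (direction (piece_index y)) (\<lambda>x. f x + g x) n y) \<longlonglongrightarrow> h y + k y"
    using integrable_on_lines[OF W(1)] integrable_on_lines[OF W(2)]
      assms(1)[unfolded is_trace_def, THEN conjunct2] assms(2)[unfolded is_trace_def, THEN conjunct2]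
  proof eventually_elim
    case (elim y)
    let ?e = "direction (piece_index y)"
    have "line_average ?e f n y + line_average ?e g n y = line_average ?e (\<lambda>x. f x + g x) n y" if "20 \<le> n" for n
    proof -
      have "{0..1 / real (Suc n)} \<subseteq> {0..1/20}" using that by (auto simp: field_simps)
      then show ?thesis
        unfolding line_average_def
        using integrable_on_subinterval[OF elim(1)] integrable_on_subinterval[OF elim(2)]
        by (simp add: Henstock_Kurzweil_Integration.integral_add scaleR_add_right)
    qed
    then have "\<forall>\<^sub>F n in sequentially. line_average ?e f n y + line_average ?e g n y = line_average ?e (\<lambda>x. f x + g x) n y"
      using eventually_sequentially by blast
    with tendsto_add[OF elim(3,4)] show ?case by (rule Lim_transform_eventually)
  qed
  with assms(1,2) show ?thesis unfolding is_trace_def by (intro conjI borel_measurable_add) auto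
qed

lemma is_trace_cmult:
  assumes "is_trace f h"
  shows "is_trace (\<lambda>x. c * f x) (\<lambda>y. c * h y)"
proof -
  have "line_average e (\<lambda>x. c * f x) n y = c * line_average e f n y" for e n y
    by (simp add: line_average_def)
  with assms show ?thesis
    unfolding is_trace_def by (auto elim!: eventually_mono intro: tendsto_mult_left)
qed

lemma continuous_line_average:
  assumes f: "continuous_on (closure hartogs_triangle) f" and y: "y \<in> frontier hartogs_triangle"
  shows "(\<lambda>n. line_average (direction (piece_index y)) f n y) \<longlonglongrightarrow> f y"
proof -
  let ?e = "direction (piece_index y)"
  have "y + t *\<^sub>R ?e \<in> closure hartogs_triangle" if "t \<in> {0..1/40}" for t
  proof (cases "t = 0")
    case True with y show ?thesis by (simp add: frontier_def)
  next
    case False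
    with that show ?thesis using direction_enters[OF y, of t] closure_subset by auto
  qed
  then have "continuous_on {0..1/40} (\<lambda>t. f (y + t *\<^sub>R ?e))"
    by (intro continuous_on_compose2[OF f]) (auto intro!: continuous_intros)
  from average_tendsto[OF _ this, of "\<lambda>t. f (y + t *\<^sub>R ?e)"] show ?thesis
    by (simp add: line_average_def)
qed

theorem corollary2p15:
  shows "\<exists>\<tau> :: (complex \<times> complex \<Rightarrow> complex) \<Rightarrow> complex \<times> complex \<Rightarrow> complex.
    bounded_operator_W1_L2 hartogs_triangle hartogs_surface_measure \<tau> \<and>
    (\<forall>f. continuous_on (closure hartogs_triangle) f \<and> f \<in> W1_space hartogs_triangle \<longrightarrow>
      (AE x in hartogs_surface_measure. \<tau> f x = f x))"
proof -
  let ?M = hartogs_surface_measure and ?T = hartogs_triangle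
  obtain C where C: "0 \<le> C" "\<And>f. f \<in> W1_space ?T \<Longrightarrow> \<exists>h. is_trace f h \<and>
     (\<integral>\<^sup>+y. ennreal ((cmod (h y))\<^sup>2) \<partial>?M) \<le> ennreal (C * (W1_norm ?T f)\<^sup>2)"
    using trace_exists by blast
  define \<tau> where "\<tau> f = (SOME h. is_trace f h)" for f
  have tr: "is_trace f (\<tau> f)" if "is_trace f h" for f h
    unfolding \<tau>_def by (rule someI[of "is_trace f", OF that])
  have trW: "is_trace f (\<tau> f)" if "f \<in> W1_space ?T" for f
    using C(2)[OF that] tr by blast
  have bound: "(\<integral>\<^sup>+y. ennreal ((cmod (\<tau> f y))\<^sup>2) \<partial>?M) \<le> ennreal (C * (W1_norm ?T f)\<^sup>2)" if f: "f \<in> W1_space ?T" for f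
  proof -
    obtain h where h: "is_trace f h" "(\<integral>\<^sup>+y. ennreal ((cmod (h y))\<^sup>2) \<partial>?M) \<le> ennreal (C * (W1_norm ?T f)\<^sup>2)"
      using C(2)[OF f] by blast
    have "AE y in ?M. \<tau> f y = h y" by (rule trace_unique[OF tr[OF h(1)] h(1)])
    then have "(\<integral>\<^sup>+y. ennreal ((cmod (\<tau> f y))\<^sup>2) \<partial>?M) = (\<integral>\<^sup>+y. ennreal ((cmod (h y))\<^sup>2) \<partial>?M)"
      by (intro nn_integral_cong_AE) (auto elim!: eventually_mono)
    with h(2) show ?thesis by simp
  qed
  have m: "\<tau> f \<in> borel_measurable ?M" if "f \<in> W1_space ?T" for f
    using trW[OF that] by (simp add: is_trace_def)
  have i: "integrable ?M (\<lambda>y. (cmod (\<tau> f y))\<^sup>2)" if "f \<in> W1_space ?T" for f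
  proof (rule integrableI_bounded)
    show "(\<lambda>y. (cmod (\<tau> f y))\<^sup>2) \<in> borel_measurable ?M" using m[OF that] by simp
    show "(\<integral>\<^sup>+y. ennreal (norm ((cmod (\<tau> f y))\<^sup>2)) \<partial>?M) < \<infinity>"
      using le_less_trans[OF bound[OF that]] by simp
  qed
  have "L2_norm ?M (\<tau> f) \<le> sqrt C * W1_norm ?T f" if f: "f \<in> W1_space ?T" for f
  proof -
    have "ennreal (LINT y|?M. (cmod (\<tau> f y))\<^sup>2) \<le> ennreal (C * (W1_norm ?T f)\<^sup>2)"
      using bound[OF f] by (subst (asm) nn_integral_eq_integral[OF i[OF f]]) auto
    then have "(LINT y|?M. (cmod (\<tau> f y))\<^sup>2) \<le> C * (W1_norm ?T f)\<^sup>2"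
      using C(1) by (subst (asm) ennreal_le_iff) auto
    then have "L2_norm ?M (\<tau> f) \<le> sqrt (C * (W1_norm ?T f)\<^sup>2)" by (simp add: L2_norm_def)
    also have "\<dots> = sqrt C * \<bar>W1_norm ?T f\<bar>" by (simp add: real_sqrt_mult)
    also have "\<bar>W1_norm ?T f\<bar> = W1_norm ?T f"
      unfolding W1_norm_def by (intro abs_of_nonneg real_sqrt_ge_zero add_nonneg_nonneg sum_nonneg) auto
    finally show ?thesis .
  qed
  moreover have "AE y in ?M. \<tau> f y = \<tau> g y"
    if "f \<in> W1_space ?T" "g \<in> W1_space ?T" "AE x in lebesgue_on ?T. f x = g x" for f g
    by (rule trace_unique[OF trW[OF that(1)] is_trace_cong[OF trW[OF that(2)] that(3)]])
  moreover have "AE y in ?M. \<tau> (\<lambda>x. f x + g x) y = \<tau> f y + \<tau> g y"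
    if "f \<in> W1_space ?T" "g \<in> W1_space ?T" for f g
  proof -
    have a: "is_trace (\<lambda>x. f x + g x) (\<lambda>y. \<tau> f y + \<tau> g y)"
      by (rule is_trace_add[OF trW[OF that(1)] trW[OF that(2)] that])
    show ?thesis by (rule trace_unique[OF tr[OF a] a])
  qed
  moreover have "AE y in ?M. \<tau> (\<lambda>x. c * f x) y = c * \<tau> f y" if "f \<in> W1_space ?T" for f c
  proof -
    have a: "is_trace (\<lambda>x. c * f x) (\<lambda>y. c * \<tau> f y)" by (rule is_trace_cmult[OF trW[OF that]])
    show ?thesis by (rule trace_unique[OF tr[OF a] a])
  qed
  ultimately have "bounded_operator_W1_L2 ?T ?M \<tau>"
    unfolding bounded_operator_W1_L2_def L2_space_def using m i by blast
  moreover have "AE y in ?M. \<tau> f y = f y" if f: "continuous_on (closure ?T) f" "f \<in> W1_space ?T" for f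
  proof -
    have "AE y in ?M. y \<in> frontier ?T"
      by (rule AE_I2) (simp add: hartogs_surface_measure_def space_restrict_space)
    moreover have "AE y in ?M. (\<lambda>n. line_average (direction (piece_index y)) f n y) \<longlonglongrightarrow> \<tau> f y"
      using trW[OF f(2)] by (simp add: is_trace_def)
    ultimately show ?thesis
      by eventually_elim (rule LIMSEQ_unique[OF _ continuous_line_average[OF f(1)]])
  qed
  ultimately show ?thesis by blast
qed

end
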